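(* For every integer $k\geq 3$ there is a constant $C_k>0$, depending only on $k$, such that the following holds for all integers $\ell\geq 2$ and $n\neq 0$. If $A$ is a set of positive integers such that there exists a positive integer $a_0$ for which $a_0\prod_{a\in B}a+n$ is a perfect $k$-th power for each subset $B$ of $A$ with size $\ell$, then $$|A|\leq C_k\left(\ell+\frac{\log(|n|+1)}{\ell}\right).$$
   Context: A perfect $k$-th power is the $k$-th power of an integer. *)

theory Defs
  imports Complex_Main "HOL-Computational_Algebra.Nth_Powers"
begin

end

theory Submission
  imports Defs "HOL-Analysis.Analysis" "HOL-Number_Theory.Number_Theory"
    "HOL-Computational_Algebra.Squarefree" "HOL-Real_Asymp.Real_Asymp"
begin

text \<open>
  Let N = |n| + 1 and let F be a finite subset of A with at least l elements. Multiplying a0 by the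
  l - 2 largest elements of F gives an integer c such that c a b + n is a k-th power for any two
  distinct remaining elements a, b. The remaining elements are separated by the size of
  a sqrt(c), whose logarithm is called lsize below, relative to 3 k log N.

  Large elements: their number is bounded in terms of k alone (large_elements_bounded). For a < b
  and u < v, the two k-th powers (c a u + n)(c b v + n) and (c a v + n)(c b u + n) are very close to
  each other but distinct, which forces lsize to grow geometrically along the large elements
  (gap_principle). On the other hand, if a1 < a2 < a3 < a4 are large, the quotients of the k-th
  roots of c a1 aj + n and c a2 aj + n, for j = 3 and j = 4, are two extremely good rational
  approximations to the k-th root of a1 / a2. When lsize grows fast enough this contradicts Thue's
  method, which is carried out with the explicit Pade approximants of (1 + z) to the power 1/k
  (four_rapidly_growing_impossible). Here k > 2 enters: two approximations of exponent almost k
  exclude each other as soon as k exceeds k/2 + 1.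

  Small elements: let M be the largest of them. Since all l - 2 factors absorbed into c are at least
  M, one gets l log M = O(log N) and log c = O(log N). Fix a prime q dividing k. For a prime
  p = 1 mod q not dividing c n, the small elements occupy at most O(sqrt p) residue classes
  mod p (card_residues_le_if_pairwise_powers), because c a b + n must always be a q-th power
  residue. Gallagher's larger sieve with the primes of this kind between x and K x, where x is a
  multiple of (l + log N / l) squared, bounds the number of small elements by
  O(l + log N / l) (small_elements_bounded). The primes dividing c n have total logarithmic weight
  O(log N), which is negligible against x.

  The sieve requires that the primes p = 1 mod q between x and K x have total weight at least
  x (primes_cong_1_dense). This follows from Dirichlet's theorem in the form of Mertens, proved
  along the lines of Shapiro: the sums of chi(d) Lambda(d) / d are bounded for every
  nonprincipal character with L(1, chi) nonzero and behave like - log x otherwise, so that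
  positivity leaves room for at most one vanishing value. It would have to belong to a real
  character, and this is excluded by a separate argument (real_character_nonvanishing).
\<close>

unbundle no vec_syntax and fps_syntax
hide_const (open) up_ring.monom up_ring.coeff

section \<open>Pade approximants of binomial series\<close>

text \<open>
  Up to a common factor these are the coefficients of the hypergeometric polynomial
  F(-r, \<nu> - r; -2r; -z), the classical denominator of the Pade approximant of order r to
  (1 + z) to the power \<nu>; the numerator arises by changing the sign of \<nu>.
\<close>

definition pade_coeff :: "nat \<Rightarrow> real \<Rightarrow> nat \<Rightarrow> real" where
  "pade_coeff r \<nu> j = (if j \<le> r then of_nat ((2*r - j) choose r) * ((of_nat r - \<nu>) gchoose j) else 0)"

text \<open>
  The recurrence of the hypergeometric coefficients. The factor 2r - j on the left vanishes at
  j = 2r; this is where a solution can become nonzero again after it has vanished at j = r + 1.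
\<close>

lemma pade_coeff_rec:
  "(real j + 1) * (2 * real r - real j) * pade_coeff r \<nu> (Suc j) = (real r - real j) * (real r - \<nu> - real j) * pade_coeff r \<nu> j"
proof (cases "j < r")
  case True
  have g: "(real j + 1) * ((real r - \<nu>) gchoose Suc j) = (real r - \<nu> - real j) * ((real r - \<nu>) gchoose j)"
    using gbinomial_absorb_comp[of "real r - \<nu>" j] gbinomial_absorption[of j "real r - \<nu>"]
    by (simp add: algebra_simps)
  obtain m where m: "2*r - j = Suc m" "m = 2*r - Suc j" "real m = 2 * real r - real j - 1"
    using True by (cases "2*r-j") (auto simp: of_nat_diff)
  have "(Suc m - r) * (Suc m choose r) = Suc m * (m choose r)"
    using binomial_absorb_comp[of "Suc m" r] by simp
  hence "real (Suc m - r) * real (Suc m choose r) = real (Suc m) * real (m choose r)"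
    by (metis of_nat_mult)
  moreover have "real (Suc m - r) = real r - real j" "real (Suc m) = 2 * real r - real j"
    using m True by auto
  ultimately have c: "(2 * real r - real j) * real (m choose r) = (real r - real j) * real (Suc m choose r)" by simp
  have "(real j + 1) * (2 * real r - real j) * pade_coeff r \<nu> (Suc j) 
     = ((2 * real r - real j) * real (m choose r)) * ((real j + 1) * ((real r - \<nu>) gchoose Suc j))"
    using True m(2) by (simp add: pade_coeff_def)
  also have "\<dots> = (real r - real j) * real (Suc m choose r) * ((real r - \<nu> - real j) * ((real r - \<nu>) gchoose j))"
    by (simp only: c g)
  also have "\<dots> = (real r - real j) * (real r - \<nu> - real j) * pade_coeff r \<nu> j"
    using True m(1) by (simp add: pade_coeff_def)
  finally show ?thesis .
qed (auto simp: pade_coeff_def)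

text \<open>
  The recurrence is equivalent to the hypergeometric differential equation. In this form it can
  be multiplied by a power of 1 + z, which is done in the next lemma.
\<close>

lemma hyper_coeff_iff_ODE:
  fixes G :: "real fps"
  shows "(\<forall>m. (real m + 1) * (2 * real r - real m) * G $ (Suc m) = (real r - real m) * (real r + \<nu> - real m) * G $ m)
    \<longleftrightarrow> fps_X * (1 + fps_X) * fps_deriv (fps_deriv G) 
       - (fps_const (2 * real r) + fps_const (2 * real r + \<nu> - 1) * fps_X) * fps_deriv G 
       + fps_const (real r * (real r + \<nu>)) * G = 0" (is "_ \<longleftrightarrow> ?E = 0")
proof -
  have nth: "?E $ m = (real r - real m) * (real r + \<nu> - real m) * G $ m - (real m + 1) * (2 * real r - real m) * G $ (Suc m)" for m
  proof -
    have E: "?E = fps_X * fps_deriv (fps_deriv G) + fps_X * (fps_X * fps_deriv (fps_deriv G)) 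
       - fps_const (2 * real r) * fps_deriv G - fps_const (2 * real r + \<nu> - 1) * (fps_X * fps_deriv G)
       + fps_const (real r * (real r + \<nu>)) * G"
      by (simp only: algebra_simps mult_1_left mult_1_right)
    show ?thesis
    proof (cases m)
      case 0 thus ?thesis unfolding E by (simp add: algebra_simps)
    next
      case (Suc i)
      show ?thesis unfolding E Suc
        by (cases i) (simp_all add: algebra_simps)
    qed
  qed
  show ?thesis unfolding fps_eq_iff nth by auto
qed

text \<open>
  Euler's transformation: if w is (1 + z) to the power \<nu>, then (1 + z) w' = \<nu> w and
  (1 + z)^2 w'' = \<nu> (\<nu> - 1) w, so multiplication by w carries the equation with parameter -\<nu>
  to the one with parameter \<nu>.
\<close>

lemma pade_ODE_transfer:
  fixes w B :: "real fps"
  assumes w: "(1 + fps_X) * fps_deriv w = fps_const \<nu> * w"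
  assumes B: "fps_X * (1 + fps_X) * fps_deriv (fps_deriv B) 
       - (fps_const (2 * real r) + fps_const (2 * real r - \<nu> - 1) * fps_X) * fps_deriv B 
       + fps_const (real r * (real r - \<nu>)) * B = 0"
  shows "fps_X * (1 + fps_X) * fps_deriv (fps_deriv (w * B)) 
       - (fps_const (2 * real r) + fps_const (2 * real r + \<nu> - 1) * fps_X) * fps_deriv (w * B)
       + fps_const (real r * (real r + \<nu>)) * (w * B) = 0"
proof -
  define X :: "real fps" where "X = fps_X"
  define n where "n = fps_const \<nu>"
  define R where "R = fps_const (real r)"
  define w1 w2 B1 B2 where "w1 = fps_deriv w" and "w2 = fps_deriv w1" and "B1 = fps_deriv B" and "B2 = fps_deriv B1"
  have c: "fps_const (2 * real r) = 2 * R" "fps_const (2 * real r - \<nu> - 1) = 2 * R - n - 1"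
     "fps_const (real r * (real r - \<nu>)) = R * (R - n)" "fps_const (2 * real r + \<nu> - 1) = 2 * R + n - 1"
     "fps_const (real r * (real r + \<nu>)) = R * (R + n)"
    by (auto simp: R_def n_def fps_eq_iff numeral_fps_const)
  have w1: "(1 + X) * w1 = n * w" using w by (simp add: X_def n_def w1_def)
  have "fps_deriv ((1 + X) * w1) = fps_deriv (n * w)" using w1 by simp
  hence w2: "(1 + X) * w2 + w1 = n * w1"
    by (simp add: X_def n_def w2_def w1_def)
  have B: "X * (1 + X) * B2 - (2 * R + (2 * R - n - 1) * X) * B1 + R * (R - n) * B = 0"
    using B unfolding c X_def[symmetric] B1_def[symmetric] B2_def[symmetric] by simp
  have d1: "fps_deriv (w * B) = w1 * B + w * B1" by (simp add: w1_def B1_def algebra_simps)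
  have d2: "fps_deriv (fps_deriv (w * B)) = w2 * B + 2 * (w1 * B1) + w * B2"
    unfolding d1 by (simp add: w1_def B1_def w2_def B2_def algebra_simps)
  have ww: "(1 + X)^2 * w2 = n * (n - 1) * w"
  proof -
    have "(1 + X)^2 * w2 = (1 + X) * ((1 + X) * w2)" by (simp add: power2_eq_square algebra_simps)
    also have "(1 + X) * w2 = (n - 1) * w1" using w2 by (simp add: algebra_simps)
    also have "(1 + X) * ((n - 1) * w1) = (n - 1) * ((1 + X) * w1)" by (simp add: algebra_simps)
    finally show ?thesis unfolding w1 by (simp add: mult_ac)
  qed
  have "(1 + X) * (X * (1 + X) * (w2 * B + 2 * (w1 * B1) + w * B2) - (2 * R + (2 * R + n - 1) * X) * (w1 * B + w * B1) + R * (R + n) * (w * B))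
     = X * ((1 + X)^2 * w2) * B + 2 * X * (1 + X) * ((1 + X) * w1) * B1 + X * (1 + X)^2 * w * B2
       - (2 * R + (2 * R + n - 1) * X) * (((1 + X) * w1) * B + (1 + X) * w * B1) + R * (R + n) * (1 + X) * w * B"
    by (simp add: algebra_simps power2_eq_square)
  also have "\<dots> = (1 + X) * w * (X * (1 + X) * B2 - (2 * R + (2 * R - n - 1) * X) * B1 + R * (R - n) * B)"
    unfolding ww w1 by (simp add: algebra_simps power2_eq_square)
  also have "\<dots> = 0" using B by simp
  finally have "X * (1 + X) * (w2 * B + 2 * (w1 * B1) + w * B2) - (2 * R + (2 * R + n - 1) * X) * (w1 * B + w * B1) + R * (R + n) * (w * B) = 0"
  proof -
    assume a: "(1 + X) * (X * (1 + X) * (w2 * B + 2 * (w1 * B1) + w * B2) - (2 * R + (2 * R + n - 1) * X) * (w1 * B + w * B1) + R * (R + n) * (w * B)) = 0"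
    have "(1 + X) $ 0 = 1" by (simp add: X_def)
    hence "1 + X \<noteq> 0" by (metis fps_zero_nth zero_neq_one)
    with a show ?thesis by (metis mult_eq_0_iff)
  qed
  thus ?thesis unfolding d2 unfolding d1 c X_def[symmetric] .
qed

text \<open>
  The defining property of the Pade approximant. Both sides satisfy the same recurrence and
  agree at 0, and the recurrence determines all coefficients up to index 2r.
\<close>

lemma fps_binomial_mult_pade:
  fixes r :: nat and \<nu> :: real
  assumes "m \<le> 2 * r"
  shows "(fps_binomial \<nu> * Abs_fps (pade_coeff r \<nu>)) $ m = pade_coeff r (-\<nu>) m"
proof -
  define G where "G = fps_binomial \<nu> * Abs_fps (pade_coeff r \<nu>)"
  have w: "(1 + fps_X) * fps_deriv (fps_binomial \<nu>) = fps_const \<nu> * fps_binomial \<nu>"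
  proof -
    have "is_unit (1 + fps_X :: real fps)" by (simp add: fps_is_unit_iff)
    thus ?thesis by (simp add: fps_binomial_deriv dvd_mult_div_cancel unit_imp_dvd)
  qed
  have "\<forall>m. (real m + 1) * (2 * real r - real m) * Abs_fps (pade_coeff r \<nu>) $ (Suc m) = (real r - real m) * (real r + (-\<nu>) - real m) * Abs_fps (pade_coeff r \<nu>) $ m"
    using pade_coeff_rec[of _ r \<nu>] by simp
  hence "fps_X * (1 + fps_X) * fps_deriv (fps_deriv (Abs_fps (pade_coeff r \<nu>))) 
       - (fps_const (2 * real r) + fps_const (2 * real r - \<nu> - 1) * fps_X) * fps_deriv (Abs_fps (pade_coeff r \<nu>)) 
       + fps_const (real r * (real r - \<nu>)) * Abs_fps (pade_coeff r \<nu>) = 0"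
    unfolding hyper_coeff_iff_ODE by simp
  from pade_ODE_transfer[OF w this]
  have rec: "(real m + 1) * (2 * real r - real m) * G $ (Suc m) = (real r - real m) * (real r + \<nu> - real m) * G $ m" for m
    unfolding G_def[symmetric] hyper_coeff_iff_ODE[symmetric] by blast
  have "m \<le> 2 * r \<Longrightarrow> G $ m = pade_coeff r (-\<nu>) m"
  proof (induction m)
    case 0 show ?case by (simp add: G_def pade_coeff_def)
  next
    case (Suc m)
    have "(real m + 1) * (2 * real r - real m) * G $ (Suc m) = (real m + 1) * (2 * real r - real m) * pade_coeff r (-\<nu>) (Suc m)"
      using rec[of m] Suc pade_coeff_rec[of m r "-\<nu>"] by simp
    moreover have "(real m + 1) * (2 * real r - real m) \<noteq> 0" using Suc.prems by auto
    ultimately show ?case by (metis mult_cancel_left)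
  qed
  thus ?thesis using assms G_def by simp
qed


definition pade :: "nat \<Rightarrow> real \<Rightarrow> real \<Rightarrow> real" where
  "pade r \<nu> z = (\<Sum>j\<le>r. pade_coeff r \<nu> j * z ^ j)"

lemma gbinomial_shift_pos:
  assumes "\<nu> < 1" "j \<le> r"
  shows "((real r - \<nu>) gchoose j) > 0"
  unfolding gbinomial_prod_rev
  using assms by (intro divide_pos_pos prod_pos) auto

lemma gbinomial_shift_le:
  assumes "\<bar>\<nu>\<bar> < 1" "j \<le> r"
  shows "((real r - \<nu>) gchoose j) \<le> 2 ^ Suc r"
proof -
  have "((real r - \<nu>) gchoose j) \<le> ((real (Suc r)) gchoose j)"
    unfolding gbinomial_prod_rev
    using assms by (intro divide_right_mono prod_mono) auto
  also have "\<dots> = real (Suc r choose j)" by (simp only: binomial_gbinomial)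
  also have "\<dots> \<le> 2 ^ Suc r" using binomial_le_pow2[of "Suc r" j] by (metis of_nat_le_iff of_nat_numeral of_nat_power)
  finally show ?thesis .
qed

lemma pade_coeff_bound:
  assumes "\<bar>\<nu>\<bar> < 1"
  shows "\<bar>pade_coeff r \<nu> j\<bar> \<le> 2 * 8 ^ r"
proof (cases "j \<le> r")
  case True
  have "(2 * r - j choose r) \<le> 2 ^ (2 * r - j)" by (rule binomial_le_pow2)
  also have "\<dots> \<le> 2 ^ (2 * r)" by (rule power_increasing) auto
  finally have "real (2 * r - j choose r) \<le> 4 ^ r"
    by (metis of_nat_le_iff of_nat_numeral of_nat_power power_mult power2_eq_square numeral_times_numeral semiring_norm(13) semiring_norm(11))
  moreover have "((real r - \<nu>) gchoose j) > 0" using assms True by (intro gbinomial_shift_pos) auto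
  ultimately have "\<bar>pade_coeff r \<nu> j\<bar> \<le> 4 ^ r * 2 ^ Suc r"
    using gbinomial_shift_le[OF assms True] True
    by (simp add: pade_coeff_def abs_mult mult_mono)
  also have "\<dots> = 2 * 8 ^ r" by (simp add: power_mult_distrib [symmetric])
  finally show ?thesis .
qed (simp add: pade_coeff_def)

lemma abs_gbinomial_le_1:
  fixes \<nu> :: real
  assumes "\<bar>\<nu>\<bar> \<le> 1"
  shows "\<bar>\<nu> gchoose j\<bar> \<le> 1"
proof -
  have "\<bar>\<Prod>i = 0..<j. \<nu> - real i\<bar> \<le> (\<Prod>i = 0..<j. real (Suc i))"
    unfolding abs_prod using assms by (intro prod_mono) auto
  also have "\<dots> = fact j" by (simp add: fact_prod_Suc)
  finally show ?thesis by (simp add: gbinomial_prod_rev abs_divide)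
qed

definition pade_poly :: "nat \<Rightarrow> real \<Rightarrow> real poly" where
  "pade_poly r \<nu> = (\<Sum>j\<le>r. monom (pade_coeff r \<nu> j) j)"

lemma coeff_pade_poly: "coeff (pade_poly r \<nu>) j = pade_coeff r \<nu> j"
  by (auto simp: pade_poly_def coeff_sum pade_coeff_def)

lemma degree_pade_poly: "degree (pade_poly r \<nu>) \<le> r"
  by (rule degree_le) (auto simp: coeff_pade_poly pade_coeff_def)

lemma poly_pade_poly: "poly (pade_poly r \<nu>) z = pade r \<nu> z"
  by (simp add: pade_poly_def pade_def poly_sum poly_monom)

lemma fps_of_pade_poly: "fps_of_poly (pade_poly r \<nu>) = Abs_fps (pade_coeff r \<nu>)"
  by (auto simp: fps_eq_iff coeff_pade_poly)

text \<open>
  Approximants of consecutive orders are not proportional at any nonzero point: the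
  determinant is a polynomial of degree at most 2r + 1 which, by the defining property of the
  approximants, vanishes to order 2r + 1 at 0, and its leading coefficient is a nonzero multiple
  of \<nu>. In Thue's method this guarantees that one of two consecutive orders yields a nonzero
  integer.
\<close>

lemma pade_nonvanishing:
  fixes \<nu> z :: real
  assumes \<nu>: "\<bar>\<nu>\<bar> < 1" "\<nu> \<noteq> 0" and z: "z \<noteq> 0"
  shows "pade r (-\<nu>) z * pade (Suc r) \<nu> z \<noteq> pade (Suc r) (-\<nu>) z * pade r \<nu> z"
proof -
  define D where "D = pade_poly r (-\<nu>) * pade_poly (Suc r) \<nu> - pade_poly (Suc r) (-\<nu>) * pade_poly r \<nu>"
  define w where "w = fps_binomial \<nu>"
  define A where "A = (\<lambda>r. Abs_fps (pade_coeff r (-\<nu>)))"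
  define B where "B = (\<lambda>r. Abs_fps (pade_coeff r \<nu>))"
  have low: "(A s - w * B s) $ i = 0" if "i \<le> 2 * s" for i s
    using fps_binomial_mult_pade[OF that, of \<nu>] by (simp add: A_def B_def w_def)
  \<comment> \<open>Both products in D are written modulo the remainders of the approximants; the common main terms cancel.\<close>
  have Dfps: "fps_of_poly D = (A r - w * B r) * B (Suc r) - (A (Suc r) - w * B (Suc r)) * B r"
    by (simp add: D_def fps_of_poly_diff fps_of_poly_mult fps_of_pade_poly A_def B_def algebra_simps)
  have c0: "coeff D i = 0" if "i \<le> 2 * r" for i
  proof -
    have "coeff D i = fps_of_poly D $ i" by simp
    also have "\<dots> = 0"
    proof -
      have "((A s - w * B s) * G) $ i = 0" if "s \<ge> r" for s G
        unfolding fps_mult_nth[of "A s - w * B s"] using \<open>i \<le> 2 * r\<close> that by (intro sum.neutral) (auto simp: low simp del: fps_sub_nth)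
      thus ?thesis unfolding Dfps fps_sub_nth[of "(A r - w * B r) * B (Suc r)"] by simp
    qed
    finally show ?thesis .
  qed
  have deg: "degree D \<le> Suc (2 * r)"
    unfolding D_def
    by (intro degree_diff_le order.trans[OF degree_mult_le])
       (use degree_pade_poly[of r] degree_pade_poly[of "Suc r"] in \<open>force intro: order.trans[OF add_mono]\<close>)+
  have top: "coeff (pade_poly r a * pade_poly (Suc r) b) (Suc (2 * r)) = ((real r - a) gchoose r) * ((real (Suc r) - b) gchoose Suc r)" for a b
  proof -
    have "coeff (pade_poly r a * pade_poly (Suc r) b) (Suc (2 * r)) = (\<Sum>i\<le>Suc (2 * r). pade_coeff r a i * pade_coeff (Suc r) b (Suc (2 * r) - i))"
      by (simp add: coeff_mult coeff_pade_poly)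
    also have "\<dots> = (\<Sum>i\<in>{r}. pade_coeff r a i * pade_coeff (Suc r) b (Suc (2 * r) - i))"
      by (intro sum.mono_neutral_right) (auto simp: pade_coeff_def)
    also have "\<dots> = ((real r - a) gchoose r) * ((real (Suc r) - b) gchoose Suc r)"
      by (simp add: pade_coeff_def mult_2 Suc_diff_le)
    finally show ?thesis .
  qed
  define g1 g2 where "g1 = ((real r + \<nu>) gchoose r)" and "g2 = ((real r - \<nu>) gchoose r)"
  have pos: "g1 > 0" "g2 > 0" 
    using gbinomial_shift_pos[of "-\<nu>" r r] gbinomial_shift_pos[of \<nu> r r] \<nu> by (auto simp: g1_def g2_def)
  have s1: "((real (Suc r) - \<nu>) gchoose Suc r) = (real r + 1 - \<nu>) / (real r + 1) * g2"
    using gbinomial_factors[of "real r - \<nu>" r] by (simp add: g2_def algebra_simps)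
  have s2: "((real (Suc r) + \<nu>) gchoose Suc r) = (real r + 1 + \<nu>) / (real r + 1) * g1"
    using gbinomial_factors[of "real r + \<nu>" r] by (simp add: g1_def algebra_simps)
  have "coeff D (Suc (2 * r)) = g1 * ((real (Suc r) - \<nu>) gchoose Suc r) - g2 * ((real (Suc r) + \<nu>) gchoose Suc r)"
    unfolding D_def coeff_diff using top[of "-\<nu>" \<nu>] top[of \<nu> "-\<nu>"]
    by (simp add: g1_def g2_def mult.commute)
  also have "\<dots> = - 2 * \<nu> * g1 * g2 / (real r + 1)"
  proof -
    have "g1 * ((u - \<nu>) / u * g2) - g2 * ((u + \<nu>) / u * g1) = - 2 * \<nu> * g1 * g2 / u" if "u > 0" for u
      using that by (simp add: divide_simps) (simp add: algebra_simps)
    from this[of "real r + 1"] show ?thesis unfolding s1 s2 by simp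
  qed
  finally have k: "coeff D (Suc (2 * r)) \<noteq> 0" using pos \<nu> by auto
  have "D = monom (coeff D (Suc (2 * r))) (Suc (2 * r))"
  proof (rule poly_eqI)
    fix i show "coeff D i = coeff (monom (coeff D (Suc (2 * r))) (Suc (2 * r))) i"
    proof (cases "i = Suc (2 * r)")
      case False
      hence "i \<le> 2 * r \<or> i > degree D" using deg by linarith
      thus ?thesis using c0 False by (auto simp: coeff_eq_0)
    qed simp
  qed
  hence "poly D z = coeff D (Suc (2 * r)) * z ^ Suc (2 * r)" by (metis poly_monom)
  hence "poly D z \<noteq> 0" using k z by simp
  thus ?thesis by (simp add: D_def poly_pade_poly)
qed

text \<open>
  The coefficients of the product of the binomial series with the denominator are bounded by
  the sum of the moduli of the denominator's coefficients, since all binomial coefficients of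
  \<nu> have modulus at most 1. Those below index 2r + 1 form the numerator, and the tail is dominated
  by a geometric series.
\<close>

lemma pade_remainder:
  fixes \<nu> z :: real
  assumes \<nu>: "\<bar>\<nu>\<bar> < 1" and z: "\<bar>z\<bar> \<le> 1/2"
  shows "\<bar>pade r (-\<nu>) z - (1 + z) powr \<nu> * pade r \<nu> z\<bar> \<le> 4 * 16 ^ r * \<bar>z\<bar> ^ Suc (2 * r)"
proof -
  define b where "b = pade_coeff r \<nu>"
  define g where "g = (\<lambda>m. \<Sum>i\<le>m. (\<nu> gchoose i) * b (m - i))"
  define C :: real where "C = 2 * 16 ^ r"
  have gF: "g m = (fps_binomial \<nu> * Abs_fps b) $ m" for m
    by (simp add: g_def fps_mult_nth atLeast0AtMost)
  have glow: "g m = pade_coeff r (-\<nu>) m" if "m \<le> 2 * r" for m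
    unfolding gF b_def by (rule fps_binomial_mult_pade[OF that])
  have gb: "\<bar>g m\<bar> \<le> C" for m
  proof -
    have "\<bar>g m\<bar> \<le> (\<Sum>i\<le>m. \<bar>b (m - i)\<bar>)" unfolding g_def
    proof (rule order.trans[OF sum_abs], rule sum_mono)
      fix i
      show "\<bar>(\<nu> gchoose i) * b (m - i)\<bar> \<le> \<bar>b (m - i)\<bar>"
        using abs_gbinomial_le_1[of \<nu> i] \<nu> by (simp add: abs_mult mult_left_le_one_le)
    qed
    also have "\<dots> = (\<Sum>i\<le>m. \<bar>b i\<bar>)"
      by (rule sum.reindex_bij_witness[of _ "\<lambda>i. m - i" "\<lambda>i. m - i"]) auto
    also have "\<dots> \<le> (\<Sum>i\<le>max m r. \<bar>b i\<bar>)" by (intro sum_mono2) auto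
    also have "\<dots> = (\<Sum>i\<le>r. \<bar>b i\<bar>)"
      by (intro sum.mono_neutral_right) (auto simp: b_def pade_coeff_def)
    also have "\<dots> \<le> (\<Sum>i\<le>r. 2 * 8 ^ r)"
      unfolding b_def by (intro sum_mono pade_coeff_bound \<nu>)
    also have "\<dots> = real (Suc r) * (2 * 8 ^ r)" by simp
    also have "\<dots> \<le> 2 ^ r * (2 * 8 ^ r)"
      using Suc_leI[OF less_exp[of r]] 
      by (intro mult_right_mono) (metis of_nat_le_iff of_nat_numeral of_nat_power, simp)
    also have "\<dots> = C" by (simp add: C_def power_mult_distrib [symmetric])
    finally show ?thesis .
  qed
  have zs: "summable (\<lambda>m. \<bar>z\<bar> ^ m)" using z by (intro summable_geometric) auto
  have sa: "summable (\<lambda>i. norm ((\<nu> gchoose i) * z ^ i))"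
  proof (rule summable_comparison_test'[OF zs, of 0])
    fix n show "norm (norm ((\<nu> gchoose n) * z ^ n)) \<le> \<bar>z\<bar> ^ n"
      using abs_gbinomial_le_1[of \<nu> n] \<nu> by (simp add: abs_mult power_abs mult_left_le_one_le)
  qed
  have b0: "b j = 0" if "j \<notin> {..r}" for j using that by (auto simp: b_def pade_coeff_def)
  have sb: "(\<lambda>j. b j * z ^ j) sums (\<Sum>j\<le>r. b j * z ^ j)"
    by (intro sums_finite) (auto simp: b0)
  have sb': "summable (\<lambda>j. norm (b j * z ^ j))"
    by (intro summable_finite[of "{..r}"]) (auto simp: b0)
  have w: "(\<lambda>i. (\<nu> gchoose i) * z ^ i) sums (1 + z) powr \<nu>" using z by (intro gen_binomial_real) auto
  have "(\<lambda>m. \<Sum>i\<le>m. ((\<nu> gchoose i) * z ^ i) * (b (m - i) * z ^ (m - i))) sums 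
     ((\<Sum>i. (\<nu> gchoose i) * z ^ i) * (\<Sum>j. b j * z ^ j))"
    by (intro Cauchy_product_sums sa sb')
  also have "(\<Sum>i. (\<nu> gchoose i) * z ^ i) = (1 + z) powr \<nu>" using w by (rule sums_unique[symmetric])
  also have "(\<Sum>j. b j * z ^ j) = pade r \<nu> z" using sums_unique[OF sb] by (simp add: pade_def b_def)
  also have "(\<lambda>m. \<Sum>i\<le>m. ((\<nu> gchoose i) * z ^ i) * (b (m - i) * z ^ (m - i))) = (\<lambda>m. g m * z ^ m)"
  proof
    fix m
    show "(\<Sum>i\<le>m. ((\<nu> gchoose i) * z ^ i) * (b (m - i) * z ^ (m - i))) = g m * z ^ m"
      unfolding g_def sum_distrib_right
    proof (intro sum.cong refl)
      fix i assume "i \<in> {..m}"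
      hence "z ^ m = z ^ i * z ^ (m - i)" by (simp add: power_add [symmetric])
      thus "((\<nu> gchoose i) * z ^ i) * (b (m - i) * z ^ (m - i)) = (\<nu> gchoose i) * b (m - i) * z ^ m" by simp
    qed
  qed
  finally have gs: "(\<lambda>m. g m * z ^ m) sums ((1 + z) powr \<nu> * pade r \<nu> z)" .
  have init: "(\<Sum>m<Suc (2*r). g m * z ^ m) = pade r (-\<nu>) z"
  proof -
    have "(\<Sum>m<Suc (2*r). g m * z ^ m) = (\<Sum>m<Suc (2*r). pade_coeff r (-\<nu>) m * z ^ m)"
      by (intro sum.cong) (auto simp: glow)
    also have "\<dots> = pade r (-\<nu>) z" unfolding pade_def
      by (intro sum.mono_neutral_right) (auto simp: pade_coeff_def)
    finally show ?thesis .
  qed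
  have tail: "(\<lambda>m. g (m + Suc (2*r)) * z ^ (m + Suc (2*r))) sums ((1 + z) powr \<nu> * pade r \<nu> z - pade r (-\<nu>) z)"
    using sums_split_initial_segment[OF gs, of "Suc (2*r)"] unfolding init .
  have "(\<lambda>m. C * \<bar>z\<bar> ^ Suc (2*r) * \<bar>z\<bar> ^ m) sums (C * \<bar>z\<bar> ^ Suc (2*r) * (1 / (1 - \<bar>z\<bar>)))"
    using z by (intro sums_mult geometric_sums) auto
  hence geo: "summable (\<lambda>m. C * \<bar>z\<bar> ^ Suc (2*r) * \<bar>z\<bar> ^ m)"
    "(\<Sum>m. C * \<bar>z\<bar> ^ Suc (2*r) * \<bar>z\<bar> ^ m) = C * \<bar>z\<bar> ^ Suc (2*r) * (1 / (1 - \<bar>z\<bar>))"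
    by (auto simp: sums_iff)
  have "norm (\<Sum>m. g (m + Suc (2*r)) * z ^ (m + Suc (2*r))) \<le> (\<Sum>m. C * \<bar>z\<bar> ^ Suc (2*r) * \<bar>z\<bar> ^ m)"
  proof (rule norm_suminf_le[OF _ geo(1)])
    fix m
    have "norm (g (m + Suc (2*r)) * z ^ (m + Suc (2*r))) = \<bar>g (m + Suc (2*r))\<bar> * (\<bar>z\<bar> ^ Suc (2*r) * \<bar>z\<bar> ^ m)"
      by (simp add: abs_mult power_abs power_add)
    also have "\<dots> \<le> C * (\<bar>z\<bar> ^ Suc (2*r) * \<bar>z\<bar> ^ m)"
      by (intro mult_right_mono gb) auto
    finally show "norm (g (m + Suc (2*r)) * z ^ (m + Suc (2*r))) \<le> C * \<bar>z\<bar> ^ Suc (2*r) * \<bar>z\<bar> ^ m"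
      by (simp only: mult.assoc)
  qed
  also have "(\<Sum>m. g (m + Suc (2*r)) * z ^ (m + Suc (2*r))) = (1 + z) powr \<nu> * pade r \<nu> z - pade r (-\<nu>) z"
    using tail by (simp only: sums_iff)
  also note geo(2)
  also have "C * \<bar>z\<bar> ^ Suc (2*r) * (1 / (1 - \<bar>z\<bar>)) \<le> C * \<bar>z\<bar> ^ Suc (2*r) * 2"
    using z by (intro mult_left_mono) (auto simp: C_def field_simps)
  finally show ?thesis by (simp add: C_def abs_minus_commute mult_ac)
qed

lemma fps_nth_power_in_Ints:
  fixes g :: "real fps"
  assumes "\<And>l. l < j \<Longrightarrow> g $ l \<in> \<int>" "l < j"
  shows "(g ^ i) $ l \<in> \<int>"
  using assms(2)
proof (induction i arbitrary: l)
  case (Suc i)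
  show ?case unfolding power_Suc fps_mult_nth
    using Suc.prems by (intro Ints_sum Ints_mult assms(1) Suc.IH) auto
qed (auto simp: fps_one_nth)

text \<open>
  The series f = (1 + k^2 X) to the power 1/k has integral coefficients: writing f = 1 + k g and
  dividing (1 + k g)^k = 1 + k^2 X by k^2 expresses each coefficient of g as an integral polynomial in
  the earlier ones. The point is that the denominators of the coefficients grow only
  exponentially.
\<close>

lemma root_series_integral:
  fixes k :: nat
  assumes k: "k > 0"
  defines "f \<equiv> Abs_fps (\<lambda>j. real k ^ (2 * j) * ((1 / real k) gchoose j))"
  shows "f $ j \<in> \<int>"
proof -
  have fnth: "f = fps_binomial (1 / real k) oo (fps_const (real k ^ 2) * fps_X)"
    by (simp add: f_def fps_eq_iff power_mult)
  have "f ^ k = fps_binomial (1 / real k) ^ k oo (fps_const (real k ^ 2) * fps_X)"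
    unfolding fnth by (simp add: fps_compose_power)
  also have "fps_binomial (1 / real k) ^ k = 1 + fps_X"
    using k by (simp add: fps_binomial_power fps_binomial_1)
  also have "(1 + fps_X) oo (fps_const (real k ^ 2) * fps_X) = 1 + fps_const (real k ^ 2) * fps_X"
    by (simp add: fps_compose_add_distrib)
  finally have fk: "f ^ k = 1 + fps_const (real k ^ 2) * fps_X" .
  define g where "g = fps_const (1 / real k) * (f - 1)"
  have g0: "g $ 0 = 0" by (simp add: g_def f_def)
  have fg: "f = fps_const (real k) * g + 1"
    using k by (simp add: g_def fps_eq_iff)
  have "g $ j \<in> \<int>" for j
  proof (induction j rule: less_induct)
    case (less j)
    consider "j = 0" | "j = 1" | "j \<ge> 2" by linarith
    thus ?case
    proof cases
      case 1 thus ?thesis using g0 by simp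
    next
      case 2 
      have "g $ 1 = 1" using k by (simp add: g_def f_def power2_eq_square)
      thus ?thesis using 2 by simp
    next
      case 3
      have "0 = (f ^ k) $ j" using 3 by (simp add: fk)
      also have "f ^ k = (\<Sum>i\<le>k. of_nat (k choose i) * (fps_const (real k) * g) ^ i * 1 ^ (k - i))"
        unfolding fg by (rule binomial_ring)
      also have "\<dots> = (\<Sum>i\<le>k. fps_const (real (k choose i) * real k ^ i) * g ^ i)"
        by (intro sum.cong refl) (simp add: power_mult_distrib fps_of_nat[symmetric] fps_const_power mult_ac)
      also have "\<dots> $ j = (\<Sum>i\<le>k. real (k choose i) * real k ^ i * (g ^ i) $ j)"
        by (simp add: fps_sum_nth)
      also have "{..k} = insert 0 (insert 1 {2..k})" using k by auto
      also have "(\<Sum>i\<in>insert 0 (insert 1 {2..k}). real (k choose i) * real k ^ i * (g ^ i) $ j) 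
         = real k ^ 2 * g $ j + (\<Sum>i\<in>{2..k}. real (k choose i) * real k ^ i * (g ^ i) $ j)"
        using 3 by (simp add: power2_eq_square)
      also have "(\<Sum>i\<in>{2..k}. real (k choose i) * real k ^ i * (g ^ i) $ j) = 
          real k ^ 2 * (\<Sum>i\<in>{2..k}. real (k choose i) * real k ^ (i - 2) * (g ^ i) $ j)"
        unfolding sum_distrib_left
      proof (intro sum.cong refl)
        fix i assume "i \<in> {2..k}"
        hence "2 + (i - 2) = i" by auto
        hence "real k ^ i = real k ^ 2 * real k ^ (i - 2)" by (metis power_add)
        thus "real (k choose i) * real k ^ i * (g ^ i) $ j = real k ^ 2 * (real (k choose i) * real k ^ (i - 2) * (g ^ i) $ j)" by simp
      qed
      \<comment> \<open>Since g has no constant term, the powers of g from the second on involve only earlier coefficients of g.\<close>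
      finally have "real k ^ 2 * (g $ j + (\<Sum>i\<in>{2..k}. real (k choose i) * real k ^ (i - 2) * (g ^ i) $ j)) = 0"
        by (simp add: algebra_simps)
      hence e: "g $ j = - (\<Sum>i\<in>{2..k}. real (k choose i) * real k ^ (i - 2) * (g ^ i) $ j)"
        using k by simp
      have "(g ^ i) $ j \<in> \<int>" if i2: "i \<ge> 2" for i
      proof -
        obtain i' where i': "i = Suc (Suc i')" using le_Suc_ex[OF i2] by auto
        have "(g * g ^ Suc i') $ j = (\<Sum>l=0..j. g $ l * (g ^ Suc i') $ (j - l))" by (rule fps_mult_nth)
        also have "\<dots> \<in> \<int>"
        proof (rule Ints_sum)
          fix l assume "l \<in> {0..j}"
          then consider "l = 0" | "l = j" | "0 < l" "l < j" by (cases "l = 0"; cases "l = j") auto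
          thus "g $ l * (g ^ Suc i') $ (j - l) \<in> \<int>"
          proof cases
            case 3 
            thus ?thesis using fps_nth_power_in_Ints[OF less.IH, of j "j - l" "Suc i'"] less.IH
              by (intro Ints_mult) auto
          qed (auto simp: g0)
        qed
        finally show ?thesis by (simp add: i')
      qed
      thus ?thesis unfolding e by (intro Ints_minus Ints_sum Ints_mult Ints_power Ints_of_nat) auto
    qed
  qed
  thus ?thesis by (subst fg) (auto intro!: Ints_add Ints_mult simp: fps_one_nth)
qed

lemma gbinomial_div_integral:
  fixes k i j :: nat
  assumes k: "k > 0"
  shows "real k ^ (2 * j) * ((real i / real k) gchoose j) \<in> \<int>"
proof -
  define f where "f = Abs_fps (\<lambda>j. real k ^ (2 * j) * ((1 / real k) gchoose j))"
  have fnth: "f = fps_binomial (1 / real k) oo (fps_const (real k ^ 2) * fps_X)"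
    by (simp add: f_def fps_eq_iff power_mult)
  have "f ^ i = fps_binomial (1 / real k) ^ i oo (fps_const (real k ^ 2) * fps_X)"
    unfolding fnth by (simp add: fps_compose_power)
  also have "fps_binomial (1 / real k) ^ i = fps_binomial (real i / real k)"
    by (simp add: fps_binomial_power)
  finally have "(f ^ i) $ j = real k ^ (2 * j) * ((real i / real k) gchoose j)"
    by (simp add: power_mult)
  moreover have "(f ^ i) $ j \<in> \<int>"
    by (rule fps_nth_power_in_Ints[of "Suc j"]) (auto simp: f_def root_series_integral[OF k, simplified])
  ultimately show ?thesis by simp
qed

lemma pade_coeff_integral:
  fixes k :: nat
  assumes k: "k > 0" and \<nu>: "\<nu> = 1 / real k \<or> \<nu> = - 1 / real k"
  shows "real k ^ (2 * r) * pade_coeff r \<nu> j \<in> \<int>"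
proof (cases "j \<le> r")
  case True
  have "real k ^ (2 * j) * ((real r - \<nu>) gchoose j) \<in> \<int>"
  proof (cases "r = 0")
    case True thus ?thesis using \<open>j \<le> r\<close> by simp
  next
    case False
    hence rk: "r * k \<ge> 1" using k by (simp add: Suc_leI)
    from \<nu> have "real r - \<nu> = real (r * k - 1) / real k \<or> real r - \<nu> = real (r * k + 1) / real k"
      using k rk by (auto simp: of_nat_diff field_simps simp del: of_nat_mult) (auto simp: field_simps)
    thus ?thesis using gbinomial_div_integral[OF k] by metis
  qed
  hence "real k ^ (2 * (r - j)) * real (2 * r - j choose r) * (real k ^ (2 * j) * ((real r - \<nu>) gchoose j)) \<in> \<int>"
    using Ints_mult[of "real k ^ (2 * (r - j)) * real (2 * r - j choose r)"] Ints_mult Ints_power Ints_of_nat by blast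
  also have "real k ^ (2 * (r - j)) * real (2 * r - j choose r) * (real k ^ (2 * j) * ((real r - \<nu>) gchoose j)) 
     = real k ^ (2 * (r - j) + 2 * j) * (real (2 * r - j choose r) * ((real r - \<nu>) gchoose j))"
    by (simp add: power_add mult_ac)
  also have "2 * (r - j) + 2 * j = 2 * r" using True by simp
  finally show ?thesis using True by (simp add: pade_coeff_def)
qed (simp add: pade_coeff_def)

text \<open>
  Clearing the denominators of the Pade polynomials at a rational point costs a factor that
  is exponential in r; a factor of size r! would be fatal in the application.
\<close>

lemma pade_integral:
  fixes k :: nat and W c :: int
  assumes k: "k > 0" and \<nu>: "\<nu> = 1 / real k \<or> \<nu> = - 1 / real k" and W: "W \<noteq> 0"
  shows "real k ^ (2 * r) * of_int W ^ r * pade r \<nu> (of_int c / of_int W) \<in> \<int>"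
proof -
  have "real k ^ (2 * r) * of_int W ^ r * pade r \<nu> (of_int c / of_int W) = 
     (\<Sum>j\<le>r. (real k ^ (2 * r) * pade_coeff r \<nu> j) * (of_int (c ^ j * W ^ (r - j))))"
    unfolding pade_def sum_distrib_left
  proof (intro sum.cong refl)
    fix j assume "j \<in> {..r}"
    hence "(of_int W :: real) ^ r = of_int W ^ j * of_int W ^ (r - j)" by (simp add: power_add [symmetric])
    thus "real k ^ (2 * r) * of_int W ^ r * (pade_coeff r \<nu> j * (of_int c / of_int W) ^ j) = (real k ^ (2 * r) * pade_coeff r \<nu> j) * (of_int (c ^ j * W ^ (r - j)))"
      using W by (simp add: power_divide field_simps)
  qed
  also have "\<dots> \<in> \<int>" by (intro Ints_sum Ints_mult pade_coeff_integral[OF k \<nu>] Ints_of_int)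
  finally show ?thesis .
qed

lemma pade_abs_le:
  assumes "\<bar>\<nu>\<bar> < 1" "\<bar>z\<bar> \<le> 1/2"
  shows "\<bar>pade r \<nu> z\<bar> \<le> 4 * 8 ^ r"
proof -
  have "\<bar>pade r \<nu> z\<bar> \<le> (\<Sum>j\<le>r. \<bar>pade_coeff r \<nu> j\<bar> * \<bar>z\<bar> ^ j)"
    unfolding pade_def by (rule order.trans[OF sum_abs]) (simp add: abs_mult power_abs)
  also have "\<dots> \<le> (\<Sum>j\<le>r. (2 * 8 ^ r) * (1/2) ^ j)"
    using assms by (intro sum_mono mult_mono pade_coeff_bound power_mono) auto
  also have "\<dots> = (2 * 8 ^ r) * (\<Sum>j\<le>r. (1/2) ^ j)" by (simp add: sum_distrib_left)
  also have "(\<Sum>j\<le>r. (1/2 :: real) ^ j) \<le> 2"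
  proof -
    have "(\<Sum>j\<le>r. (1/2 :: real) ^ j) = 2 - (1/2) ^ r" by (induction r) (auto simp: field_simps)
    thus ?thesis by simp
  qed
  finally show ?thesis by simp
qed

section \<open>Two good approximations to a root of a rational number\<close>

lemma power_diff_ge:
  fixes s t :: real
  assumes "s \<ge> 0" "t \<ge> 0" "k \<ge> 1"
  shows "\<bar>s - t\<bar> * s ^ (k - 1) \<le> \<bar>s ^ k - t ^ k\<bar>"
proof -
  obtain m where k: "k = Suc m" using assms(3) by (cases k) auto
  show ?thesis
  proof (cases "t \<le> s")
    case True
    hence "t * t ^ m \<le> t * s ^ m" "t ^ k \<le> s ^ k" using assms by (auto intro!: mult_left_mono power_mono)
    thus ?thesis using True by (simp add: k algebra_simps)
  next
    case False
    hence "t * s ^ m \<le> t * t ^ m" "s ^ k \<le> t ^ k" using assms by (auto intro!: mult_left_mono power_mono)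
    thus ?thesis using False by (simp add: k algebra_simps)
  qed
qed

text \<open>
  The core of Thue's method. The pair x, y is used to write the k-th root of a1 / a2 as
  (x / y) (1 + z)^(1/k) with small z, and the Pade approximants turn it into integers P, Q
  such that P x / (Q y) is a very good approximation to that root. Compared with x' / y', the integer
  P x y' - Q y x' is nonzero for one of two consecutive orders; estimating it by the two
  approximation errors gives the lower bound 1 for their sum.
\<close>

lemma thue_root_approximations:
  fixes a1 a2 c x y x' y' :: int and k r :: nat
  assumes k: "k \<ge> 2" and pos: "a1 > 0" "a2 > 0" "x > 0" "y > 0" "x' > 0" "y' > 0"
    and c1: "c = a2 * x ^ k - a1 * y ^ k" and c2: "c = a2 * x' ^ k - a1 * y' ^ k"
    and c0: "c \<noteq> 0" and cW: "2 * \<bar>c\<bar> \<le> a2 * x ^ k"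
  defines "W \<equiv> real_of_int (a2 * x ^ k)" and "E \<equiv> 16 * real k ^ 2"
  defines "bnd \<equiv> \<lambda>r. 4 * of_int x * of_int y' * E ^ r * \<bar>of_int c\<bar> ^ Suc (2 * r) / W ^ Suc r
     + 4 * E ^ r * W ^ r * of_int y * (\<bar>of_int c\<bar> / (of_int a2 * of_int x' ^ (k - 1)))"
  shows "1 \<le> bnd r \<or> 1 \<le> bnd (Suc r)"
proof -
  define \<nu> where "\<nu> = 1 / real k"
  define z where "z = real_of_int (- c) / real_of_int (a2 * x ^ k)"
  define \<theta> where "\<theta> = (of_int a1 / of_int a2 :: real) powr \<nu>"
  define P where "P = (\<lambda>r. real k ^ (2 * r) * W ^ r * pade r (-\<nu>) z)"
  define Q where "Q = (\<lambda>r. real k ^ (2 * r) * W ^ r * pade r \<nu> z)"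
  have \<nu>: "\<bar>\<nu>\<bar> < 1" "\<nu> \<noteq> 0" "\<bar>-\<nu>\<bar> < 1" using k by (auto simp: \<nu>_def)
  have Wpos: "W > 0" using pos by (simp add: W_def)
  have z0: "z \<noteq> 0" using c0 pos by (simp add: z_def)
  have az: "\<bar>z\<bar> = \<bar>of_int c\<bar> / W" using Wpos pos by (simp add: z_def W_def abs_divide abs_mult)
  have "2 * \<bar>real_of_int c\<bar> \<le> W" using cW unfolding W_def by linarith
  hence z2: "\<bar>z\<bar> \<le> 1/2" unfolding az using Wpos by (simp add: field_simps)
  have \<theta>pos: "\<theta> > 0" using pos by (simp add: \<theta>_def)
  have \<theta>k: "\<theta> ^ k = of_int a1 / of_int a2"
    using pos k by (simp add: \<theta>_def \<nu>_def powr_power)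
  have W1: "W = of_int a2 * of_int x ^ k" by (simp add: W_def)
  have z1: "1 + z = (\<theta> * of_int y / of_int x) ^ k"
  proof -
    have "z = - of_int c / W" by (simp add: z_def W_def)
    hence "1 + z = (W - of_int c) / W" using Wpos by (simp add: field_simps)
    also have "W - of_int c = of_int a1 * of_int y ^ k" by (simp add: c1 W1)
    finally show ?thesis using pos by (simp add: W1 power_divide power_mult_distrib \<theta>k)
  qed
  have z1r: "(1 + z) powr \<nu> = \<theta> * of_int y / of_int x"
  proof -
    have "(t ^ k) powr (1 / real k) = t" if "t > 0" for t
      using that k by (simp add: powr_powr flip: powr_realpow)
    moreover have "\<theta> * of_int y / of_int x > 0" using \<theta>pos pos by simp
    ultimately show ?thesis unfolding z1 \<nu>_def by blast
  qed
  have app: "\<bar>of_int x' - \<theta> * of_int y'\<bar> \<le> \<bar>of_int c\<bar> / (of_int a2 * of_int x' ^ (k - 1))"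
  proof -
    have "\<bar>real_of_int x' - \<theta> * of_int y'\<bar> * of_int x' ^ (k - 1) \<le> \<bar>of_int x' ^ k - (\<theta> * of_int y') ^ k\<bar>"
      using pos \<theta>pos k by (intro power_diff_ge) auto
    also have "real_of_int x' ^ k - (\<theta> * of_int y') ^ k = of_int c / of_int a2"
      using pos by (simp add: c2 power_mult_distrib \<theta>k field_simps)
    finally show ?thesis using pos by (simp add: field_simps abs_divide)
  qed
  have int: "P r \<in> \<int>" "Q r \<in> \<int>" for r
    unfolding P_def Q_def W_def z_def 
    by (rule pade_integral; use k pos in \<open>auto simp: \<nu>_def\<close>)+
  have step: "P r * of_int x * of_int y' = Q r * of_int y * of_int x' \<or> 1 \<le> bnd r" for r
  proof (cases "P r * of_int x * of_int y' = Q r * of_int y * of_int x'")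
    case False
    define I where "I = P r * of_int x * of_int y' - Q r * of_int y * of_int x'"
    have "I \<in> \<int>" unfolding I_def by (intro Ints_diff Ints_mult int) auto
    moreover have "I \<noteq> 0" using False by (simp add: I_def)
    ultimately have "1 \<le> \<bar>I\<bar>" by (rule Ints_nonzero_abs_ge1)
    also have "I = of_int y' * (P r * of_int x - \<theta> * of_int y * Q r) + Q r * of_int y * (\<theta> * of_int y' - of_int x')"
      by (simp add: I_def algebra_simps)
    also have "\<bar>\<dots>\<bar> \<le> of_int y' * \<bar>P r * of_int x - \<theta> * of_int y * Q r\<bar> + \<bar>Q r\<bar> * of_int y * \<bar>of_int x' - \<theta> * of_int y'\<bar>"
      using pos by (intro order.trans[OF abs_triangle_ineq]) (simp add: abs_mult abs_minus_commute)
    also have "\<dots> \<le> of_int y' * (of_int x * (4 * E ^ r * \<bar>of_int c\<bar> ^ Suc (2 * r) / W ^ Suc r))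
       + (4 * E ^ r * W ^ r) * of_int y * (\<bar>of_int c\<bar> / (of_int a2 * of_int x' ^ (k - 1)))"
    proof (intro add_mono mult_mono app)
      have "P r * of_int x - \<theta> * of_int y * Q r = real k ^ (2 * r) * W ^ r * of_int x * (pade r (-\<nu>) z - (1 + z) powr \<nu> * pade r \<nu> z)"
        unfolding z1r P_def Q_def using pos by (simp add: field_simps)
      also have "\<bar>\<dots>\<bar> = real k ^ (2 * r) * W ^ r * of_int x * \<bar>pade r (-\<nu>) z - (1 + z) powr \<nu> * pade r \<nu> z\<bar>"
        using Wpos pos by (simp add: abs_mult)
      also have "\<dots> \<le> real k ^ (2 * r) * W ^ r * of_int x * (4 * 16 ^ r * \<bar>z\<bar> ^ Suc (2 * r))"
        using Wpos pos by (intro mult_left_mono pade_remainder \<nu> z2) auto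
      also have "\<dots> = of_int x * (4 * E ^ r * (W ^ r * \<bar>z\<bar> ^ Suc (2 * r)))"
        by (simp add: E_def power_mult_distrib power_mult)
      also have "W ^ r * \<bar>z\<bar> ^ Suc (2 * r) = \<bar>of_int c\<bar> ^ Suc (2 * r) / W ^ Suc r"
      proof -
        have "W ^ Suc (2 * r) = W ^ r * W ^ Suc r" by (simp add: power_add [symmetric] mult_2)
        thus ?thesis unfolding az power_divide using Wpos by simp
      qed
      finally show "\<bar>P r * of_int x - \<theta> * of_int y * Q r\<bar> \<le> of_int x * (4 * E ^ r * \<bar>of_int c\<bar> ^ Suc (2 * r) / W ^ Suc r)" by simp
      have "\<bar>Q r\<bar> = real k ^ (2 * r) * W ^ r * \<bar>pade r \<nu> z\<bar>" using Wpos by (simp add: Q_def abs_mult)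
      also have "\<dots> \<le> real k ^ (2 * r) * W ^ r * (4 * 8 ^ r)"
        using Wpos by (intro mult_left_mono pade_abs_le \<nu> z2) auto
      also have "\<dots> \<le> real k ^ (2 * r) * W ^ r * (4 * 16 ^ r)"
        using Wpos by (intro mult_left_mono power_mono) auto
      also have "\<dots> = 4 * E ^ r * W ^ r" by (simp add: E_def power_mult_distrib power_mult)
      finally show "\<bar>Q r\<bar> \<le> 4 * E ^ r * W ^ r" .
    qed (use pos Wpos in \<open>auto simp: E_def\<close>)
    also have "\<dots> = bnd r" by (simp add: bnd_def mult_ac)
    finally show ?thesis by simp
  qed simp
  show ?thesis
  proof (rule ccontr)
    assume "\<not> ?thesis"
    hence e: "P r * of_int x * of_int y' = Q r * of_int y * of_int x'" 
      "P (Suc r) * of_int x * of_int y' = Q (Suc r) * of_int y * of_int x'"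
      using step[of r] step[of "Suc r"] by auto
    have "(P r * Q (Suc r)) * (of_int x * of_int y') = (P r * of_int x * of_int y') * Q (Suc r)" by simp
    also have "\<dots> = (P (Suc r) * of_int x * of_int y') * Q r" unfolding e by simp
    also have "\<dots> = (P (Suc r) * Q r) * (of_int x * of_int y')" by simp
    finally have "P r * Q (Suc r) = P (Suc r) * Q r" using pos by simp
    hence "(real k ^ (2 * r) * W ^ r * (real k ^ (2 * Suc r) * W ^ Suc r)) * (pade r (-\<nu>) z * pade (Suc r) \<nu> z)
       = (real k ^ (2 * r) * W ^ r * (real k ^ (2 * Suc r) * W ^ Suc r)) * (pade (Suc r) (-\<nu>) z * pade r \<nu> z)"
      by (simp only: P_def Q_def mult_ac)
    moreover have "real k ^ (2 * r) * W ^ r * (real k ^ (2 * Suc r) * W ^ Suc r) \<noteq> 0" using k Wpos by auto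
    ultimately have "pade r (-\<nu>) z * pade (Suc r) \<nu> z = pade (Suc r) (-\<nu>) z * pade r \<nu> z" by (metis mult_cancel_left)
    thus False using pade_nonvanishing[OF \<nu>(1,2) z0] by blast
  qed
qed

section \<open>Large elements\<close>

text \<open>
  The logarithm of a sqrt(c). With this normalisation the logarithm of c a b is the sum of
  the values at a and b.
\<close>

definition lsize :: "int \<Rightarrow> int \<Rightarrow> real" where
  "lsize c a = ln (of_int c) / 2 + ln (of_int a)"

lemma ln_prod_eq_lsize:
  assumes "c > 0" "a > 0" "b > 0"
  shows "ln (real_of_int (c * a * b)) = lsize c a + lsize c b"
  using assms by (simp add: lsize_def ln_mult)

lemma lsize_less: "0 < a \<Longrightarrow> a < b \<Longrightarrow> lsize c a < lsize c b"
  by (simp add: lsize_def)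

lemma large_product:
  fixes c a b n :: int and k :: nat
  assumes k: "k \<ge> 3" and pos: "c > 0" "a > 0" "b > 0" 
    and la: "lsize c a \<ge> 3 * real k * ln (of_int \<bar>n\<bar> + 1)" "lsize c b \<ge> 3 * real k * ln (of_int \<bar>n\<bar> + 1)"
  shows "2 * \<bar>n\<bar> \<le> c * a * b"
proof (cases "n = 0")
  case True thus ?thesis using pos by simp
next
  case False
  define N where "N = real_of_int \<bar>n\<bar> + 1"
  have N: "N \<ge> 2" using False by (simp add: N_def)
  have "2 * ln N \<le> (6 * real k) * ln N" using k N by (intro mult_right_mono) auto
  also have "\<dots> \<le> ln (real_of_int (c * a * b))"
    using la unfolding ln_prod_eq_lsize[OF pos] N_def by simp
  finally have "ln (N ^ 2) \<le> ln (real_of_int (c * a * b))" using N by (simp add: ln_realpow)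
  hence "N ^ 2 \<le> real_of_int (c * a * b)" using N pos by (subst (asm) ln_le_cancel_iff) auto
  moreover have "2 * N \<le> N ^ 2" using N by (simp add: power2_eq_square)
  ultimately have "2 * N \<le> real_of_int (c * a * b)" by linarith
  hence "real_of_int (2 * (\<bar>n\<bar> + 1)) \<le> real_of_int (c * a * b)" unfolding N_def by simp
  hence "2 * (\<bar>n\<bar> + 1) \<le> c * a * b" by (simp only: of_int_le_iff)
  thus ?thesis by simp
qed

text \<open>
  For large a and b the term n changes c a b by a factor between 1/2 and 2 only, so the k-th root
  may be taken positive and has the expected logarithmic size.
\<close>

lemma nth_root_of_large:
  fixes c a b n :: int and k :: nat
  assumes k: "k \<ge> 3" and pos: "c > 0" "a > 0" "b > 0"
    and la: "lsize c a \<ge> 3 * real k * ln (of_int \<bar>n\<bar> + 1)" "lsize c b \<ge> 3 * real k * ln (of_int \<bar>n\<bar> + 1)"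
    and pw: "is_nth_power k (c * a * b + n)"
  obtains x :: int where "x > 0" "x ^ k = c * a * b + n"
    "\<bar>real k * ln (of_int x) - (lsize c a + lsize c b)\<bar> \<le> ln 2"
proof -
  define p where "p = c * a * b"
  have p: "p > 0" using pos by (simp add: p_def)
  have np: "2 * \<bar>n\<bar> \<le> p" unfolding p_def by (rule large_product[OF k pos la])
  from pw obtain y where y: "p + n = y ^ k" by (auto simp: is_nth_power_def p_def)
  define x where "x = \<bar>y\<bar>"
  have pn: "p + n > 0" using np p by linarith
  have "x ^ k = \<bar>y ^ k\<bar>" by (simp only: x_def power_abs)
  hence xk: "x ^ k = p + n" using pn y by simp
  have "x \<noteq> 0" using xk pn k by (intro notI) (auto simp: power_0_left)
  hence x0: "x > 0" by (simp add: x_def)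
  have l: "real k * ln (of_int x) = ln (real_of_int (p + n))" 
    using x0 by (subst xk[symmetric]) (simp add: ln_realpow)
  have "ln (real_of_int p / 2) \<le> ln (real_of_int (p + n))"
    using p np pn by (subst ln_le_cancel_iff) auto
  moreover have "ln (real_of_int (p + n)) \<le> ln (real_of_int p * 2)"
    using p np pn by (subst ln_le_cancel_iff) auto
  ultimately have "\<bar>real k * ln (of_int x) - ln (of_int p)\<bar> \<le> ln 2"
    unfolding l using p by (simp add: ln_div ln_mult abs_le_iff)
  thus ?thesis using that[of x] x0 xk ln_prod_eq_lsize[OF pos] by (simp add: p_def)
qed

lemma pade_error_small:
  fixes x y E C W :: real
  assumes "x > 0" "y > 0" "E > 0" "C > 0" "W > 0"
    and "ln 8 + ln x + ln y + real r * ln E + real (Suc (2 * r)) * ln C - real (Suc r) * ln W < 0"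
  shows "4 * x * y * E ^ r * C ^ Suc (2 * r) / W ^ Suc r < 1 / 2"
proof -
  have "ln (8 * x * y * E ^ r * C ^ Suc (2 * r) / W ^ Suc r) < ln 1"
    using assms by (simp add: ln_mult ln_div ln_realpow del: power_Suc)
  hence "8 * x * y * E ^ r * C ^ Suc (2 * r) / W ^ Suc r < 1"
    using assms by (subst (asm) ln_less_cancel_iff) (auto intro!: divide_pos_pos mult_pos_pos)
  thus ?thesis by simp
qed

lemma root_error_small:
  fixes x y E C W a :: real
  assumes "x > 0" "y > 0" "E > 0" "C > 0" "W > 0" "a > 0"
    and "ln 8 + real r * ln E + real r * ln W + ln y + (ln C - ln a) - real m * ln x < 0"
  shows "4 * E ^ r * W ^ r * y * (C / (a * x ^ m)) < 1 / 2"
proof -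
  have "ln (8 * E ^ r * W ^ r * y * (C / (a * x ^ m))) < ln 1"
    using assms by (simp add: ln_mult ln_div ln_realpow del: power_Suc)
  hence "8 * E ^ r * W ^ r * y * (C / (a * x ^ m)) < 1"
    using assms by (subst (asm) ln_less_cancel_iff) (auto intro!: divide_pos_pos mult_pos_pos)
  thus ?thesis by simp
qed

text \<open>
  Write T and U for the sizes of a3 and a4. Everything that concerns a1 and a2 only is
  negligible against T. In these terms the Pade error of order r has logarithm about
  U/k - (r + 2/3) T or less, and the error contributed by the second approximation is about
  (r + 1/3) T - (k - 1) U/k or less. For k at least 3 both are negative for two consecutive values of
  r near 3/2 U/(k T), contrary to the lower bound of Thue's method.
\<close>

lemma four_rapidly_growing_impossible:
  fixes c n a1 a2 a3 a4 :: int and k :: nat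
  assumes k: "k \<ge> 3" and c: "c > 0" and n: "n \<noteq> 0" and a: "0 < a1" "a1 < a2" "a3 > 0" "a4 > 0"
    and pw: "is_nth_power k (c * a1 * a3 + n)" "is_nth_power k (c * a2 * a3 + n)"
        "is_nth_power k (c * a1 * a4 + n)" "is_nth_power k (c * a2 * a4 + n)"
    and l1: "lsize c a1 \<ge> 3 * real k * ln (of_int \<bar>n\<bar> + 1)"
    and l2: "lsize c a2 \<ge> 60 * real k * lsize c a1"
    and l3: "lsize c a3 \<ge> 60 * real k * lsize c a2"
    and l4: "lsize c a4 \<ge> 60 * real k * lsize c a3"
  shows False
proof -
  define A1 s T U \<eta> where "A1 = lsize c a1" and "s = lsize c a2" and "T = lsize c a3" and "U = lsize c a4"
    and "\<eta> = ln (real_of_int \<bar>n\<bar> + 1)"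
  note d = A1_def[symmetric] s_def[symmetric] T_def[symmetric] U_def[symmetric] \<eta>_def[symmetric]
  have a2: "a2 > 0" using a by simp
  have l2pos: "(2/3::real) \<le> ln 2" "ln (2::real) \<le> 25/36" using ln2_ge_two_thirds ln2_le_25_over_36 by auto
  have \<eta>: "ln 2 \<le> \<eta>" unfolding \<eta>_def using n by (subst ln_le_cancel_iff) auto
  have "3 * real k * \<eta> \<ge> 9 * \<eta>" using k \<eta> l2pos by (intro mult_right_mono) auto
  hence A1: "A1 \<ge> 9 * \<eta>" using l1 unfolding d by linarith
  have grow: "60 * real k * v \<ge> 180 * v" if "v \<ge> 0" for v using k that by (intro mult_right_mono) auto
  have s: "s \<ge> 180 * A1" using grow[of A1] A1 \<eta> l2pos l2 unfolding d by linarith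
  have T: "T \<ge> 180 * s" using grow[of s] s A1 \<eta> l2pos l3 unfolding d by linarith
  have U: "U \<ge> 60 * real k * T" using l4 unfolding d .
  define V where "V = U / real k"
  have V: "V \<ge> 60 * T" using U k by (simp add: V_def field_simps)
  have T0: "T > 0" "s > 0" "A1 > 0" using T s A1 \<eta> l2pos by linarith+
  have U2: "U \<ge> T" using grow[of T] U T0 by linarith
  have \<eta>k: "3 * real k * \<eta> \<le> A1" using l1 unfolding d .
  have la: "lsize c a1 \<ge> 3 * real k * ln (of_int \<bar>n\<bar> + 1)" "lsize c a2 \<ge> 3 * real k * ln (of_int \<bar>n\<bar> + 1)"
     "lsize c a3 \<ge> 3 * real k * ln (of_int \<bar>n\<bar> + 1)" "lsize c a4 \<ge> 3 * real k * ln (of_int \<bar>n\<bar> + 1)"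
    unfolding d using \<eta>k s T U2 T0 by linarith+
  obtain x where x: "x > 0" "x ^ k = c * a1 * a3 + n" "\<bar>real k * ln (of_int x) - (A1 + T)\<bar> \<le> ln 2"
    using nth_root_of_large[OF k c a(1) a(3) la(1,3) pw(1)] unfolding d by metis
  obtain y where y: "y > 0" "y ^ k = c * a2 * a3 + n" "\<bar>real k * ln (of_int y) - (s + T)\<bar> \<le> ln 2"
    using nth_root_of_large[OF k c a2 a(3) la(2,3) pw(2)] unfolding d by metis
  obtain x' where x': "x' > 0" "x' ^ k = c * a1 * a4 + n" "\<bar>real k * ln (of_int x') - (A1 + U)\<bar> \<le> ln 2"
    using nth_root_of_large[OF k c a(1) a(4) la(1,4) pw(3)] unfolding d by metis
  obtain y' where y': "y' > 0" "y' ^ k = c * a2 * a4 + n" "\<bar>real k * ln (of_int y') - (s + U)\<bar> \<le> ln 2"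
    using nth_root_of_large[OF k c a2 a(4) la(2,4) pw(4)] unfolding d by metis
  define e where "e = n * (a2 - a1)"
  have e0: "e \<noteq> 0" using n a by (simp add: e_def)
  have e1: "e = a2 * x ^ k - a1 * y ^ k" "e = a2 * x' ^ k - a1 * y' ^ k"
    unfolding x(2) y(2) x'(2) y'(2) e_def by (simp_all add: algebra_simps)
  define W where "W = real_of_int (a2 * x ^ k)"
  have W0: "W > 0" using a2 x(1) by (simp add: W_def)
  have lnW: "ln W = ln (of_int a2) + real k * ln (of_int x)"
    using a2 x(1) by (simp add: W_def ln_mult ln_realpow)
  have \<gamma>: "ln (of_int a2) \<le> s" "s - A1 \<le> ln (of_int a2)"
    using a c unfolding s_def A1_def lsize_def by auto
  have ec: "\<bar>e\<bar> \<le> \<bar>n\<bar> * a2" using a by (simp add: e_def abs_mult mult_left_mono)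
  hence "ln (real_of_int \<bar>e\<bar>) \<le> ln ((real_of_int \<bar>n\<bar> + 1) * of_int a2)"
  proof (subst ln_le_cancel_iff)
    have "real_of_int \<bar>e\<bar> \<le> real_of_int (\<bar>n\<bar> * a2)" using ec by linarith
    also have "\<dots> \<le> (real_of_int \<bar>n\<bar> + 1) * of_int a2" using a2 by (simp add: algebra_simps)
    finally show "real_of_int \<bar>e\<bar> \<le> (real_of_int \<bar>n\<bar> + 1) * of_int a2" .
  qed (use e0 a2 in auto)
  also have "\<dots> = \<eta> + ln (of_int a2)" using a2 by (simp add: \<eta>_def ln_mult_pos)
  finally have lne: "ln (real_of_int \<bar>e\<bar>) \<le> \<eta> + ln (of_int a2)" .
  have cW: "2 * \<bar>e\<bar> \<le> a2 * x ^ k"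
  proof -
    have "ln (2 * real_of_int \<bar>e\<bar>) = ln 2 + ln (real_of_int \<bar>e\<bar>)" using e0 by (simp add: ln_mult_pos)
    also have "\<dots> \<le> ln W" unfolding lnW using lne x(3) A1 T s T0 \<eta> by linarith
    finally have "2 * real_of_int \<bar>e\<bar> \<le> W" using e0 W0 by (subst (asm) ln_le_cancel_iff) auto
    thus ?thesis unfolding W_def by linarith
  qed
  define E where "E = 16 * real k ^ 2"
  have E0: "E > 0" using k by (simp add: E_def)
  have lnE: "ln E \<le> 2 * s" "ln E \<ge> 0"
  proof -
    have "ln E = ln (2 ^ 4) + 2 * ln (real k)" using k by (simp add: E_def ln_mult ln_realpow)
    also have "ln (2 ^ 4 :: real) = 4 * ln 2" by (subst ln_realpow) auto
    finally have "ln E = 4 * ln 2 + 2 * ln (real k)" .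
    moreover have "ln (real k) \<le> real k - 1" using k by (intro ln_le_minus_one) auto
    moreover have "3 * real k * \<eta> \<ge> 3 * real k * (2/3)" using \<eta> l2pos by (intro mult_left_mono) auto
    ultimately show "ln E \<le> 2 * s" using \<eta>k s T0 l2pos k by linarith
    have "1 * 1 \<le> 16 * real k ^ 2" using k by (intro mult_mono one_le_power) auto
    thus "ln E \<ge> 0" by (simp add: E_def)
  qed
  have kdiv: "v / real k \<le> v / 3" if "v \<ge> 0" for v using that k by (intro divide_left_mono) auto
  have kb: "t \<le> w / real k" if "real k * t \<le> w" for t w using that k by (simp add: field_simps)
  have X: "ln (of_int x) \<le> T / 3 + s"
  proof -
    have "ln (of_int x) \<le> (A1 + T + ln 2) / real k" using x(3) by (intro kb) linarith
    also have "\<dots> \<le> (A1 + T + ln 2) / 3" using T0 l2pos by (intro kdiv) linarith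
    finally show ?thesis using s A1 \<eta> T0 unfolding add_divide_distrib by linarith
  qed
  have Y: "ln (of_int y) \<le> T / 3 + s"
  proof -
    have "ln (of_int y) \<le> (s + T + ln 2) / real k" using y(3) by (intro kb) linarith
    also have "\<dots> \<le> (s + T + ln 2) / 3" using T0 l2pos by (intro kdiv) linarith
    finally show ?thesis using s A1 \<eta> T0 unfolding add_divide_distrib by linarith
  qed
  have Y': "ln (of_int y') \<le> V + s"
  proof -
    have "ln (of_int y') \<le> (U + (s + ln 2)) / real k" using y'(3) by (intro kb) linarith
    also have "\<dots> = V + (s + ln 2) / real k" by (simp add: V_def add_divide_distrib)
    also have "\<dots> \<le> V + (s + ln 2) / 3" using T0 l2pos kdiv[of "s + ln 2"] by linarith
    finally show ?thesis using s A1 \<eta> T0 unfolding add_divide_distrib by linarith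
  qed
  have X': "ln (of_int x') \<ge> V"
  proof -
    have "real k * ln (of_int x') \<ge> U" using x'(3) A1 \<eta> l2pos by linarith
    thus ?thesis using k by (simp add: V_def field_simps)
  qed
  have V0: "V > 0" using V T0 by linarith
  have kX': "real (k - 1) * ln (of_int x') \<ge> 2 * V"
    using k X' V0 by (intro mult_mono) auto
  have W1: "ln W \<ge> T" unfolding lnW using x(3) \<gamma> s A1 \<eta> l2pos T0 by linarith
  have W2: "ln W \<le> T + 3 * s" unfolding lnW using x(3) \<gamma> s A1 \<eta> l2pos T0 by linarith
  have lne2: "ln (real_of_int \<bar>e\<bar>) \<le> 2 * s" using lne \<gamma> s A1 \<eta> l2pos T0 by linarith
  have ln8: "ln (8::real) \<le> s"
  proof -
    have "ln (8::real) = ln (2 ^ 3)" by simp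
    also have "\<dots> = 3 * ln 2" by (subst ln_realpow) auto
    finally show ?thesis using s A1 \<eta> l2pos T0 by linarith
  qed
  define bnd where "bnd = (\<lambda>r. 4 * of_int x * of_int y' * E ^ r * \<bar>of_int e\<bar> ^ Suc (2 * r) / W ^ Suc r
     + 4 * E ^ r * W ^ r * of_int y * (\<bar>of_int e\<bar> / (of_int a2 * of_int x' ^ (k - 1))) :: real)"
  have small: "bnd r < 1" if q1: "1.5 * V \<le> real (Suc r) * T" and q2: "real (Suc r) * T \<le> 1.5 * V + 2 * T" for r
  proof -
    define q p where "q = real (Suc r) * T" and "p = real (Suc r) * s"
    have "real (Suc r) * (180 * s) \<le> q" unfolding q_def using T by (intro mult_left_mono) auto
    hence p: "180 * p \<le> q" by (simp add: p_def)
    have rs: "real r * s = p - s" and rT: "real r * T = q - T" by (simp_all add: p_def q_def algebra_simps)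
    have p0: "p \<ge> s" using T0 by (simp add: p_def)
    have \<eta>s: "\<eta> \<le> s" using s A1 \<eta> l2pos T0 by linarith
    have Y3: "3 * ln (of_int y) \<le> T + 3 * s" using Y by simp
    have q': "3 * V \<le> 2 * q" "2 * q \<le> 3 * V + 4 * T" using q1 q2 by (simp_all add: q_def)
    have q: "1.5 * V \<le> q" "q \<le> 1.5 * V + 2 * T" using q1 q2 by (simp_all add: q_def)
    have rE: "real r * ln E \<le> 2 * (p - s)" using mult_left_mono[OF lnE(1), of "real r"] rs by simp
    have re: "real (Suc (2 * r)) * ln (real_of_int \<bar>e\<bar>) \<le> 4 * p"
    proof -
      have "real (Suc (2 * r)) * ln (real_of_int \<bar>e\<bar>) \<le> real (Suc (2 * r)) * (2 * s)"
        using lne2 by (intro mult_left_mono) auto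
      also have "\<dots> \<le> 4 * p" using T0 by (simp add: p_def algebra_simps)
      finally show ?thesis .
    qed
    have rW: "q \<le> real (Suc r) * ln W" unfolding q_def using W1 by (intro mult_left_mono) auto
    have rW2: "real r * ln W \<le> (q - T) + 3 * (p - s)" 
      using mult_left_mono[OF W2, of "real r"] rs rT by (simp add: algebra_simps)
    have "4 * of_int x * of_int y' * E ^ r * \<bar>of_int e\<bar> ^ Suc (2 * r) / W ^ Suc r < 1 / 2"
    proof (rule pade_error_small)
      show "ln 8 + ln (of_int x) + ln (of_int y') + real r * ln E + real (Suc (2 * r)) * ln \<bar>of_int e\<bar> - real (Suc r) * ln W < 0"
        using X Y' rE re rW p q V ln8 T0 p0 T V0 by simp
    qed (use x y' E0 e0 W0 in auto)
    moreover have "4 * E ^ r * W ^ r * of_int y * (\<bar>of_int e\<bar> / (of_int a2 * of_int x' ^ (k - 1))) < 1 / 2"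
    proof (rule root_error_small)
      show "ln 8 + real r * ln E + real r * ln W + ln (of_int y) + (ln \<bar>of_int e\<bar> - ln (of_int a2)) - real (k - 1) * ln (of_int x') < 0"
        using Y3 rE rW2 p q' V ln8 T0 V0 kX' lne[unfolded of_int_abs] \<eta>s by (simp only: right_diff_distrib)
    qed (use x' y E0 e0 W0 a2 in auto)
    ultimately show ?thesis unfolding bnd_def by linarith
  qed
  \<comment> \<open>The two errors require r + 1 to lie well above V / T and well below 2 V / T; the factor 3/2 is the middle.\<close>
  define r where "r = nat \<lceil>1.5 * V / T\<rceil> - 1"
  have "1.5 * V / T > 0" using V0 T0 by simp
  hence "real (Suc r) = of_int \<lceil>1.5 * V / T\<rceil>" unfolding r_def by (simp add: of_nat_diff Suc_leI)
  hence "1.5 * V / T \<le> real (Suc r)" "real (Suc r) \<le> 1.5 * V / T + 1" by linarith+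
  hence r: "1.5 * V \<le> real (Suc r) * T" "real (Suc r) * T \<le> 1.5 * V + T" using T0 by (simp_all add: field_simps)
  have "bnd r < 1" using r T0 by (intro small) auto
  moreover have "bnd (Suc r) < 1" using r T0 by (intro small) (auto simp: algebra_simps)
  moreover have "1 \<le> bnd r \<or> 1 \<le> bnd (Suc r)"
    unfolding bnd_def E_def W_def
    by (rule thue_root_approximations[of k a1 a2 x y x' y' e r]) (use k a a2 x y x' y' e0 e1 cW in auto)
  ultimately show False by linarith
qed

text \<open>
  Let X^k = (c a u + n)(c b v + n) and Y^k = (c a v + n)(c b u + n). Then
  X^k - Y^k = n c (b - a)(v - u) is nonzero, so its modulus is at least X^(k - 1). Comparing
  sizes gives the growth, because k - 1 is at least 2 and log |n| is negligible.
\<close>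

lemma gap_principle:
  fixes c n a b u v :: int and k :: nat
  assumes k: "k \<ge> 3" and c: "c > 0" and n: "n \<noteq> 0" and ab: "0 < a" "a < b" and uv: "0 < u" "u < v"
    and pw: "is_nth_power k (c * a * u + n)" "is_nth_power k (c * b * v + n)"
        "is_nth_power k (c * a * v + n)" "is_nth_power k (c * b * u + n)"
    and la: "lsize c a \<ge> 3 * real k * ln (of_int \<bar>n\<bar> + 1)" "lsize c u \<ge> 3 * real k * ln (of_int \<bar>n\<bar> + 1)"
  shows "3 / 2 * (lsize c a + lsize c u) \<le> lsize c b + lsize c v"
proof -
  define \<eta> where "\<eta> = ln (real_of_int \<bar>n\<bar> + 1)"
  have \<eta>: "ln 2 \<le> \<eta>" unfolding \<eta>_def using n by (subst ln_le_cancel_iff) auto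
  have bv: "b > 0" "v > 0" using ab uv by auto
  have lb: "lsize c b \<ge> 3 * real k * ln (of_int \<bar>n\<bar> + 1)" "lsize c v \<ge> 3 * real k * ln (of_int \<bar>n\<bar> + 1)"
    using la lsize_less[of a b c] lsize_less[of u v c] ab uv by auto
  obtain x1 where x1: "x1 > 0" "x1 ^ k = c * a * u + n" "\<bar>real k * ln (of_int x1) - (lsize c a + lsize c u)\<bar> \<le> ln 2"
    using nth_root_of_large[OF k c ab(1) uv(1) la pw(1)] by metis
  obtain x2 where x2: "x2 > 0" "x2 ^ k = c * b * v + n" "\<bar>real k * ln (of_int x2) - (lsize c b + lsize c v)\<bar> \<le> ln 2"
    using nth_root_of_large[OF k c bv lb pw(2)] by metis
  obtain x3 where x3: "x3 > 0" "x3 ^ k = c * a * v + n"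
    using nth_root_of_large[OF k c ab(1) bv(2) la(1) lb(2) pw(3)] by metis
  obtain x4 where x4: "x4 > 0" "x4 ^ k = c * b * u + n"
    using nth_root_of_large[OF k c bv(1) uv(1) lb(1) la(2) pw(4)] by metis
  define X Y where "X = x1 * x2" and "Y = x3 * x4"
  have XY: "X > 0" "Y > 0" using x1 x2 x3 x4 by (auto simp: X_def Y_def)
  have diff: "X ^ k - Y ^ k = n * c * (b - a) * (v - u)"
    unfolding X_def Y_def power_mult_distrib x1(2) x2(2) x3(2) x4(2) by (simp add: algebra_simps)
  have "X \<noteq> Y" using diff n c ab uv by auto
  hence "1 \<le> \<bar>real_of_int X - of_int Y\<bar>" by linarith
  hence "1 * real_of_int X ^ (k - 1) \<le> \<bar>real_of_int X - of_int Y\<bar> * of_int X ^ (k - 1)"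
    using XY by (intro mult_right_mono) auto
  also have "\<dots> \<le> \<bar>of_int X ^ k - of_int Y ^ k\<bar>" using XY k by (intro power_diff_ge) auto
  also have "\<dots> = real_of_int \<bar>n * c * (b - a) * (v - u)\<bar>" unfolding diff[symmetric] by simp
  also have "\<bar>n * c * (b - a) * (v - u)\<bar> = \<bar>n\<bar> * (c * (b - a) * (v - u))" using c ab uv by (simp add: abs_mult)
  also have "real_of_int \<dots> \<le> real_of_int (\<bar>n\<bar> * (c * b * v))"
    using c ab uv bv by (subst of_int_le_iff) (intro mult_left_mono mult_mono, auto)
  also have "\<dots> \<le> (real_of_int \<bar>n\<bar> + 1) * real_of_int (c * b * v)" using c bv by (simp add: algebra_simps)
  finally have "ln (real_of_int X ^ (k - 1)) \<le> ln ((real_of_int \<bar>n\<bar> + 1) * real_of_int (c * b * v))"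
    using XY c bv by (subst ln_le_cancel_iff) auto
  also have "\<dots> = \<eta> + ln (real_of_int (c * b * v))" using c bv by (subst ln_mult_pos) (auto simp: \<eta>_def)
  also have "\<dots> = \<eta> + (lsize c b + lsize c v)" by (simp only: ln_prod_eq_lsize[OF c bv])
  finally have "real (k - 1) * ln (of_int X) \<le> \<eta> + (lsize c b + lsize c v)" using XY by (simp add: ln_realpow)
  hence "real k * (real (k - 1) * ln (of_int X)) \<le> real k * (\<eta> + (lsize c b + lsize c v))" by (intro mult_left_mono) auto
  hence m: "real (k - 1) * (real k * ln (of_int X)) \<le> real k * (\<eta> + (lsize c b + lsize c v))" by (simp add: mult_ac)
  define S R where "S = lsize c a + lsize c u" and "R = lsize c b + lsize c v"
  have S0: "6 * (real k * \<eta>) \<le> S" using la unfolding \<eta>_def[symmetric] S_def by linarith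
  have "ln (real_of_int X) = ln (of_int x1) + ln (of_int x2)" using x1 x2 by (simp add: X_def ln_mult)
  hence "real k * ln (of_int X) = real k * ln (of_int x1) + real k * ln (of_int x2)" by (simp add: algebra_simps)
  hence "real k * ln (of_int X) \<ge> S + R - 2 * \<eta>" using x1(3) x2(3) \<eta> unfolding S_def R_def by linarith
  hence "real (k - 1) * (S + R - 2 * \<eta>) \<le> real k * (\<eta> + R)" 
    using m mult_left_mono[of "S + R - 2 * \<eta>" "real k * ln (of_int X)" "real (k - 1)"] unfolding R_def by linarith
  hence h: "(real k - 1) * S \<le> (3 * real k - 2) * \<eta> + R" using k by (simp add: of_nat_diff algebra_simps)
  have e0: "\<eta> > 0" using \<eta> by (smt (verit) ln_gt_zero)
  have "(3 * real k - 2) * \<eta> \<le> 3 * (real k * \<eta>)" using e0 by (simp add: algebra_simps)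
  hence "(real k - 1) * S \<le> S / 2 + R" using h S0 by linarith
  moreover have "2 * S \<le> (real k - 1) * S"
  proof (rule mult_right_mono)
    have "real k * \<eta> \<ge> 0" using e0 by simp
    thus "S \<ge> 0" using S0 by linarith
  qed (use k in auto)
  ultimately show ?thesis unfolding S_def R_def by linarith
qed

text \<open>
  Among consecutive elements the gap principle multiplies lsize by at least 3/2 every three
  steps. Hence elements at a distance of 3t, where (3/2)^t exceeds 60 k, grow fast enough for
  Thue's method, and four of them cannot coexist.
\<close>

lemma large_elements_bounded:
  fixes k :: nat
  assumes k: "k \<ge> 3"
  obtains K :: nat where "\<And>(c::int) (n::int) E. c > 0 \<Longrightarrow> n \<noteq> 0 \<Longrightarrow> finite E \<Longrightarrow> (\<And>a. a \<in> E \<Longrightarrow> a > 0) \<Longrightarrow>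
     (\<And>a. a \<in> E \<Longrightarrow> lsize c a \<ge> 3 * real k * ln (of_int \<bar>n\<bar> + 1)) \<Longrightarrow>
     (\<And>a b. a \<in> E \<Longrightarrow> b \<in> E \<Longrightarrow> a \<noteq> b \<Longrightarrow> is_nth_power k (c * a * b + n)) \<Longrightarrow> card E \<le> K"
proof -
  obtain t :: nat where t: "60 * real k < (3/2) ^ t" using real_arch_pow[of "3/2" "60 * real k"] by auto
  have t0: "t > 0" using t k by (intro Nat.gr0I) auto
  have "card E \<le> 9 * t" if c: "c > 0" and n: "n \<noteq> 0" and fin: "finite E" and pos: "\<And>a. a \<in> E \<Longrightarrow> a > 0"
     and la: "\<And>a. a \<in> E \<Longrightarrow> lsize c a \<ge> 3 * real k * ln (of_int \<bar>n\<bar> + 1)"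
     and pw: "\<And>a b. a \<in> E \<Longrightarrow> b \<in> E \<Longrightarrow> a \<noteq> b \<Longrightarrow> is_nth_power k (c * a * b + n)" for c n :: int and E
  proof (rule ccontr)
    assume big: "\<not> card E \<le> 9 * t"
    define e where "e = (\<lambda>i. sorted_list_of_set E ! i)"
    have len: "length (sorted_list_of_set E) = card E" using fin by simp
    have eE: "e i \<in> E" if "i < card E" for i
      using that len fin unfolding e_def by (metis nth_mem set_sorted_list_of_set)
    have mono: "e i < e j" if "i < j" "j < card E" for i j
      using that len sorted_wrt_nth_less[of "(<)" "sorted_list_of_set E" i j] strict_sorted_list_of_set[of E] fin
      unfolding e_def by (simp add: strict_sorted_iff)
    define A where "A = (\<lambda>i. lsize c (e i))"
    have pw': "is_nth_power k (c * e i * e j + n)" if "i < card E" "j < card E" "i \<noteq> j" for i j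
      using that mono[of i j] mono[of j i] by (intro pw eE) (auto simp: neq_iff)
    have step: "A (i + 3) \<ge> 3 / 2 * A i" if "i + 3 < card E" for i
    proof -
      \<comment> \<open>The four indices are paired as i < i + 2 and i + 1 < i + 3, so that no element occurs twice in a product.\<close>
      have "3 / 2 * (lsize c (e i) + lsize c (e (i + 1))) \<le> lsize c (e (i + 2)) + lsize c (e (i + 3))"
        by (rule gap_principle[OF k c n]) (use that in \<open>auto intro!: pos eE mono pw' la simp del: of_int_abs\<close>)
      moreover have "A i < A (i + 1)" "A (i + 2) < A (i + 3)"
        using that unfolding A_def by (auto intro!: lsize_less pos eE mono)
      moreover have "3 / 2 * p \<le> v'" if "3 / 2 * (p + q) \<le> u + v'" "p < q" "u < v'" for p q u v' :: real
        using that by (simp add: field_simps)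
      ultimately show ?thesis unfolding A_def by blast
    qed
    have steps: "i + 3 * m < card E \<Longrightarrow> A (i + 3 * m) \<ge> (3 / 2) ^ m * A i" for i m
    proof (induction m)
      case (Suc m)
      have "(3/2) ^ Suc m * A i = 3/2 * ((3/2) ^ m * A i)" by simp
      also have "\<dots> \<le> 3 / 2 * A (i + 3 * m)" using Suc by (intro mult_left_mono) auto
      also have "\<dots> \<le> A (i + 3 * m + 3)" using Suc.prems by (intro step) auto
      finally show ?case by (simp add: algebra_simps)
    qed simp
    have Apos: "A i \<ge> 0" if "i < card E" for i
    proof -
      have "0 \<le> 3 * real k * ln (real_of_int \<bar>n\<bar> + 1)" by simp
      also have "\<dots> \<le> A i" unfolding A_def by (intro la eE that)
      finally show ?thesis .
    qed
    have grow: "A (i + 3 * t) \<ge> 60 * real k * A i" if "i + 3 * t < card E" for i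
    proof -
      have "60 * real k * A i \<le> (3/2) ^ t * A i" using t Apos[of i] that by (intro mult_right_mono) auto
      also have "\<dots> \<le> A (i + 3 * t)" using that by (rule steps)
      finally show ?thesis .
    qed
    show False
    proof (rule four_rapidly_growing_impossible[OF k c n, of "e 0" "e (3 * t)" "e (6 * t)" "e (9 * t)"])
      show "60 * real k * lsize c (e 0) \<le> lsize c (e (3 * t))" using grow[of 0] big by (simp add: A_def)
      show "60 * real k * lsize c (e (3 * t)) \<le> lsize c (e (6 * t))" using grow[of "3 * t"] big by (simp add: A_def)
      show "60 * real k * lsize c (e (6 * t)) \<le> lsize c (e (9 * t))" using grow[of "6 * t"] big by (simp add: A_def)
    qed (use big t0 in \<open>auto intro!: pos eE mono pw' la simp del: of_int_abs\<close>)
  qed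
  thus ?thesis using that[of "9 * t"] by blast
qed

section \<open>Chebyshev and Mertens estimates and the Moebius function\<close>

text \<open>
  Summation over all factorisations n = d m with n at most x.
\<close>

lemma sum_divisors_eq_hyperbola:
  fixes F :: "nat \<Rightarrow> nat \<Rightarrow> 'a :: comm_monoid_add"
  shows "(\<Sum>n=1..x. \<Sum>d | d dvd n. F d (n div d)) = (\<Sum>d=1..x. \<Sum>m=1..x div d. F d m)"
proof -
  have aux: "b \<le> x" if "b * k \<le> x" "0 < k" for b k x :: nat using that by (cases k) auto
  have "(\<Sum>n=1..x. \<Sum>d | d dvd n. F d (n div d)) = (\<Sum>(n, d)\<in>Sigma {1..x} (\<lambda>n. {d. d dvd n}). F d (n div d))"
    by (intro sum.Sigma) auto
  also have "\<dots> = (\<Sum>(d, m)\<in>Sigma {1..x} (\<lambda>d. {1..x div d}). F d m)"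
    by (intro sum.reindex_bij_witness[of _ "\<lambda>(d, m). (d * m, d)" "\<lambda>(n, d). (d, n div d)"])
       (auto simp: Suc_le_eq less_eq_div_iff_mult_less_eq mult.commute intro!: Nat.gr0I elim!: dvdE intro: aux)
  also have "\<dots> = (\<Sum>d=1..x. \<Sum>m=1..x div d. F d m)"
    by (intro sum.Sigma[symmetric]) auto
  finally show ?thesis .
qed

definition chebyshev_psi :: "nat \<Rightarrow> real" where
  "chebyshev_psi x = (\<Sum>d=1..x. mangoldt d)"

lemma ln_fact_eq_sum_ln: "ln (fact x :: real) = (\<Sum>n=1..x. ln (real n))"
  by (induction x) (simp_all add: ln_mult_pos del: of_nat_Suc)

text \<open>
  Summing the identity that the values of the von Mangoldt function over the divisors of n add up
  to log n.
\<close>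

lemma ln_fact_eq_sum_mangoldt: "ln (fact x) = (\<Sum>d=1..x. mangoldt d * real (x div d))"
proof -
  have "ln (fact x :: real) = (\<Sum>n=1..x. ln (real n))"
    by (rule ln_fact_eq_sum_ln)
  also have "\<dots> = (\<Sum>n=1..x. \<Sum>d | d dvd n. mangoldt d)"
    by (intro sum.cong refl) (simp add: mangoldt_sum)
  also have "\<dots> = (\<Sum>d=1..x. \<Sum>m=1..x div d. mangoldt d)"
    by (rule sum_divisors_eq_hyperbola)
  finally show ?thesis by (simp add: mult.commute)
qed

text \<open>
  The logarithm of the central binomial coefficient, expanded by the previous identity, has
  nonnegative coefficients, and those of the d with x < d \<le> 2x equal 1.
\<close>

lemma chebyshev_psi_double: "chebyshev_psi (2 * x) - chebyshev_psi x \<le> 2 * real x * ln 2"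
proof -
  have "chebyshev_psi (2 * x) - chebyshev_psi x = (\<Sum>d\<in>{x<..2*x}. mangoldt d)"
  proof -
    have e: "{1..2*x} = {1..x} \<union> {x<..2*x}" by auto
    have "chebyshev_psi (2 * x) = chebyshev_psi x + (\<Sum>d\<in>{x<..2*x}. mangoldt d)"
      unfolding chebyshev_psi_def e by (rule sum.union_disjoint) auto
    thus ?thesis by simp
  qed
  also have "\<dots> \<le> (\<Sum>d\<in>{x<..2*x}. mangoldt d * real (2 * x div d - 2 * (x div d)))"
  proof (rule sum_mono)
    fix d assume d: "d \<in> {x<..2*x}"
    hence "x div d = 0" "2 * x div d = 1" by (auto simp: div_eq_dividend_iff intro!: div_nat_eqI)
    thus "mangoldt d \<le> mangoldt d * real (2 * x div d - 2 * (x div d))" by simp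
  qed
  also have "\<dots> \<le> (\<Sum>d=1..2*x. mangoldt d * real (2 * x div d - 2 * (x div d)))"
    by (intro sum_mono2) (auto simp: mangoldt_nonneg)
  also have "\<dots> = (\<Sum>d=1..2*x. mangoldt d * real (2 * x div d)) - 2 * (\<Sum>d=1..2*x. mangoldt d * real (x div d))"
    unfolding sum_distrib_left sum_subtractf[symmetric]
  proof (intro sum.cong refl)
    fix d :: nat
    have "2 * (x div d) \<le> 2 * x div d"
    proof (cases "d = 0")
      case False
      have "(x div d) * d \<le> x" by simp
      thus ?thesis using False by (simp add: less_eq_div_iff_mult_less_eq mult.assoc)
    qed simp
    thus "mangoldt d * real (2 * x div d - 2 * (x div d)) = mangoldt d * real (2 * x div d) - 2 * (mangoldt d * real (x div d))"
      by (simp add: of_nat_diff algebra_simps)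
  qed
  also have "(\<Sum>d=1..2*x. mangoldt d * real (x div d)) = (\<Sum>d=1..x. mangoldt d * real (x div d))"
    by (intro sum.mono_neutral_right) auto
  also have "(\<Sum>d=1..2*x. mangoldt d * real (2 * x div d)) - 2 * (\<Sum>d=1..x. mangoldt d * real (x div d)) = ln (fact (2 * x)) - 2 * ln (fact x)"
    by (simp only: ln_fact_eq_sum_mangoldt)
  also have "\<dots> = ln (real (2 * x choose x))"
  proof -
    have "fact x * fact (2 * x - x) * (2 * x choose x) = (fact (2 * x) :: nat)" by (rule binomial_fact_lemma) simp
    hence "real (fact x * fact x * (2 * x choose x)) = real (fact (2 * x))" by (simp add: mult_2)
    hence "fact x * fact x * real (2 * x choose x) = (fact (2 * x) :: real)" by simp
    hence "ln (fact (2 * x) :: real) = ln (fact x * fact x * real (2 * x choose x))" by simp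
    also have "\<dots> = 2 * ln (fact x) + ln (real (2 * x choose x))"
      by (subst ln_mult_pos; simp add: ln_mult_pos)
    finally show ?thesis by simp
  qed
  also have "\<dots> \<le> ln (2 ^ (2 * x))"
  proof (subst ln_le_cancel_iff)
    show "real (2 * x choose x) \<le> 2 ^ (2 * x)"
      using binomial_le_pow2[of "2 * x" x] by (metis of_nat_le_iff of_nat_numeral of_nat_power)
  qed auto
  also have "\<dots> = 2 * real x * ln 2" by (subst ln_realpow) auto
  finally show ?thesis .
qed

lemma chebyshev_psi_le: "chebyshev_psi x \<le> 5 * real x"
proof (induction x rule: less_induct)
  case (less x)
  consider "x = 0" | "x = 1" | "x \<ge> 2" by linarith
  thus ?case
  proof cases
    case 3
    define h where "h = (x + 1) div 2"
    have h: "h < x" "x \<le> 2 * h" "2 * h \<le> x + 1" using 3 by (auto simp: h_def)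
    have "chebyshev_psi x \<le> chebyshev_psi (2 * h)" unfolding chebyshev_psi_def
      using h by (intro sum_mono2) (auto simp: mangoldt_nonneg)
    also have "\<dots> \<le> chebyshev_psi h + 2 * real h * ln 2" using chebyshev_psi_double[of h] by simp
    also have "\<dots> \<le> 5 * real h + 2 * real h * (25/36)"
      using less.IH[OF h(1)] ln2_le_25_over_36 by (intro add_mono mult_left_mono) auto
    also have "\<dots> \<le> 5 * real x"
    proof (cases "x = 2")
      case True thus ?thesis using h by simp
    next
      case False
      hence "3 \<le> x" using 3 by simp
      thus ?thesis using h(3) by simp
    qed
    finally show ?thesis .
  qed (auto simp: chebyshev_psi_def)
qed

lemma ln_fact_bounds:
  assumes "x \<ge> 1"
  shows "ln (fact x) \<le> real x * ln (real x)" "real x * ln (real x) - real x \<le> ln (fact x)"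
proof -
  have "ln (fact x :: real) = (\<Sum>n=1..x. ln (real n))" by (rule ln_fact_eq_sum_ln)
  also have "\<dots> \<le> (\<Sum>n=1..x. ln (real x))" by (intro sum_mono) auto
  finally show "ln (fact x) \<le> real x * ln (real x)" by simp
  have s: "(\<lambda>n. real x ^ n / fact n) sums exp (real x)" 
    using exp_converges[of "real x"] by (simp add: divide_inverse mult.commute)
  have "real x ^ x / fact x \<le> exp (real x)"
    using sum_le_suminf[of "\<lambda>n. real x ^ n / fact n" "{x}"] s by (auto simp: sums_iff)
  hence "real x ^ x \<le> exp (real x) * fact x" by (simp add: field_simps)
  hence "ln (real x ^ x) \<le> ln (exp (real x) * fact x)" using assms by (subst ln_le_cancel_iff) auto
  also have "\<dots> = real x + ln (fact x)" by (subst ln_mult_pos) auto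
  finally show "real x * ln (real x) - real x \<le> ln (fact x)" using assms by (simp add: ln_realpow)
qed

lemma nat_div_gt_real_div_minus_1:
  fixes d x :: nat
  assumes "d > 0"
  shows "real x / real d - 1 < real (x div d)"
proof -
  have "x < d + (x div d) * d" using assms by (rule dividend_less_div_times)
  hence "real x < real (d + (x div d) * d)" by (simp only: of_nat_less_iff)
  thus ?thesis using assms by (simp add: field_simps)
qed

text \<open>
  Replacing the integer part of x / d by x / d in the expansion of log x! costs at most
  psi(x) = O(x).
\<close>

lemma mertens_mangoldt:
  assumes "x \<ge> 1"
  shows "\<bar>(\<Sum>d=1..x. mangoldt d / real d) - ln (real x)\<bar> \<le> 5"
proof -
  define S where "S = (\<Sum>d=1..x. mangoldt d / real d :: real)"
  have up: "ln (fact x) \<le> real x * S" 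
    unfolding ln_fact_eq_sum_mangoldt S_def sum_distrib_left
  proof (rule sum_mono)
    fix d
    have "mangoldt d * real (x div d) \<le> mangoldt d * (real x / real d)"
      by (intro mult_left_mono of_nat_div_le_of_nat) (auto simp: mangoldt_nonneg)
    thus "mangoldt d * real (x div d) \<le> real x * (mangoldt d / real d)" by (simp add: field_simps)
  qed
  have "real x * S - chebyshev_psi x \<le> ln (fact x)"
    unfolding ln_fact_eq_sum_mangoldt S_def sum_distrib_left chebyshev_psi_def sum_subtractf[symmetric]
  proof (rule sum_mono)
    fix d assume "d \<in> {1..x}"
    hence "real x / real d - 1 \<le> real (x div d)" 
      using nat_div_gt_real_div_minus_1[of d x] by simp
    hence "mangoldt d * (real x / real d - 1) \<le> mangoldt d * real (x div d)" by (intro mult_left_mono) (auto simp: mangoldt_nonneg)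
    thus "real x * (mangoldt d / real d) - mangoldt d \<le> mangoldt d * real (x div d)" by (simp add: algebra_simps)
  qed
  hence lo: "real x * S \<le> ln (fact x) + 5 * real x" using chebyshev_psi_le[of x] by linarith
  have "real x * S \<le> real x * (ln (real x) + 5)" using lo ln_fact_bounds(1)[OF assms] by (simp add: algebra_simps)
  moreover have "real x * (ln (real x) - 1) \<le> real x * S" using up ln_fact_bounds(2)[OF assms] by (simp add: algebra_simps)
  ultimately have "S \<le> ln (real x) + 5" "ln (real x) - 1 \<le> S" using assms by auto
  thus ?thesis unfolding S_def by linarith
qed


lemma sum_divisors_coprime_mult:
  fixes f :: "nat \<Rightarrow> 'a :: comm_semiring_0"
  assumes ab: "coprime a b" "a > 0" "b > 0" and f: "\<And>x y. x dvd a \<Longrightarrow> y dvd b \<Longrightarrow> f (x * y) = f x * f y"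
  shows "(\<Sum>d | d dvd a * b. f d) = (\<Sum>d | d dvd a. f d) * (\<Sum>d | d dvd b. f d)"
proof -
  have g: "gcd (x * y) a = x \<and> gcd (x * y) b = y" if xy: "x dvd a" "y dvd b" for x y
  proof -
    have c: "coprime a y" "coprime b x"
      using coprime_divisors[OF dvd_refl xy(2) ab(1)] coprime_divisors[OF xy(1) dvd_refl ab(1)] by (simp_all add: coprime_commute)
    have "gcd (x * y) a = gcd x a" by (rule gcd_mult_left_right_cancel[OF c(1)])
    moreover have "gcd (x * y) b = gcd y b" by (rule gcd_mult_left_left_cancel[OF c(2)])
    ultimately show ?thesis using xy by (simp add: gcd_nat.absorb1)
  qed
  have "(\<Sum>d | d dvd a. f d) * (\<Sum>d | d dvd b. f d) = (\<Sum>(x,y)\<in>{d. d dvd a} \<times> {d. d dvd b}. f x * f y)"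
    by (simp add: sum_product sum.cartesian_product)
  also have "\<dots> = (\<Sum>d | d dvd a * b. f d)"
  proof (rule sum.reindex_bij_witness[of _ "\<lambda>d. (gcd d a, gcd d b)" "\<lambda>(x, y). x * y"], goal_cases)
    case (1 xy) thus ?case using g by auto
  next
    case (2 xy) thus ?case by (auto intro: mult_dvd_mono)
  next
    case (3 d)
    then obtain x y where "d = x * y" "x dvd a" "y dvd b" using division_decomp[of d a b] by auto
    thus ?case using g[of x y] by simp
  next
    case (4 d) thus ?case by auto
  next
    case (5 xy) thus ?case using f by auto
  qed
  finally show ?thesis by simp
qed

lemma sum_divisors_prime_power:
  assumes "prime (p :: nat)"
  shows "(\<Sum>d | d dvd p ^ k. f d) = (\<Sum>i\<le>k. f (p ^ i))"
proof -
  have "{d. d dvd p ^ k} = (\<lambda>i. p ^ i) ` {..k}" using divides_primepow_nat[OF assms] by auto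
  moreover have "inj_on (\<lambda>i. p ^ i) {..k}" using prime_gt_1_nat[OF assms] by (auto intro!: inj_onI)
  ultimately show ?thesis by (simp add: sum.reindex)
qed

definition moebius_mu :: "nat \<Rightarrow> int" where
  "moebius_mu n = (if squarefree n then (-1) ^ card (prime_factors n) else 0)"

lemma abs_moebius_mu_le_1: "\<bar>moebius_mu n\<bar> \<le> 1"
  by (auto simp: moebius_mu_def power_abs)

text \<open>
  Splitting off the full power of one prime; this drives the arguments about multiplicative
  functions below.
\<close>

lemma prime_factor_split:
  fixes n :: nat
  assumes "n > 1"
  obtains p k m where "prime p" "k > 0" "n = p ^ k * m" "coprime (p ^ k) m" "0 < m" "m < n"
proof -
  obtain p where p: "prime p" "p dvd n" using assms prime_factor_nat[of n] by auto
  define k where "k = multiplicity p n"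
  have n0: "n \<noteq> 0" using assms by simp
  obtain m where m: "n = p ^ k * m" "\<not> p dvd m" 
  proof -
    have "\<not> is_unit p" using p(1) by auto
    show ?thesis
    proof (rule multiplicity_decompose'[OF n0 \<open>\<not> is_unit p\<close>])
      fix m assume "n = p ^ multiplicity p n * m" "\<not> p dvd m"
      thus ?thesis using that unfolding k_def by blast
    qed
  qed
  have "prime_elem p" using p(1) by simp
  hence k: "k > 0" unfolding k_def using prime_multiplicity_gt_zero_iff[of p n] p(2) n0 by simp
  have "m > 0" using m n0 by (intro Nat.gr0I) auto
  moreover have "coprime (p ^ k) m" using p m by (simp add: prime_imp_coprime)
  moreover have "1 < p ^ k" using prime_gt_1_nat[OF p(1)] k by (rule one_less_power)
  hence "m < n" using \<open>m > 0\<close> m by simp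
  ultimately show ?thesis by (intro that[OF p(1) k m(1)])
qed

lemma sum_moebius_mu: 
  assumes "n > 0"
  shows "(\<Sum>d | d dvd n. moebius_mu d) = (if n = 1 then 1 else 0)"
proof (cases "n = 1")
  case True
  thus ?thesis by (simp add: moebius_mu_def)
next
  case False
  then obtain p k m where p: "prime p" "k > 0" "n = p ^ k * m" "coprime (p ^ k) m" "0 < m"
  proof -
    have "n > 1" using assms False by simp
    thus ?thesis by (rule prime_factor_split) (rule that)
  qed
  have mult: "moebius_mu (x * y) = moebius_mu x * moebius_mu y" if "coprime x y" "x \<noteq> 0" "y \<noteq> 0" for x y
  proof -
    have sq: "squarefree (x * y) \<longleftrightarrow> squarefree x \<and> squarefree y" using that by (metis squarefree_mult_coprime squarefree_multD)
    have "prime_factors (x * y) = prime_factors x \<union> prime_factors y" using that by (simp add: prime_factors_product)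
    moreover have "prime_factors x \<inter> prime_factors y = {}"
    proof (rule equals0I)
      fix p assume "p \<in> prime_factors x \<inter> prime_factors y"
      hence "p dvd x" "p dvd y" "prime p" by auto
      thus False using coprime_common_divisor[OF that(1)] not_prime_unit by blast
    qed
    ultimately have "card (prime_factors (x * y)) = card (prime_factors x) + card (prime_factors y)"
      by (simp add: card_Un_disjoint)
    thus ?thesis by (auto simp: moebius_mu_def sq power_add)
  qed
  have "(\<Sum>d | d dvd n. moebius_mu d) = (\<Sum>d | d dvd p ^ k. moebius_mu d) * (\<Sum>d | d dvd m. moebius_mu d)"
    unfolding p(3)
  proof (rule sum_divisors_coprime_mult)
    fix x y assume xy: "x dvd p ^ k" "y dvd m"
    show "moebius_mu (x * y) = moebius_mu x * moebius_mu y"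
    proof (intro mult coprime_divisors[OF xy p(4)])
      have "p ^ k \<noteq> 0" using prime_gt_0_nat[OF p(1)] by simp
      thus "x \<noteq> 0" using xy(1) by (intro notI) simp
      show "y \<noteq> 0" using xy(2) p(5) by auto
    qed
  qed (use p prime_gt_0_nat in auto)
  also have "(\<Sum>d | d dvd p ^ k. moebius_mu d) = (\<Sum>i\<le>k. moebius_mu (p ^ i))" by (rule sum_divisors_prime_power[OF p(1)])
  also have "\<dots> = (\<Sum>i\<in>{0,1}. moebius_mu (p ^ i))"
  proof (rule sum.mono_neutral_right)
    show "\<forall>i\<in>{..k} - {0, 1}. moebius_mu (p ^ i) = 0"
    proof
      fix i assume "i \<in> {..k} - {0, 1}"
      hence "p ^ 2 dvd p ^ i" by (intro le_imp_power_dvd) auto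
      hence "\<not> squarefree (p ^ i)" using p(1) unfolding squarefree_def by (metis not_prime_unit)
      thus "moebius_mu (p ^ i) = 0" by (simp add: moebius_mu_def)
    qed
  qed (use p in auto)
  also have "\<dots> = 0" using p(1) by (simp add: moebius_mu_def squarefree_prime prime_prime_factors)
  finally show ?thesis using False by simp
qed

section \<open>Nonprincipal characters\<close>

text \<open>
  Only the properties of a nonprincipal Dirichlet character modulo q that matter for partial
  summation: complete multiplicativity, periodicity, values of modulus at most 1, and a vanishing
  sum over a period.
\<close>

locale nonprincipal_character =
  fixes q :: nat and \<chi> :: "nat \<Rightarrow> complex"
  assumes q_pos: "q > 0" and chi_1: "\<chi> 1 = 1" and chi_mult: "\<chi> (m * n) = \<chi> m * \<chi> n"
    and chi_periodic: "\<chi> (n + q) = \<chi> n" and norm_chi_le: "norm (\<chi> n) \<le> 1"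
    and sum_chi_period: "(\<Sum>n<q. \<chi> n) = 0"
begin

lemma sum_chi_initial_bound: "norm (\<Sum>n<x. \<chi> n) \<le> real q"
proof (induction x rule: less_induct)
  case (less x)
  show ?case
  proof (cases "x < q")
    case True
    have "norm (\<Sum>n<x. \<chi> n) \<le> (\<Sum>n<x. 1)" by (rule sum_norm_le) (use norm_chi_le in auto)
    also have "\<dots> \<le> real q" using True by simp
    finally show ?thesis .
  next
    case False
    have "(\<Sum>n<x. \<chi> n) = (\<Sum>n<q. \<chi> n) + (\<Sum>n=q..<x. \<chi> n)"
      using False by (subst sum.union_disjoint[symmetric]) (auto intro!: sum.cong)
    also have "(\<Sum>n=q..<x. \<chi> n) = (\<Sum>n<x-q. \<chi> n)"
    proof (rule sum.reindex_bij_witness[of _ "\<lambda>n. n + q" "\<lambda>n. n - q"], goal_cases)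
      case (5 n) thus ?case using chi_periodic[of "n - q"] by simp
    qed (use False in auto)
    finally show ?thesis using less.IH[of "x - q"] q_pos False by (simp add: sum_chi_period)
  qed
qed

lemma sum_chi_interval_bound: "norm (\<Sum>n=m..<x. \<chi> n) \<le> 2 * real q"
proof (cases "m \<le> x")
  case True
  have "(\<Sum>n<x. \<chi> n) = (\<Sum>n<m. \<chi> n) + (\<Sum>n=m..<x. \<chi> n)"
    using True by (subst sum.union_disjoint[symmetric]) (auto intro!: sum.cong)
  hence "(\<Sum>n=m..<x. \<chi> n) = (\<Sum>n<x. \<chi> n) - (\<Sum>n<m. \<chi> n)" by simp
  also have "norm \<dots> \<le> norm (\<Sum>n<x. \<chi> n) + norm (\<Sum>n<m. \<chi> n)" by (rule norm_triangle_ineq4)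
  also have "\<dots> \<le> 2 * real q" using sum_chi_initial_bound[of x] sum_chi_initial_bound[of m] by linarith
  finally show ?thesis .
qed simp

text \<open>
  Summation by parts: the partial sums of the character are bounded and f is monotone, so the
  differences of f telescope.
\<close>

lemma abel_summation_bound:
  fixes f :: "nat \<Rightarrow> real"
  assumes f: "\<And>n. n \<ge> m \<Longrightarrow> f (Suc n) \<le> f n" "\<And>n. n \<ge> m \<Longrightarrow> f n \<ge> 0"
  shows "norm (\<Sum>n=m..<x. \<chi> n * of_real (f n)) \<le> 2 * real q * f m"
proof (cases "m \<le> x")
  case True
  define S where "S = (\<lambda>y. \<Sum>n=m..<y. \<chi> n)"
  have "(\<Sum>n=m..<x. \<chi> n * of_real (f n)) = S x * of_real (f x) + (\<Sum>n=m..<x. S (Suc n) * of_real (f n - f (Suc n)))"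
    using True
  proof (induction x rule: dec_induct)
    case base thus ?case by (simp add: S_def)
  next
    case (step x)
    have "S (Suc x) = S x + \<chi> x" using step.hyps by (simp add: S_def)
    thus ?case using step by (simp add: algebra_simps)
  qed
  also have "norm \<dots> \<le> 2 * real q * f x + (\<Sum>n=m..<x. 2 * real q * (f n - f (Suc n)))"
  proof (rule norm_triangle_mono)
    show "norm (S x * of_real (f x)) \<le> 2 * real q * f x"
      using f(2)[OF True] sum_chi_interval_bound[of m x] unfolding S_def norm_mult norm_of_real by (intro mult_mono) auto
    show "norm (\<Sum>n=m..<x. S (Suc n) * of_real (f n - f (Suc n))) \<le> (\<Sum>n=m..<x. 2 * real q * (f n - f (Suc n)))"
    proof (rule sum_norm_le)
      fix n assume "n \<in> {m..<x}"
      hence "f n - f (Suc n) \<ge> 0" using f(1)[of n] by simp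
      thus "norm (S (Suc n) * of_real (f n - f (Suc n))) \<le> 2 * real q * (f n - f (Suc n))"
        using sum_chi_interval_bound[of m "Suc n"] unfolding S_def norm_mult norm_of_real by (intro mult_mono) auto
    qed
  qed
  also have "(\<Sum>n=m..<x. 2 * real q * (f n - f (Suc n))) = 2 * real q * (f m - f x)"
    using True sum_Suc_diff'[of m x "\<lambda>n. - f n"] by (simp add: sum_distrib_left[symmetric])
  finally show ?thesis by (simp add: algebra_simps)
next
  case False thus ?thesis using f(2)[of m] by simp
qed

text \<open>
  The partial sums of the series for L(1, chi), and its value.
\<close>

definition W :: "nat \<Rightarrow> complex" where "W y = (\<Sum>m=1..y. \<chi> m / of_nat m)"

definition L where "L = lim W"

lemma W_diff_bound:
  assumes "y \<le> y'"
  shows "norm (W y' - W y) \<le> 2 * real q / real (y + 1)"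
proof -
  have "W y' - W y = (\<Sum>m=Suc y..<Suc y'. \<chi> m * of_real (1 / real m))"
  proof -
    have "{1..y'} = {1..y} \<union> {Suc y..<Suc y'}" using assms by auto
    hence "W y' = W y + (\<Sum>m=Suc y..<Suc y'. \<chi> m / of_nat m)" unfolding W_def by (simp only:) (rule sum.union_disjoint, auto)
    thus ?thesis by (simp add: divide_inverse)
  qed
  also have "norm \<dots> \<le> 2 * real q * (1 / real (Suc y))"
    by (rule abel_summation_bound) (auto simp: field_simps)
  finally show ?thesis by simp
qed

lemma W_convergent: "W \<longlonglongrightarrow> L"
proof -
  have "Cauchy W"
  proof (rule CauchyI')
    fix e :: real assume e: "e > 0"
    obtain M :: nat where M: "2 * real q / e < real M" using reals_Archimedean2 by blast
    show "\<exists>M. \<forall>m\<ge>M. \<forall>n>m. dist (W m) (W n) < e"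
    proof (intro exI allI impI)
      fix m n assume mn: "M \<le> m" "m < n"
      have "norm (W m - W n) \<le> 2 * real q / real (m + 1)"
        using W_diff_bound[of m n] mn by (simp add: norm_minus_commute)
      also have "2 * real q < e * real (m + 1)" 
      proof -
        have "2 * real q < e * real M" using M e by (simp add: field_simps)
        also have "\<dots> \<le> e * real (m + 1)" using mn e by (intro mult_left_mono) auto
        finally show ?thesis .
      qed
      hence "2 * real q / real (m + 1) < e" by (simp add: field_simps)
      finally show "dist (W m) (W n) < e" unfolding dist_norm .
    qed
  qed
  thus ?thesis unfolding L_def using Cauchy_convergent_iff convergent_LIMSEQ_iff by blast
qed

lemma W_L_bound: "norm (W y - L) \<le> 2 * real q / real (y + 1)"
proof -
  have "(\<lambda>y'. norm (W y' - W y)) \<longlonglongrightarrow> norm (L - W y)" by (intro tendsto_intros W_convergent)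
  moreover have "eventually (\<lambda>y'. norm (W y' - W y) \<le> 2 * real q / real (y + 1)) sequentially"
    using eventually_ge_at_top[of y] by eventually_elim (rule W_diff_bound)
  ultimately have "norm (L - W y) \<le> 2 * real q / real (y + 1)" by (rule tendsto_upperbound) auto
  thus ?thesis by (simp add: norm_minus_commute)
qed

text \<open>
  log n / n decreases from n = 3 on; the terms before that are estimated trivially.
\<close>

lemma sum_chi_ln_bound: "norm (\<Sum>n=1..x. \<chi> n * of_real (ln (real n) / real n)) \<le> 1 + 2 * real q"
proof -
  define f where "f = (\<lambda>n. ln (real n) / real n)"
  have ln3: "ln (real n) \<ge> 1" if "n \<ge> 3" for n
  proof -
    have "exp 1 \<le> real n" using exp_le that by linarith
    hence "ln (exp 1) \<le> ln (real n)" by (intro ln_mono) (auto intro: exp_gt_zero)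
    thus ?thesis by simp
  qed
  have dec: "f (Suc n) \<le> f n" if n: "n \<ge> 3" for n
  proof -
    have "ln (1 + 1 / real n) \<le> 1 / real n" by (rule ln_add_one_self_le_self) auto
    moreover have "real (Suc n) = real n * (1 + 1 / real n)" using n by (simp add: field_simps)
    hence "ln (real (Suc n)) = ln (real n) + ln (1 + 1 / real n)"
      using n by (simp only:) (rule ln_mult_pos, auto intro: add_pos_nonneg)
    ultimately have "ln (real (Suc n)) \<le> ln (real n) + 1 / real n" by simp
    hence "real n * ln (real (Suc n)) \<le> real n * (ln (real n) + 1 / real n)" by (intro mult_left_mono) auto
    also have "\<dots> = real n * ln (real n) + 1" using n by (simp add: algebra_simps)
    also have "\<dots> \<le> (real n + 1) * ln (real n)" using ln3[OF n] by (simp add: algebra_simps)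
    finally show ?thesis unfolding f_def using n by (simp add: field_simps)
  qed
  have f0: "f n \<ge> 0" for n by (cases "n = 0") (auto simp: f_def)
  have f1: "f n \<le> 1" for n
    by (cases "n = 0") (auto simp: f_def field_simps intro: order.trans[OF ln_le_minus_one])
  show ?thesis
  proof (cases "x \<ge> 2")
    case True
    have "{1..x} = {1} \<union> ({2} \<union> {3..<Suc x})" using True by auto
    hence "(\<Sum>n=1..x. \<chi> n * of_real (f n)) = (\<Sum>n\<in>{1} \<union> ({2} \<union> {3..<Suc x}). \<chi> n * of_real (f n))" by simp
    also have "\<dots> = (\<Sum>n\<in>{2} \<union> {3..<Suc x}. \<chi> n * of_real (f n))"
      by (subst sum.union_disjoint) (auto simp: f_def)
    also have "\<dots> = \<chi> 2 * of_real (f 2) + (\<Sum>n=3..<Suc x. \<chi> n * of_real (f n))" 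
      by (subst sum.union_disjoint) auto
    also have "norm \<dots> \<le> 1 + 2 * real q * f 3"
    proof (rule norm_triangle_mono)
      have "norm (\<chi> 2 * of_real (f 2)) \<le> 1 * 1" unfolding norm_mult 
        using norm_chi_le[of 2] f0[of 2] f1[of 2] by (intro mult_mono) auto
      thus "norm (\<chi> 2 * of_real (f 2)) \<le> 1" by simp
      show "norm (\<Sum>n=3..<Suc x. \<chi> n * of_real (f n)) \<le> 2 * real q * f 3"
        by (intro abel_summation_bound dec f0)
    qed
    also have "\<dots> \<le> 1 + 2 * real q * 1" using f1[of 3] by (intro add_left_mono mult_left_mono) auto
    finally show ?thesis by (simp add: f_def)
  next
    case False
    hence "{1..x} \<subseteq> {1}" by auto
    hence "(\<Sum>n=1..x. \<chi> n * of_real (ln (real n) / real n)) = 0" by (intro sum.neutral) auto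
    thus ?thesis by simp
  qed
qed

definition S :: "nat \<Rightarrow> complex" where "S x = (\<Sum>d=1..x. \<chi> d * of_real (mangoldt d / real d))"

lemma sum_chi_ln_eq:
  "(\<Sum>n=1..x. \<chi> n * of_real (ln (real n) / real n)) = (\<Sum>d=1..x. \<Sum>m=1..x div d. \<chi> d * \<chi> m * of_real (mangoldt d / (real d * real m)))"
proof -
  have "(\<Sum>n=1..x. \<chi> n * of_real (ln (real n) / real n)) = (\<Sum>n=1..x. \<Sum>d | d dvd n. \<chi> d * \<chi> (n div d) * of_real (mangoldt d / (real d * real (n div d))))"
  proof (intro sum.cong refl)
    fix n assume n: "n \<in> {1..x}"
    have "ln (real n) = (\<Sum>d | d dvd n. mangoldt d)" using n by (simp add: mangoldt_sum)
    hence "\<chi> n * of_real (ln (real n) / real n) = (\<Sum>d | d dvd n. \<chi> n * of_real (mangoldt d / real n))"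
      by (simp add: sum_divide_distrib sum_distrib_left)
    also have "\<dots> = (\<Sum>d | d dvd n. \<chi> d * \<chi> (n div d) * of_real (mangoldt d / (real d * real (n div d))))"
    proof (intro sum.cong refl)
      fix d assume "d \<in> {d. d dvd n}"
      hence d: "d * (n div d) = n" by simp
      hence "real d * real (n div d) = real n" by (metis of_nat_mult)
      moreover have "\<chi> d * \<chi> (n div d) = \<chi> n" by (subst chi_mult[symmetric]) (simp only: d)
      ultimately show "\<chi> n * of_real (mangoldt d / real n) = \<chi> d * \<chi> (n div d) * of_real (mangoldt d / (real d * real (n div d)))" by simp
    qed
    finally show "\<chi> n * of_real (ln (real n) / real n) = (\<Sum>d | d dvd n. \<chi> d * \<chi> (n div d) * of_real (mangoldt d / (real d * real (n div d))))" .
  qed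
  also have "\<dots> = (\<Sum>d=1..x. \<Sum>m=1..x div d. \<chi> d * \<chi> m * of_real (mangoldt d / (real d * real m)))"
    by (rule sum_divisors_eq_hyperbola)
  finally show ?thesis .
qed

lemma inv_div_bound:
  assumes "d \<ge> 1" "x \<ge> 1"
  shows "2 * real q / real (x div d + 1) \<le> 2 * real q * (real d / real x)"
proof -
  have "real x / real d \<le> real (x div d + 1)" using nat_div_gt_real_div_minus_1[of d x] assms by simp
  hence "2 * real q / real (x div d + 1) \<le> 2 * real q / (real x / real d)"
    using assms by (intro divide_left_mono) auto
  thus ?thesis by simp
qed

text \<open>
  Grouping the sum of chi(n) log n / n according to log = Lambda * 1 gives the sum over d of
  chi(d) Lambda(d) / d times a partial sum of L(1, chi) of length x / d. Replacing the latter by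
  its limit costs O(d / x) each, hence O(psi(x) / x) = O(1) in total.
\<close>

lemma L_times_S_bounded:
  assumes x: "x \<ge> 1"
  shows "norm (L * S x) \<le> 1 + 12 * real q"
proof -
  define T where "T = (\<Sum>n=1..x. \<chi> n * of_real (ln (real n) / real n))"
  have "T = (\<Sum>d=1..x. \<chi> d * of_real (mangoldt d / real d) * W (x div d))"
    unfolding T_def sum_chi_ln_eq W_def sum_distrib_left by (intro sum.cong refl) (simp add: field_simps)
  hence "T - L * S x = (\<Sum>d=1..x. \<chi> d * of_real (mangoldt d / real d) * (W (x div d) - L))"
    unfolding S_def sum_distrib_left by (simp only: right_diff_distrib sum_subtractf mult_ac)
  also have "norm \<dots> \<le> (\<Sum>d=1..x. mangoldt d * (2 * real q / real x))"
  proof (rule sum_norm_le)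
    fix d assume d: "d \<in> {1..x}"
    have "norm (\<chi> d * of_real (mangoldt d / real d) * (W (x div d) - L)) \<le> 1 * (mangoldt d / real d) * (2 * real q * (real d / real x))"
      unfolding norm_mult
    proof (intro mult_mono norm_chi_le)
      show "norm (W (x div d) - L) \<le> 2 * real q * (real d / real x)"
        using W_L_bound[of "x div d"] inv_div_bound[of d x] d by (auto intro: order.trans)
    qed (auto simp: mangoldt_nonneg norm_divide)
    also have "\<dots> = mangoldt d * (2 * real q / real x)" using d by simp
    finally show "norm (\<chi> d * of_real (mangoldt d / real d) * (W (x div d) - L)) \<le> mangoldt d * (2 * real q / real x)" .
  qed
  also have "\<dots> = chebyshev_psi x * (2 * real q / real x)" unfolding chebyshev_psi_def by (rule sum_distrib_right[symmetric])
  also have "\<dots> \<le> (5 * real x) * (2 * real q / real x)" by (intro mult_right_mono chebyshev_psi_le) auto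
  also have "\<dots> = 10 * real q" using x by simp
  finally have "norm (T - L * S x) \<le> 10 * real q" .
  moreover have "norm T \<le> 1 + 2 * real q" unfolding T_def by (rule sum_chi_ln_bound)
  moreover have "norm (L * S x) \<le> norm T + norm (T - L * S x)"
    using norm_triangle_ineq4[of T "T - L * S x"] by simp
  ultimately show ?thesis by linarith
qed

text \<open>
  Moebius inversion of the identity
  sum over m of chi(m) / m * (log (x / m) + S(x / m)) = log x * W(x), where S is the sum of
  chi(d) Lambda(d) / d. If L(1, chi) = 0, then W(x / d) = O(d / x), and the sum of
  log (x / d) over d \<le> x is O(x).
\<close>

lemma ln_plus_S_bounded:
  assumes L0: "L = 0" and x: "x \<ge> 1"
  shows "norm (of_real (ln (real x)) + S x) \<le> 2 * real q"
proof -
  define F where "F = (\<lambda>n. of_real (ln (real x / real n)) + S (x div n))"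
  define G where "G = (\<lambda>d m. of_int (moebius_mu d) * (\<chi> d * \<chi> m / (of_nat d * of_nat m) * F (d * m)))"
  have "of_real (ln (real x)) + S x = (\<Sum>n\<in>{1}. \<chi> n / of_nat n * F n)"
    using chi_1 by (simp add: F_def)
  also have "\<dots> = (\<Sum>n=1..x. (if n = 1 then 1 else 0) * (\<chi> n / of_nat n * F n))"
    using x by (intro sum.mono_neutral_cong_left) auto
  also have "\<dots> = (\<Sum>n=1..x. \<Sum>d | d dvd n. G d (n div d))"
  proof (intro sum.cong refl)
    fix n assume n: "n \<in> {1..x}"
    have "(if n = 1 then 1 else 0 :: complex) = of_int (\<Sum>d | d dvd n. moebius_mu d)" using n by (subst sum_moebius_mu) auto
    hence "(if n = 1 then 1 else 0) * (\<chi> n / of_nat n * F n) = (\<Sum>d | d dvd n. of_int (moebius_mu d) * (\<chi> n / of_nat n * F n))"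
      by (simp only: sum_distrib_right of_int_sum)
    also have "\<dots> = (\<Sum>d | d dvd n. G d (n div d))"
    proof (intro sum.cong refl)
      fix d assume "d \<in> {d. d dvd n}"
      hence d: "d * (n div d) = n" by simp
      hence "of_nat d * of_nat (n div d) = (of_nat n :: complex)" by (metis of_nat_mult)
      moreover have "\<chi> d * \<chi> (n div d) = \<chi> n" by (subst chi_mult[symmetric]) (simp only: d)
      ultimately show "of_int (moebius_mu d) * (\<chi> n / of_nat n * F n) = G d (n div d)" unfolding G_def by (simp only: d)
    qed
    finally show "(if n = 1 then 1 else 0) * (\<chi> n / of_nat n * F n) = (\<Sum>d | d dvd n. G d (n div d))" .
  qed
  also have "\<dots> = (\<Sum>d=1..x. \<Sum>m=1..x div d. G d m)" by (rule sum_divisors_eq_hyperbola)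
  also have "\<dots> = (\<Sum>d=1..x. of_int (moebius_mu d) * (\<chi> d / of_nat d) * (of_real (ln (real x / real d)) * W (x div d)))"
  proof (intro sum.cong refl)
    fix d assume d: "d \<in> {1..x}"
    define y where "y = x div d"
    have split_F: "F (d * m) = (of_real (ln (real x / real d)) - of_real (ln (real m))) + S (y div m)" if "m \<in> {1..y}" for m
    proof -
      have "ln (real x / real (d * m)) = ln (real x / real d) - ln (real m)"
        using that d x by (simp add: ln_div ln_mult)
      thus ?thesis unfolding F_def y_def by (simp add: div_mult2_eq)
    qed
    have inner: "(\<Sum>m=1..y. \<chi> m / of_nat m * S (y div m)) = (\<Sum>m=1..y. \<chi> m / of_nat m * of_real (ln (real m)))"
    proof -
      have "(\<Sum>m=1..y. \<chi> m / of_nat m * S (y div m)) = (\<Sum>m=1..y. \<Sum>e=1..y div m. \<chi> m * \<chi> e * of_real (mangoldt e / (real m * real e)))"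
        unfolding S_def sum_distrib_left by (intro sum.cong refl) (simp add: field_simps)
      also have "\<dots> = (\<Sum>n=1..y. \<Sum>m | m dvd n. \<chi> m * \<chi> (n div m) * of_real (mangoldt (n div m) / (real m * real (n div m))))"
        by (rule sum_divisors_eq_hyperbola[symmetric])
      also have "\<dots> = (\<Sum>n=1..y. \<Sum>e | e dvd n. \<chi> e * \<chi> (n div e) * of_real (mangoldt e / (real e * real (n div e))))"
      proof (rule sum.cong[OF refl])
        fix n assume "n \<in> {1..y}"
        thus "(\<Sum>m | m dvd n. \<chi> m * \<chi> (n div m) * of_real (mangoldt (n div m) / (real m * real (n div m)))) 
            = (\<Sum>e | e dvd n. \<chi> e * \<chi> (n div e) * of_real (mangoldt e / (real e * real (n div e))))"
          by (intro sum.reindex_bij_witness[of _ "\<lambda>e. n div e" "\<lambda>e. n div e"]) (auto simp: mult_ac elim!: dvdE)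
      qed
      also have "\<dots> = (\<Sum>m=1..y. \<chi> m * of_real (ln (real m) / real m))"
        unfolding sum_chi_ln_eq by (rule sum_divisors_eq_hyperbola)
      finally show ?thesis by simp
    qed
    have "(\<Sum>m=1..y. G d m) = of_int (moebius_mu d) * (\<chi> d / of_nat d) * (\<Sum>m=1..y. \<chi> m / of_nat m * F (d * m))"
      unfolding G_def sum_distrib_left by (intro sum.cong refl) simp
    also have "(\<Sum>m=1..y. \<chi> m / of_nat m * F (d * m)) = (\<Sum>m=1..y. of_real (ln (real x / real d)) * (\<chi> m / of_nat m) - \<chi> m / of_nat m * of_real (ln (real m)) + \<chi> m / of_nat m * S (y div m))"
      by (intro sum.cong refl) (simp only: split_F, simp add: algebra_simps)
    also have "\<dots> = of_real (ln (real x / real d)) * W y"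
      unfolding sum.distrib sum_subtractf inner by (simp add: W_def sum_distrib_left)
    finally show "(\<Sum>m=1..x div d. G d m) = of_int (moebius_mu d) * (\<chi> d / of_nat d) * (of_real (ln (real x / real d)) * W (x div d))"
      by (simp add: y_def)
  qed
  also have "norm \<dots> \<le> (\<Sum>d=1..x. (ln (real x) - ln (real d)) * (2 * real q / real x))"
  proof (rule sum_norm_le)
    fix d assume d: "d \<in> {1..x}"
    have lnd: "ln (real x / real d) = ln (real x) - ln (real d)" "ln (real x / real d) \<ge> 0" using d x by (auto simp: ln_div)
    have mu: "norm (of_int (moebius_mu d) :: complex) \<le> 1" using abs_moebius_mu_le_1[of d] by (simp add: norm_of_int)
    have "norm (of_int (moebius_mu d) * (\<chi> d / of_nat d) * (of_real (ln (real x / real d)) * W (x div d)))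
       \<le> 1 * (1 / real d) * (ln (real x / real d) * (2 * real q * (real d / real x)))"
      unfolding norm_mult
    proof (intro mult_mono mu)
      show "norm (\<chi> d / of_nat d) \<le> 1 / real d" using norm_chi_le[of d] by (simp add: norm_divide divide_right_mono)
      show "norm (W (x div d)) \<le> 2 * real q * (real d / real x)"
        using W_L_bound[of "x div d"] inv_div_bound[of d x] d by (auto simp: L0 intro: order.trans)
      show "norm (complex_of_real (ln (real x / real d))) \<le> ln (real x / real d)" using lnd(2) unfolding norm_of_real by linarith
    qed (use lnd(2) in auto)
    also have "\<dots> = (ln (real x) - ln (real d)) * (2 * real q / real x)" using d by (simp add: lnd)
    finally show "norm (of_int (moebius_mu d) * (\<chi> d / of_nat d) * (of_real (ln (real x / real d)) * W (x div d))) \<le> (ln (real x) - ln (real d)) * (2 * real q / real x)" .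
  qed
  also have "\<dots> = (real x * ln (real x) - ln (fact x)) * (2 * real q / real x)"
    unfolding ln_fact_eq_sum_ln sum_distrib_right[symmetric] by (simp add: sum_subtractf)
  also have "\<dots> \<le> real x * (2 * real q / real x)"
    using ln_fact_bounds(2)[OF x] by (intro mult_right_mono) auto
  also have "\<dots> = 2 * real q" using x by simp
  finally show ?thesis .
qed

end

section \<open>Nonvanishing of L(1, chi) for real characters\<close>

definition inv_sqrt_error :: "nat \<Rightarrow> real" where
  "inv_sqrt_error y = (\<Sum>m=1..y. 1 / sqrt (real m)) - 2 * sqrt (real y)"

text \<open>
  The error decreases in steps of size at most 1 / sqrt y - 1 / sqrt (y + 1), so that its value
  at the fixed large argument x can serve as the constant in an asymptotic expansion for all
  smaller arguments.
\<close>

lemma inv_sqrt_error_diff: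
  assumes "1 \<le> y" "y \<le> x"
  shows "inv_sqrt_error x \<le> inv_sqrt_error y"
    "inv_sqrt_error y - inv_sqrt_error x \<le> 1 / sqrt (real y) - 1 / sqrt (real x)"
proof -
  have "inv_sqrt_error x \<le> inv_sqrt_error y \<and> inv_sqrt_error y - inv_sqrt_error x \<le> 1 / sqrt (real y) - 1 / sqrt (real x)"
    using assms(2)
  proof (induction x rule: dec_induct)
    case (step x)
    define a b where "a = sqrt (real x)" and "b = sqrt (real (Suc x))"
    have a: "0 < a" "a < b" using step.hyps assms(1) by (auto simp: a_def b_def)
    have "(b - a) * (a + b) = b ^ 2 - a ^ 2" by (simp add: power2_eq_square algebra_simps)
    also have "\<dots> = 1" by (simp add: a_def b_def)
    finally have ab: "b - a = 1 / (a + b)" using a by (simp add: field_simps)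
    have u: "inv_sqrt_error (Suc x) - inv_sqrt_error x = 1 / b - 2 * (b - a)"
      by (simp add: inv_sqrt_error_def a_def b_def)
    have d: "1 / b - 2 * (b - a) = (a - b) / (b * (a + b))" unfolding ab using a by (simp add: field_simps)
    have "(a - b) / (b * (a + b)) \<le> 0" using a by (intro divide_nonpos_pos) auto
    moreover have "(b - a) / (b * (a + b)) \<le> (b - a) / (b * a)" using a by (intro divide_left_mono mult_left_mono) auto
    moreover have "(b - a) / (b * a) = 1 / a - 1 / b" using a by (simp add: field_simps)
    moreover have "- ((a - b) / (b * (a + b))) = (b - a) / (b * (a + b))" by (simp add: minus_divide_left)
    ultimately show ?case using u d step.IH unfolding a_def b_def by linarith
  qed simp
  thus "inv_sqrt_error x \<le> inv_sqrt_error y"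
    "inv_sqrt_error y - inv_sqrt_error x \<le> 1 / sqrt (real y) - 1 / sqrt (real x)" by auto
qed

lemma inv_sqrt_error_bounds:
  assumes "1 \<le> x"
  shows "- 2 \<le> inv_sqrt_error x" "inv_sqrt_error x \<le> -1"
proof -
  have 1: "inv_sqrt_error 1 = -1" by (simp add: inv_sqrt_error_def)
  have "0 \<le> 1 / sqrt (real x)" by simp
  thus "- 2 \<le> inv_sqrt_error x" "inv_sqrt_error x \<le> -1" using inv_sqrt_error_diff[OF le_refl assms, unfolded 1, simplified] by linarith+
qed

lemma sum_inv_sqrt_le: "(\<Sum>m=1..y. 1 / sqrt (real m)) \<le> 2 * sqrt (real y)"
proof (cases "y \<ge> 1")
  case True
  thus ?thesis using inv_sqrt_error_bounds(2)[of y] by (simp add: inv_sqrt_error_def)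
qed simp

lemma sum_inv_sqrt_approx:
  fixes s d x :: nat
  assumes "1 \<le> d" "d \<le> s" and x: "x = s ^ 2"
  shows "\<bar>(\<Sum>m=1..x div d. 1 / sqrt (real m)) - (2 * sqrt (real x / real d) + inv_sqrt_error x)\<bar> \<le> 3 / sqrt (real s)"
proof -
  define y where "y = x div d"
  have sy: "s \<le> y" unfolding y_def x using assms by (simp add: less_eq_div_iff_mult_less_eq power2_eq_square)
  have s1: "1 \<le> s" using assms by simp
  have yx: "y \<le> x" by (simp add: y_def)
  have y1: "1 \<le> y" using s1 sy by simp
  have e: "0 \<le> inv_sqrt_error y - inv_sqrt_error x" "inv_sqrt_error y - inv_sqrt_error x \<le> 1 / sqrt (real y)"
    using inv_sqrt_error_diff[OF y1 yx] by (auto intro: order.trans)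
  have le: "real y \<le> real x / real d" unfolding y_def by (rule of_nat_div_le_of_nat)
  have lt: "real x / real d - 1 < real y" unfolding y_def using assms by (intro nat_div_gt_real_div_minus_1) auto
  have b: "0 \<le> sqrt (real x / real d) - sqrt (real y)" using le by simp
  have c: "sqrt (real x / real d) - sqrt (real y) \<le> 1 / sqrt (real y)"
  proof -
    define p r where "p = sqrt (real x / real d)" and "r = sqrt (real y)"
    have r: "r > 0" "r \<le> p" using y1 le by (auto simp: p_def r_def)
    have "(p - r) * r \<le> (p - r) * (p + r)" using r by (intro mult_left_mono) auto
    also have "\<dots> = p ^ 2 - r ^ 2" by (simp add: power2_eq_square algebra_simps)
    also have "\<dots> = real x / real d - real y" by (simp add: p_def r_def)
    also have "\<dots> \<le> 1" using lt by simp
    finally show ?thesis unfolding p_def[symmetric] r_def[symmetric] using r by (simp add: field_simps)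
  qed
  have "(\<Sum>m=1..y. 1 / sqrt (real m)) = inv_sqrt_error y + 2 * sqrt (real y)" by (simp add: inv_sqrt_error_def)
  moreover have "1 / sqrt (real y) \<le> 1 / sqrt (real s)" using sy s1 by (intro divide_left_mono) auto
  moreover have "3 / sqrt (real s) = 3 * (1 / sqrt (real s))" by simp
  ultimately show ?thesis unfolding y_def[symmetric] using e b c by linarith
qed

context nonprincipal_character
begin

text \<open>
  The classical argument with r(n), the sum of chi(d) over the divisors d of n. It is
  nonnegative and at least 1 on squares, hence the sum of r(n) / sqrt n up to s^2 is at least log s.
  Evaluating the same sum by the hyperbola method, with both variables cut at s, shows that it
  is 2 s L(1, chi) + O(1). So L(1, chi) cannot vanish.
\<close>

lemma real_character_nonvanishing:
  assumes real: "\<And>n. \<chi> n \<in> {-1, 0, 1}"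
  shows "L \<noteq> 0"
proof
  assume L0: "L = 0"
  define c where "c = (\<lambda>n. Re (\<chi> n))"
  have cval: "c n \<in> {-1, 0, 1}" for n using real[of n] by (auto simp: c_def)
  have cof: "\<chi> n = of_real (c n)" for n using real[of n] by (auto simp: c_def)
  have cmult: "c (m * n) = c m * c n" for m n unfolding c_def chi_mult using real[of m] real[of n] by auto
  have c1: "c 1 = 1" using chi_1 by (simp add: c_def)
  have cpow: "c (p ^ i) = c p ^ i" for p i using c1 by (induction i) (simp_all add: cmult)
  have abel: "\<bar>\<Sum>n=m..<x. c n * f n\<bar> \<le> 2 * real q * f m" 
    if "\<And>n. n \<ge> m \<Longrightarrow> f (Suc n) \<le> f n" "\<And>n. n \<ge> m \<Longrightarrow> f n \<ge> 0" for f :: "nat \<Rightarrow> real" and m x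
  proof -
    have "norm (\<Sum>n=m..<x. \<chi> n * of_real (f n)) \<le> 2 * real q * f m" using that by (rule abel_summation_bound)
    also have "(\<Sum>n=m..<x. \<chi> n * of_real (f n)) = of_real (\<Sum>n=m..<x. c n * f n)" by (simp add: cof)
    finally show ?thesis by (simp only: norm_of_real)
  qed
  define r where "r = (\<lambda>n. \<Sum>d | d dvd n. c d)"
  have r_mult: "r (a * b) = r a * r b" if "coprime a b" "a > 0" "b > 0" for a b
    unfolding r_def using that by (rule sum_divisors_coprime_mult) (rule cmult)
  have r_pp: "r (p ^ k) = (\<Sum>i\<le>k. c p ^ i)" if "prime p" for p k
    unfolding r_def sum_divisors_prime_power[OF that] by (simp add: cpow)
  have geo: "(\<Sum>i\<le>k. t ^ i) \<ge> 0" "(\<Sum>i\<le>2 * k. t ^ i) \<ge> 1" if "t \<in> {-1, 0, 1}" for t :: real and k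
  proof -
    have alt: "(\<Sum>i\<le>k. (-1) ^ i :: real) = (if even k then 1 else 0)" for k by (induction k) auto
    have z: "(\<Sum>i\<le>k. 0 ^ i :: real) = 1" for k by (induction k) auto
    show "(\<Sum>i\<le>k. t ^ i) \<ge> 0" "(\<Sum>i\<le>2 * k. t ^ i) \<ge> 1" using that by (auto simp: alt z)
  qed
  have r1: "r 1 = 1" using c1 by (simp add: r_def)
  have r_nonneg: "n > 0 \<Longrightarrow> r n \<ge> 0" for n
  proof (induction n rule: less_induct)
    case (less n)
    show ?case
    proof (cases "n > 1")
      case True
      show ?thesis
      proof (rule prime_factor_split[OF True])
        fix p k m assume p: "prime p" "0 < k" "n = p ^ k * m" "coprime (p ^ k) m" "0 < m" "m < n"
        have "r n = r (p ^ k) * r m" unfolding p(3) using p prime_gt_0_nat by (intro r_mult) auto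
        also have "\<dots> \<ge> 0" using less.IH[OF p(6) p(5)] geo(1)[OF cval] r_pp[OF p(1)] by (intro mult_nonneg_nonneg) auto
        finally show ?thesis .
      qed
    next
      case False
      hence "n = 1" using less.prems by simp
      thus ?thesis using r1 by simp
    qed
  qed
  have r_square: "n > 0 \<Longrightarrow> r (n ^ 2) \<ge> 1" for n
  proof (induction n rule: less_induct)
    case (less n)
    show ?case
    proof (cases "n > 1")
      case True
      show ?thesis
      proof (rule prime_factor_split[OF True])
        fix p k m assume p: "prime p" "0 < k" "n = p ^ k * m" "coprime (p ^ k) m" "0 < m" "m < n"
        have "n ^ 2 = p ^ (2 * k) * m ^ 2" unfolding p(3) by (simp add: power_mult_distrib power_mult[symmetric] mult.commute)
        moreover have "coprime (p ^ (2 * k)) (m ^ 2)" using p(2,4) by simp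
        ultimately have "r (n ^ 2) = r (p ^ (2 * k)) * r (m ^ 2)" using p(1,5) prime_gt_0_nat by (simp add: r_mult)
        also have "r (p ^ (2 * k)) * r (m ^ 2) \<ge> 1 * 1"
        proof (intro mult_mono)
          show "1 \<le> r (p ^ (2 * k))" unfolding r_pp[OF p(1)] by (rule geo(2)[OF cval])
          thus "0 \<le> r (p ^ (2 * k))" by linarith
        qed (use less.IH[OF p(6) p(5)] in auto)
        finally show ?thesis by simp
      qed
    next
      case False
      hence "n = 1" using less.prems by simp
      thus ?thesis using r1 by simp
    qed
  qed
  have bound: "ln (real s + 1) \<le> 12 * real q + 6" if s: "s \<ge> 1" for s
  proof -
    define x where "x = s ^ 2"
    have x1: "x \<ge> 1" using s by (simp add: x_def)
    have sx: "sqrt (real x) = real s" by (simp add: x_def)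
    define B where "B = (\<Sum>n=1..x. r n / sqrt (real n))"
    have "ln (real s + 1) \<le> harm s" by (rule ln_le_harm)
    also have "harm s = (\<Sum>m=1..s. 1 / sqrt (real (m ^ 2)))" by (simp add: harm_def divide_inverse)
    also have "\<dots> \<le> (\<Sum>m=1..s. r (m ^ 2) / sqrt (real (m ^ 2)))"
      using r_square by (intro sum_mono divide_right_mono) auto
    also have "\<dots> = (\<Sum>n\<in>(\<lambda>m. m ^ 2) ` {1..s}. r n / sqrt (real n))"
      by (subst sum.reindex) (auto intro!: inj_onI)
    also have "\<dots> \<le> B" unfolding B_def
      using r_nonneg by (intro sum_mono2) (auto simp: x_def power_mono Suc_le_eq intro!: power_mono)
    finally have lower: "ln (real s + 1) \<le> B" .
    have "B = (\<Sum>n=1..x. \<Sum>d | d dvd n. c d / sqrt (real d) * (1 / sqrt (real (n div d))))"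
      unfolding B_def
    proof (intro sum.cong refl)
      fix n assume "n \<in> {1..x}"
      show "r n / sqrt (real n) = (\<Sum>d | d dvd n. c d / sqrt (real d) * (1 / sqrt (real (n div d))))"
        unfolding r_def sum_divide_distrib
      proof (intro sum.cong refl)
        fix d assume "d \<in> {d. d dvd n}"
        hence "d * (n div d) = n" by simp
        hence "real d * real (n div d) = real n" by (metis of_nat_mult)
        hence "sqrt (real d) * sqrt (real (n div d)) = sqrt (real n)" by (simp add: real_sqrt_mult[symmetric])
        thus "c d / sqrt (real n) = c d / sqrt (real d) * (1 / sqrt (real (n div d)))" by simp
      qed
    qed
    also have "\<dots> = (\<Sum>d=1..x. \<Sum>m=1..x div d. c d / sqrt (real d) * (1 / sqrt (real m)))"
      by (rule sum_divisors_eq_hyperbola)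
    also have "s \<le> x" by (simp add: x_def power2_eq_square)
    hence "{1..x} = {1..s} \<union> {s<..x}" by auto
    also have "(\<Sum>d\<in>{1..s} \<union> {s<..x}. \<Sum>m=1..x div d. c d / sqrt (real d) * (1 / sqrt (real m)))
      = (\<Sum>d=1..s. \<Sum>m=1..x div d. c d / sqrt (real d) * (1 / sqrt (real m))) + (\<Sum>d\<in>{s<..x}. \<Sum>m=1..x div d. c d / sqrt (real d) * (1 / sqrt (real m)))"
      (is "_ = ?P1 + ?P2") by (rule sum.union_disjoint) auto
    finally have B_split: "B = ?P1 + ?P2" .
    \<comment> \<open>In the second part d > s forces m \<le> s; interchanging the sums leaves character sums over d, which are O(1 / sqrt s).\<close>
    have "?P2 = (\<Sum>(d, m)\<in>Sigma {s<..x} (\<lambda>d. {1..x div d}). c d / sqrt (real d) * (1 / sqrt (real m)))"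
      by (intro sum.Sigma) auto
    also have "\<dots> = (\<Sum>(m, d)\<in>Sigma {1..s} (\<lambda>m. {s<..x div m}). c d / sqrt (real d) * (1 / sqrt (real m)))"
    proof (intro sum.reindex_bij_witness[of _ "\<lambda>(m, d). (d, m)" "\<lambda>(d, m). (m, d)"], goal_cases)
      case (2 dm)
      obtain d m where dm: "dm = (d, m)" "s < d" "1 \<le> m" "m \<le> x div d" using 2 by auto
      have md: "m * d \<le> s * s" using dm by (simp add: less_eq_div_iff_mult_less_eq x_def power2_eq_square)
      have "m \<le> s"
      proof (rule ccontr)
        assume "\<not> m \<le> s"
        hence "s * s < m * d" using dm(2) by (intro mult_strict_mono') auto
        thus False using md by simp
      qed
      moreover have "d \<le> x div m" using md dm by (simp add: less_eq_div_iff_mult_less_eq x_def power2_eq_square mult.commute)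
      ultimately show ?case using dm by auto
    next
      case (4 md)
      obtain m d where md: "md = (m, d)" "s < d" "1 \<le> m" "d \<le> x div m" using 4 by auto
      have "d \<le> x" using md(4) div_le_dividend[of x m] by linarith
      moreover have "m \<le> x div d" using md by (simp add: less_eq_div_iff_mult_less_eq mult.commute)
      ultimately show ?case using md by auto
    qed auto
    also have "\<dots> = (\<Sum>m=1..s. \<Sum>d\<in>{s<..x div m}. c d / sqrt (real d) * (1 / sqrt (real m)))"
      by (intro sum.Sigma[symmetric]) auto
    also have "\<dots> = (\<Sum>m=1..s. 1 / sqrt (real m) * (\<Sum>d=Suc s..<Suc (x div m). c d * (1 / sqrt (real d))))"
    proof (intro sum.cong refl)
      fix m
      show "(\<Sum>d\<in>{s<..x div m}. c d / sqrt (real d) * (1 / sqrt (real m))) = 1 / sqrt (real m) * (\<Sum>d=Suc s..<Suc (x div m). c d * (1 / sqrt (real d)))"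
        unfolding sum_distrib_left by (rule sum.cong) auto
    qed
    also have "\<bar>\<dots>\<bar> \<le> (\<Sum>m=1..s. 1 / sqrt (real m) * (2 * real q * (1 / sqrt (real (Suc s)))))"
    proof (rule order.trans[OF sum_abs], rule sum_mono)
      fix m
      have "\<bar>\<Sum>d=Suc s..<Suc (x div m). c d * (1 / sqrt (real d))\<bar> \<le> 2 * real q * (1 / sqrt (real (Suc s)))"
        by (rule abel) (auto simp: frac_le)
      thus "\<bar>1 / sqrt (real m) * (\<Sum>d=Suc s..<Suc (x div m). c d * (1 / sqrt (real d)))\<bar> \<le> 1 / sqrt (real m) * (2 * real q * (1 / sqrt (real (Suc s))))"
        unfolding abs_mult by (simp only: abs_of_nonneg[of "1 / sqrt (real m)"] zero_le_divide_1_iff real_sqrt_ge_0_iff of_nat_0_le_iff mult_left_mono)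
    qed
    also have "\<dots> = (\<Sum>m=1..s. 1 / sqrt (real m)) * (2 * real q * (1 / sqrt (real (Suc s))))"
      by (rule sum_distrib_right[symmetric])
    also have "\<dots> \<le> (2 * sqrt (real s)) * (2 * real q * (1 / sqrt (real s)))"
      using s by (intro mult_mono sum_inv_sqrt_le mult_left_mono frac_le) auto
    also have "\<dots> = 4 * real q" using s by simp
    finally have P2: "\<bar>?P2\<bar> \<le> 4 * real q" .
    define h where "h = (\<lambda>y. \<Sum>m=1..y. 1 / sqrt (real m))"
    define u where "u = inv_sqrt_error x"
    define \<epsilon> where "\<epsilon> = (\<lambda>d. h (x div d) - (2 * sqrt (real x / real d) + u))"
    have "?P1 = (\<Sum>d=1..s. c d / sqrt (real d) * h (x div d))"
      unfolding h_def by (simp only: sum_distrib_left)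
    also have "\<dots> = (\<Sum>d=1..s. 2 * real s * (c d / real d) + u * (c d * (1 / sqrt (real d))) + c d / sqrt (real d) * \<epsilon> d)"
    proof (intro sum.cong refl)
      fix d assume d: "d \<in> {1..s}"
      have "sqrt (real x / real d) / sqrt (real d) = real s / real d"
        using d by (simp add: real_sqrt_divide sx)
      moreover have "c d / sqrt (real d) * (2 * sqrt (real x / real d)) = 2 * c d * (sqrt (real x / real d) / sqrt (real d))" by simp
      ultimately have "c d / sqrt (real d) * (2 * sqrt (real x / real d)) = 2 * real s * (c d / real d)" by simp
      moreover have "h (x div d) = 2 * sqrt (real x / real d) + u + \<epsilon> d" by (simp add: \<epsilon>_def)
      ultimately show "c d / sqrt (real d) * h (x div d) = 2 * real s * (c d / real d) + u * (c d * (1 / sqrt (real d))) + c d / sqrt (real d) * \<epsilon> d"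
        by (simp add: algebra_simps)
    qed
    also have "\<dots> = 2 * real s * (\<Sum>d=1..s. c d / real d) + u * (\<Sum>d=1..s. c d * (1 / sqrt (real d))) + (\<Sum>d=1..s. c d / sqrt (real d) * \<epsilon> d)"
      by (simp only: sum.distrib sum_distrib_left)
    finally have P1: "?P1 = 2 * real s * (\<Sum>d=1..s. c d / real d) + u * (\<Sum>d=1..s. c d * (1 / sqrt (real d))) + (\<Sum>d=1..s. c d / sqrt (real d) * \<epsilon> d)" .
    \<comment> \<open>Here the assumption enters: the sum is a partial sum of the series for L(1, chi) = 0.\<close>
    have t1: "\<bar>2 * real s * (\<Sum>d=1..s. c d / real d)\<bar> \<le> 4 * real q"
    proof -
      have "W s = of_real (\<Sum>d=1..s. c d / real d)" by (simp add: W_def cof)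
      hence "\<bar>\<Sum>d=1..s. c d / real d\<bar> \<le> 2 * real q / real (s + 1)" using W_L_bound[of s] L0 by (simp only: norm_of_real diff_zero)
      hence "\<bar>2 * real s * (\<Sum>d=1..s. c d / real d)\<bar> \<le> 2 * real s * (2 * real q / real (s + 1))" 
        unfolding abs_mult by (intro mult_mono) auto
      also have "\<dots> \<le> 4 * real q" using s by (simp add: field_simps)
      finally show ?thesis .
    qed
    have t2: "\<bar>u * (\<Sum>d=1..s. c d * (1 / sqrt (real d)))\<bar> \<le> 4 * real q"
    proof -
      have "\<bar>\<Sum>d=1..<Suc s. c d * (1 / sqrt (real d))\<bar> \<le> 2 * real q * (1 / sqrt (real 1))"
        by (rule abel) (auto simp: frac_le)
      moreover have "{1..<Suc s} = {1..s}" by auto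
      ultimately have "\<bar>\<Sum>d=1..s. c d * (1 / sqrt (real d))\<bar> \<le> 2 * real q"
        by (simp only: of_nat_1 real_sqrt_one div_by_1 mult_1_right)
      moreover have "\<bar>u\<bar> \<le> 2" using inv_sqrt_error_bounds[OF x1] by (simp add: u_def)
      ultimately have "\<bar>u\<bar> * \<bar>\<Sum>d=1..s. c d * (1 / sqrt (real d))\<bar> \<le> 2 * (2 * real q)" by (intro mult_mono) auto
      thus ?thesis by (simp add: abs_mult)
    qed
    have t3: "\<bar>\<Sum>d=1..s. c d / sqrt (real d) * \<epsilon> d\<bar> \<le> 6"
    proof -
      have "\<bar>\<Sum>d=1..s. c d / sqrt (real d) * \<epsilon> d\<bar> \<le> (\<Sum>d=1..s. 1 / sqrt (real d) * (3 / sqrt (real s)))"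
      proof (rule order.trans[OF sum_abs], rule sum_mono)
        fix d assume d: "d \<in> {1..s}"
        have "\<bar>\<epsilon> d\<bar> \<le> 3 / sqrt (real s)" unfolding \<epsilon>_def h_def u_def using d by (intro sum_inv_sqrt_approx) (auto simp: x_def)
        moreover have "\<bar>c d / sqrt (real d)\<bar> \<le> 1 / sqrt (real d)" using cval[of d] by (auto simp: abs_divide)
        ultimately show "\<bar>c d / sqrt (real d) * \<epsilon> d\<bar> \<le> 1 / sqrt (real d) * (3 / sqrt (real s))"
          unfolding abs_mult by (intro mult_mono) auto
      qed
      also have "\<dots> = (\<Sum>d=1..s. 1 / sqrt (real d)) * (3 / sqrt (real s))" by (rule sum_distrib_right[symmetric])
      also have "\<dots> \<le> 2 * sqrt (real s) * (3 / sqrt (real s))" by (intro mult_right_mono sum_inv_sqrt_le) auto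
      also have "\<dots> = 6" using s by simp
      finally show ?thesis .
    qed
    have "B \<le> 12 * real q + 6" using B_split P1 P2 t1 t2 t3 by linarith
    thus ?thesis using lower by linarith
  qed
  obtain s :: nat where s: "exp (12 * real q + 6) < real s" using reals_Archimedean2 by blast
  have "real s > 0" using s exp_gt_zero[of "12 * real q + 6"] by linarith
  hence "s \<ge> 1" by simp
  have "12 * real q + 6 = ln (exp (12 * real q + 6))" by simp
  also have "\<dots> < ln (real s + 1)" using s by (subst ln_less_cancel_iff) (auto intro: add_nonneg_pos)
  also have "\<dots> \<le> 12 * real q + 6" by (rule bound[OF \<open>s \<ge> 1\<close>])
  finally show False by simp
qed

end

section \<open>Primes congruent to 1 modulo a prime\<close>

text \<open>
  A prime power that is not a prime is n^i with i at least 2, and the sum of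
  log n / n^i over i is at most 2 log n / n^2.
\<close>

lemma sum_nonprime_mangoldt_bounded:
  obtains C where "C \<ge> 0" "\<And>x. (\<Sum>d\<in>{d\<in>{1..x}. \<not> prime d}. mangoldt d / real d) \<le> C"
proof -
  define g where "g = (\<lambda>n::nat. 2 * (ln (real n) / real n ^ 2))"
  have "summable (\<lambda>n::nat. real n powr (-3/2))" by (subst summable_real_powr_iff) simp
  hence "summable (\<lambda>n::nat. norm (real n powr (-3/2)))" by simp
  moreover have "g \<in> O(\<lambda>n. real n powr (-3/2))" unfolding g_def by real_asymp
  ultimately have sg: "summable g" by (rule summable_comparison_test_bigo)
  have g0: "g n \<ge> 0" for n by (cases "n = 0") (auto simp: g_def)
  have "(\<Sum>d\<in>{d\<in>{1..x}. \<not> prime d}. mangoldt d / real d) \<le> suminf g" for x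
  proof -
    define D where "D = {d\<in>{1..x}. \<not> prime d \<and> primepow d}"
    define f where "f = (\<lambda>(n, i). ln (real n) / real n ^ i)"
    define R where "R = {2..x} \<times> {2..x}"
    have "(\<Sum>d\<in>{d\<in>{1..x}. \<not> prime d}. mangoldt d / real d) = (\<Sum>d\<in>D. mangoldt d / real d :: real)"
      by (intro sum.mono_neutral_right) (auto simp: D_def mangoldt_def)
    also have "\<dots> \<le> (\<Sum>d\<in>D. f (aprimedivisor d, multiplicity (aprimedivisor d) d))"
    proof (rule sum_mono)
      fix d assume "d \<in> D"
      hence pp: "primepow d" by (simp add: D_def)
      have "d = aprimedivisor d ^ multiplicity (aprimedivisor d) d" using pp by (rule primepow_decompose[symmetric])
      hence "real (aprimedivisor d) ^ multiplicity (aprimedivisor d) d = real d" by (metis of_nat_power)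
      hence "f (aprimedivisor d, multiplicity (aprimedivisor d) d) = ln (real (aprimedivisor d)) / real d"
        unfolding f_def prod.case by (simp only:)
      thus "mangoldt d / real d \<le> f (aprimedivisor d, multiplicity (aprimedivisor d) d)" using pp by (simp add: mangoldt_def)
    qed
    also have "\<dots> = (\<Sum>t\<in>(\<lambda>d. (aprimedivisor d, multiplicity (aprimedivisor d) d)) ` D. f t)"
    proof (subst sum.reindex)
      show "inj_on (\<lambda>d. (aprimedivisor d, multiplicity (aprimedivisor d) d)) D"
      proof (rule inj_onI)
        fix d e assume "d \<in> D" "e \<in> D" and eq: "(aprimedivisor d, multiplicity (aprimedivisor d) d) = (aprimedivisor e, multiplicity (aprimedivisor e) e)"
        from eq have e: "aprimedivisor d = aprimedivisor e" "multiplicity (aprimedivisor d) d = multiplicity (aprimedivisor e) e"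
          unfolding prod.inject by blast+
        have pp: "primepow d" "primepow e" using \<open>d \<in> D\<close> \<open>e \<in> D\<close> by (simp_all add: D_def)
        have "d = aprimedivisor d ^ multiplicity (aprimedivisor d) d" using pp(1) by (rule primepow_decompose[symmetric])
        also have "\<dots> = aprimedivisor e ^ multiplicity (aprimedivisor e) e" by (rule arg_cong2[OF e])
        also have "\<dots> = e" using pp(2) by (rule primepow_decompose)
        finally show "d = e" .
      qed
    qed simp
    also have "\<dots> \<le> (\<Sum>t\<in>R. f t)"
    proof (rule sum_mono2)
      show "(\<lambda>d. (aprimedivisor d, multiplicity (aprimedivisor d) d)) ` D \<subseteq> R"
      proof (rule image_subsetI)
        fix d assume d: "d \<in> D"
        define p i where "p = aprimedivisor d" and "i = multiplicity p d"
        have pp: "primepow d" and d1: "1 \<le> d" "d \<le> x" "\<not> prime d" using d by (auto simp: D_def)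
        have dpi: "p ^ i = d" unfolding p_def i_def by (rule primepow_decompose[OF pp])
        have pr: "prime p" unfolding p_def using pp by (intro prime_aprimedivisor') (auto simp: primepow_def prime_gt_0_nat)
        have "p dvd d" unfolding p_def using pp primepow_gt_Suc_0[OF pp] by (intro aprimedivisor_dvd') auto
        hence "p \<le> x" using d1 dvd_imp_le[of p d] by linarith
        have "i \<noteq> 0" using dpi primepow_gt_Suc_0[OF pp] by (intro notI) simp
        moreover have "i \<noteq> 1" using dpi d1(3) pr by (intro notI) simp
        moreover have "i < p ^ i" using prime_gt_1_nat[OF pr] by (intro power_gt_expt) simp 
        hence "i \<le> x" using dpi d1 by linarith
        ultimately show "(aprimedivisor d, multiplicity (aprimedivisor d) d) \<in> R"
          using \<open>p \<le> x\<close> prime_ge_2_nat[OF pr] unfolding R_def p_def[symmetric] i_def[symmetric] by simp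
      qed
    qed (auto simp: R_def f_def)
    also have "\<dots> = (\<Sum>n\<in>{2..x}. \<Sum>i\<in>{2..x}. ln (real n) / real n ^ i)"
      unfolding R_def f_def by (rule sum.cartesian_product[symmetric])
    also have "\<dots> \<le> (\<Sum>n\<in>{2..x}. g n)"
    proof (rule sum_mono)
      fix n assume n: "n \<in> {2..x}"
      have "(\<Sum>i\<in>{2..x}. (1 / real n) ^ i) \<le> 2 * (1 / real n) ^ 2"
      proof -
        have "(\<Sum>i\<in>{2..x}. (1 / real n) ^ i) = (\<Sum>i\<in>{2..x}. (1 / real n) ^ 2 * (1 / real n) ^ (i - 2))"
        proof (intro sum.cong refl)
          fix i assume "i \<in> {2..x}"
          hence "2 + (i - 2) = i" by auto
          thus "(1 / real n) ^ i = (1 / real n) ^ 2 * (1 / real n) ^ (i - 2)" by (metis power_add)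
        qed
        also have "\<dots> \<le> (\<Sum>i\<in>{2..x}. (1 / real n) ^ 2 * (1 / 2) ^ (i - 2))"
          using n by (intro sum_mono mult_left_mono power_mono frac_le) auto
        also have "\<dots> = (1 / real n) ^ 2 * (\<Sum>i\<in>{2..x}. (1 / 2) ^ (i - 2))" by (simp add: sum_distrib_left)
        also have "\<dots> \<le> (1 / real n) ^ 2 * 2"
        proof (rule mult_left_mono)
          have "(\<Sum>i<m. (1 / 2 :: real) ^ i) = 2 - 2 * (1/2) ^ m" for m by (induction m) auto
          moreover have "(\<Sum>i\<in>{2..x}. (1 / 2 :: real) ^ (i - 2)) = (\<Sum>i<x-1. (1 / 2) ^ i)"
            by (intro sum.reindex_bij_witness[of _ "\<lambda>i. i + 2" "\<lambda>i. i - 2"]) (use n in auto)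
          ultimately show "(\<Sum>i\<in>{2..x}. (1 / 2 :: real) ^ (i - 2)) \<le> 2" by simp
        qed simp
        finally show ?thesis by (simp only: mult.commute)
      qed
      hence "ln (real n) * (\<Sum>i\<in>{2..x}. (1 / real n) ^ i) \<le> ln (real n) * (2 * (1 / real n) ^ 2)" using n by (intro mult_left_mono) auto
      thus "(\<Sum>i\<in>{2..x}. ln (real n) / real n ^ i) \<le> g n"
        by (simp add: g_def sum_distrib_left power_divide mult.commute)
    qed
    also have "\<dots> \<le> suminf g" using sg g0 by (intro sum_le_suminf) auto
    finally show ?thesis .
  qed
  moreover have "suminf g \<ge> 0" using sg g0 by (rule suminf_nonneg)
  ultimately show ?thesis by (intro that)
qed

definition root_of_unity :: "nat \<Rightarrow> nat \<Rightarrow> complex" where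
  "root_of_unity n j = exp (2 * of_real pi * \<i> * of_nat j / of_nat n)"

lemma root_of_unity_power: "n > 0 \<Longrightarrow> root_of_unity n j ^ n = 1"
  unfolding root_of_unity_def by (rule complex_root_unity) auto

lemma norm_root_of_unity: "norm (root_of_unity n j) = 1"
  by (simp add: root_of_unity_def norm_exp_eq_Re)

lemma root_of_unity_eq_1_iff: "n > 0 \<Longrightarrow> root_of_unity n j = 1 \<longleftrightarrow> n dvd j"
  unfolding root_of_unity_def by (intro complex_root_unity_eq_1) auto

lemma root_of_unity_add: "root_of_unity n (i + j) = root_of_unity n i * root_of_unity n j"
  by (simp add: root_of_unity_def exp_add[symmetric] add_divide_distrib ring_distribs)

lemma root_of_unity_power_commute: "root_of_unity n i ^ j = root_of_unity n j ^ i"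
  by (simp add: root_of_unity_def exp_of_nat_mult[symmetric] mult_ac)

lemma root_of_unity_cong:
  assumes "n > 0" "[a = b] (mod n)"
  shows "root_of_unity n j ^ a = root_of_unity n j ^ b"
proof -
  have "root_of_unity n j ^ a = root_of_unity n j ^ (a mod n)" for a
  proof -
    have "root_of_unity n j ^ a = root_of_unity n j ^ (n * (a div n) + a mod n)" by simp
    also have "\<dots> = (root_of_unity n j ^ n) ^ (a div n) * root_of_unity n j ^ (a mod n)" by (simp only: power_add power_mult)
    also have "\<dots> = root_of_unity n j ^ (a mod n)" by (simp only: root_of_unity_power[OF assms(1)] power_one mult_1_left)
    finally show ?thesis .
  qed
  thus ?thesis using assms(2) unfolding cong_def by metis
qed

lemma sum_root_of_unity_power:
  assumes "n > 0"
  shows "(\<Sum>i<n. root_of_unity n j ^ i) = (if n dvd j then of_nat n else 0)"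
proof (cases "n dvd j")
  case True
  hence "root_of_unity n j = 1" using root_of_unity_eq_1_iff[OF assms] by simp
  thus ?thesis using True by simp
next
  case False
  hence "root_of_unity n j \<noteq> 1" using root_of_unity_eq_1_iff[OF assms] by simp
  hence "(\<Sum>i<n. root_of_unity n j ^ i) = (root_of_unity n j ^ n - 1) / (root_of_unity n j - 1)"
    by (rule geometric_sum)
  thus ?thesis using False by (simp add: root_of_unity_power[OF assms])
qed

lemma cnj_root_of_unity:
  assumes "n > 0" "j \<le> n"
  shows "cnj (root_of_unity n j) = root_of_unity n (n - j)"
proof -
  define a b where "a = root_of_unity n j" and "b = root_of_unity n (n - j)"
  have "a * b = root_of_unity n n" using assms(2) by (simp add: a_def b_def root_of_unity_add[symmetric])
  also have "\<dots> = 1" using root_of_unity_eq_1_iff[OF assms(1), of n] by simp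
  finally have ab: "a * b = 1" .
  have "a * cnj a = 1" using norm_root_of_unity[of n j] complex_norm_square[of a] by (simp add: a_def)
  hence "cnj a = cnj a * (a * b)" using ab by simp
  also have "\<dots> = (a * cnj a) * b" by (simp add: mult_ac)
  also have "\<dots> = b" using \<open>a * cnj a = 1\<close> by simp
  finally show ?thesis by (simp add: a_def b_def)
qed

text \<open>
  A primitive root identifies the units modulo q with a cyclic group, whose characters are
  given by roots of unity.
\<close>

locale primitive_root_modulo_prime =
  fixes q g :: nat
  assumes q: "prime q" and g: "residue_primroot q g"
begin

definition \<phi> :: nat where "\<phi> = q - 1"

lemma phi_pos: "\<phi> > 0" using prime_gt_1_nat[OF q] by (simp add: \<phi>_def)

lemma powers_bij: "bij_betw (\<lambda>i. g ^ i mod q) {..<\<phi>} {0<..<q}"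
  using residue_primroot_is_generator[of q g] g q prime_gt_1_nat[OF q] by (simp add: totatives_prime totient_prime \<phi>_def)

definition dlog :: "nat \<Rightarrow> nat" where
  "dlog n = inv_into {..<\<phi>} (\<lambda>i. g ^ i mod q) (n mod q)"

lemma dlog:
  assumes "\<not> q dvd n"
  shows "dlog n < \<phi>" "[g ^ dlog n = n] (mod q)"
proof -
  have "n mod q \<in> {0<..<q}" using assms q prime_gt_0_nat by (auto simp: mod_greater_zero_iff_not_dvd)
  hence im: "n mod q \<in> (\<lambda>i. g ^ i mod q) ` {..<\<phi>}" using powers_bij by (simp add: bij_betw_def)
  show "dlog n < \<phi>" using inv_into_into[OF im] by (simp add: dlog_def)
  show "[g ^ dlog n = n] (mod q)" using f_inv_into_f[OF im] by (simp add: dlog_def cong_def)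
qed

lemma cong_powers_iff: "[g ^ a = g ^ b] (mod q) \<longleftrightarrow> [a = b] (mod \<phi>)"
proof -
  have "coprime q g" "ord q g = \<phi>" using g q by (auto simp: residue_primroot_def totient_prime \<phi>_def)
  thus ?thesis using order_divides_expdiff[of q g a b] by simp
qed

lemma dlog_mult:
  assumes "\<not> q dvd m" "\<not> q dvd n"
  shows "[dlog (m * n) = dlog m + dlog n] (mod \<phi>)"
proof -
  have "\<not> q dvd m * n" using assms q by (simp add: prime_dvd_mult_iff)
  hence "[g ^ dlog (m * n) = m * n] (mod q)" by (rule dlog)
  also have "[m * n = g ^ dlog m * g ^ dlog n] (mod q)" using dlog(2)[OF assms(1)] dlog(2)[OF assms(2)] by (intro cong_mult) (auto intro: cong_sym)
  also have "g ^ dlog m * g ^ dlog n = g ^ (dlog m + dlog n)" by (simp add: power_add)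
  finally show ?thesis by (simp only: cong_powers_iff)
qed

lemma dlog_dvd_iff:
  assumes "\<not> q dvd n"
  shows "\<phi> dvd dlog n \<longleftrightarrow> n mod q = 1"
proof -
  have "\<phi> dvd dlog n \<longleftrightarrow> [dlog n = 0] (mod \<phi>)" by (simp add: cong_0_iff)
  also have "\<dots> \<longleftrightarrow> [g ^ dlog n = g ^ 0] (mod q)" by (rule cong_powers_iff[symmetric])
  also have "\<dots> \<longleftrightarrow> [n = 1] (mod q)" using dlog(2)[OF assms] by (metis cong_sym cong_trans power_0)
  also have "\<dots> \<longleftrightarrow> n mod q = 1" using prime_gt_1_nat[OF q] by (simp add: cong_def)
  finally show ?thesis .
qed

definition chi :: "nat \<Rightarrow> nat \<Rightarrow> complex" where
  "chi j n = (if q dvd n then 0 else root_of_unity \<phi> j ^ dlog n)"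

lemma chi_nonprincipal:
  assumes j: "0 < j" "j < \<phi>"
  shows "nonprincipal_character q (chi j)"
proof
  have nd: "\<not> \<phi> dvd j" using j by (auto dest: dvd_imp_le)
  show "q > 0" using prime_gt_0_nat[OF q] .
  show "chi j 1 = 1"
  proof -
    have 1: "\<not> q dvd 1" using prime_gt_1_nat[OF q] by simp
    have "\<phi> dvd dlog 1" using prime_gt_1_nat[OF q] by (subst dlog_dvd_iff[OF 1]) simp
    hence "root_of_unity \<phi> j ^ dlog 1 = root_of_unity \<phi> j ^ 0" by (intro root_of_unity_cong phi_pos) (simp add: cong_0_iff)
    thus ?thesis using 1 by (simp add: chi_def)
  qed
  show "chi j (m * n) = chi j m * chi j n" for m n
  proof (cases "q dvd m \<or> q dvd n")
    case True thus ?thesis by (auto simp: chi_def)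
  next
    case False
    hence "root_of_unity \<phi> j ^ dlog (m * n) = root_of_unity \<phi> j ^ (dlog m + dlog n)"
      by (intro root_of_unity_cong phi_pos dlog_mult) auto
    thus ?thesis using False q by (simp add: chi_def power_add prime_dvd_mult_iff)
  qed
  show "chi j (n + q) = chi j n" for n by (simp add: chi_def dlog_def)
  show "norm (chi j n) \<le> 1" for n by (simp add: chi_def norm_power norm_root_of_unity)
  show "(\<Sum>n<q. chi j n) = 0"
  proof -
    have "(\<Sum>n<q. chi j n) = (\<Sum>n\<in>{0<..<q}. root_of_unity \<phi> j ^ dlog n)"
      by (intro sum.mono_neutral_cong_right) (auto simp: chi_def dest: nat_dvd_not_less intro: Nat.gr0I)
    also have "\<dots> = (\<Sum>i<\<phi>. root_of_unity \<phi> j ^ i)"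
    proof (rule sum.reindex_bij_betw[OF powers_bij, symmetric, THEN trans], rule sum.cong[OF refl])
      fix i assume i: "i \<in> {..<\<phi>}"
      hence "g ^ i mod q \<in> {0<..<q}" using powers_bij by (auto simp: bij_betw_def)
      hence "\<not> q dvd g ^ i mod q" by (auto dest: nat_dvd_not_less)
      hence "[g ^ dlog (g ^ i mod q) = g ^ i mod q] (mod q)" by (rule dlog)
      hence "[g ^ dlog (g ^ i mod q) = g ^ i] (mod q)" by (simp add: cong_def)
      thus "root_of_unity \<phi> j ^ dlog (g ^ i mod q) = root_of_unity \<phi> j ^ i"
        unfolding cong_powers_iff by (intro root_of_unity_cong phi_pos)
    qed
    also have "\<dots> = 0" using nd by (simp add: sum_root_of_unity_power[OF phi_pos])
    finally show ?thesis .
  qed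
qed

lemma chi_orthogonal: "(\<Sum>j<\<phi>. chi j n) = (if n mod q = 1 then of_nat \<phi> else 0)"
proof (cases "q dvd n")
  case True
  hence "n mod q \<noteq> 1" by (simp add: dvd_eq_mod_eq_0)
  thus ?thesis using True by (simp add: chi_def)
next
  case False
  have "(\<Sum>j<\<phi>. chi j n) = (\<Sum>j<\<phi>. root_of_unity \<phi> (dlog n) ^ j)"
    using False by (simp add: chi_def root_of_unity_power_commute[of _ _ "dlog n"])
  thus ?thesis using False by (simp add: sum_root_of_unity_power[OF phi_pos] dlog_dvd_iff)
qed

lemma chi_cnj: "j \<le> \<phi> \<Longrightarrow> chi (\<phi> - j) n = cnj (chi j n)"
  by (simp add: chi_def cnj_root_of_unity[OF phi_pos, symmetric])

lemma chi_zero: "chi 0 n = (if q dvd n then 0 else 1)"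
  by (simp add: chi_def root_of_unity_def)

abbreviation "SS j \<equiv> nonprincipal_character.S (chi j)"
abbreviation "LL j \<equiv> nonprincipal_character.L (chi j)"

text \<open>
  By orthogonality, (q - 1) T is the sum of S0, the contribution of the principal character, and
  of the sums S of the nonprincipal characters.
\<close>

definition T :: "nat \<Rightarrow> real" where "T x = (\<Sum>d\<in>{d\<in>{1..x}. d mod q = 1}. mangoldt d / real d)"

definition S0 :: "nat \<Rightarrow> real" where "S0 x = (\<Sum>d\<in>{d\<in>{1..x}. \<not> q dvd d}. mangoldt d / real d)"

lemma T_eq: "of_nat \<phi> * of_real (T x) = of_real (S0 x) + (\<Sum>j\<in>{1..<\<phi>}. SS j x)"
proof -
  define w :: "nat \<Rightarrow> complex" where "w = (\<lambda>d. of_real (mangoldt d / real d))"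
  have SS: "SS j x = (\<Sum>d=1..x. chi j d * w d)" if "j \<in> {1..<\<phi>}" for j
  proof -
    interpret nonprincipal_character q "chi j" using that by (intro chi_nonprincipal) auto
    show ?thesis by (simp add: S_def w_def)
  qed
  have "of_nat \<phi> * of_real (T x) = (\<Sum>d=1..x. (if d mod q = 1 then of_nat \<phi> else 0) * w d)"
    unfolding T_def of_real_sum sum_distrib_left
    by (intro sum.mono_neutral_cong_left) (auto simp: w_def)
  also have "\<dots> = (\<Sum>d=1..x. \<Sum>j<\<phi>. chi j d * w d)" by (simp only: chi_orthogonal[symmetric] sum_distrib_right)
  also have "\<dots> = (\<Sum>j<\<phi>. \<Sum>d=1..x. chi j d * w d)" by (rule sum.swap)
  also have "{..<\<phi>} = insert 0 {1..<\<phi>}" using phi_pos by auto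
  also have "(\<Sum>j\<in>insert 0 {1..<\<phi>}. \<Sum>d=1..x. chi j d * w d) = (\<Sum>d=1..x. chi 0 d * w d) + (\<Sum>j\<in>{1..<\<phi>}. SS j x)"
    by (subst sum.insert) (auto simp: SS)
  also have "(\<Sum>d=1..x. chi 0 d * w d) = of_real (S0 x)"
    unfolding S0_def of_real_sum by (intro sum.mono_neutral_cong_right) (auto simp: chi_zero w_def)
  finally show ?thesis .
qed

lemma S0_bounded: obtains C where "\<And>x. x \<ge> 1 \<Longrightarrow> \<bar>S0 x - ln (real x)\<bar> \<le> C"
proof -
  obtain C where C: "C \<ge> 0" "\<And>x. (\<Sum>d\<in>{d\<in>{1..x}. \<not> prime d}. mangoldt d / real d) \<le> C"
    by (rule sum_nonprime_mangoldt_bounded) blast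
  define D where "D = mangoldt q / real q + C"
  have "\<bar>S0 x - ln (real x)\<bar> \<le> 5 + D" if "x \<ge> 1" for x
  proof -
    define E where "E = (\<Sum>d\<in>{d\<in>{1..x}. q dvd d}. mangoldt d / real d :: real)"
    have nn: "mangoldt d / real d \<ge> (0::real)" for d by (simp add: mangoldt_nonneg)
    have "(\<Sum>d=1..x. mangoldt d / real d) = S0 x + E"
      unfolding S0_def E_def by (subst sum.union_disjoint[symmetric]) (auto intro!: sum.cong)
    moreover have "E \<ge> 0" unfolding E_def by (intro sum_nonneg nn)
    moreover have "E \<le> D"
    proof -
      have "E \<le> (\<Sum>d\<in>{q} \<union> {d\<in>{1..x}. \<not> prime d}. mangoldt d / real d)"
        unfolding E_def using q nn by (intro sum_mono2) (auto dest!: primes_dvd_imp_eq[OF q])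
      also have "\<dots> = mangoldt q / real q + (\<Sum>d\<in>{d\<in>{1..x}. \<not> prime d}. mangoldt d / real d)"
        using q by (subst sum.union_disjoint) auto
      also have "\<dots> \<le> D" unfolding D_def using C(2)[of x] by simp
      finally show ?thesis .
    qed
    ultimately show ?thesis using mertens_mangoldt[OF that] by linarith
  qed
  thus ?thesis by (rule that)
qed

lemma T_nonneg: "T x \<ge> 0" unfolding T_def by (intro sum_nonneg) (simp add: mangoldt_nonneg)

lemma Re_SS_bounded_above:
  assumes "j \<in> {1..<\<phi>}"
  obtains C where "\<And>x. x \<ge> 1 \<Longrightarrow> Re (SS j x) \<le> C"
proof -
  interpret nonprincipal_character q "chi j" using assms by (intro chi_nonprincipal) auto
  show ?thesis
  proof (cases "L = 0")
    case True
    have "Re (S x) \<le> 2 * real q" if "x \<ge> 1" for x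
    proof -
      have "ln (real x) + Re (S x) \<le> 2 * real q" 
        using ln_plus_S_bounded[OF True that] complex_Re_le_cmod[of "of_real (ln (real x)) + S x"]
        by (simp only: plus_complex.sel Re_complex_of_real)
      moreover have "ln (real x) \<ge> 0" using that by simp
      ultimately show ?thesis by linarith
    qed
    thus ?thesis by (rule that)
  next
    case False
    have "Re (S x) \<le> (1 + 12 * real q) / norm L" if "x \<ge> 1" for x
    proof -
      have "norm (S x) \<le> (1 + 12 * real q) / norm L"
        using L_times_S_bounded[OF that] False by (simp add: norm_mult field_simps)
      thus ?thesis using complex_Re_le_cmod[of "S x"] by linarith
    qed
    thus ?thesis by (rule that)
  qed
qed

lemma L_conj:
  assumes j: "j \<in> {1..<\<phi>}" and L0: "LL j = 0"
  shows "LL (\<phi> - j) = 0"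
proof -
  interpret A: nonprincipal_character q "chi j" using j by (intro chi_nonprincipal) auto
  interpret B: nonprincipal_character q "chi (\<phi> - j)" using j by (intro chi_nonprincipal) auto
  have W_cnj: "B.W = (\<lambda>y. cnj (A.W y))"
    unfolding A.W_def B.W_def fun_eq_iff using j by (simp add: chi_cnj)
  have "B.W \<longlonglongrightarrow> cnj A.L" unfolding W_cnj by (intro tendsto_cnj A.W_convergent)
  hence "B.L = cnj A.L" using B.W_convergent LIMSEQ_unique by blast
  thus ?thesis using L0 by simp
qed

text \<open>
  If L(1, chi) = 0 for a nonreal character, then the conjugate character vanishes as well. Each of
  the two contributes - log x to the nonnegative sum over d = 1 mod q, the principal character
  contributes only + log x once, and all others are bounded above: a contradiction for large x. A
  character equal to its own conjugate is real and was treated before.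
\<close>

lemma L_nonzero:
  assumes j: "j \<in> {1..<\<phi>}"
  shows "LL j \<noteq> 0"
proof
  assume L0: "LL j = 0"
  interpret A: nonprincipal_character q "chi j" using j by (intro chi_nonprincipal) auto
  define j' where "j' = \<phi> - j"
  have j': "j' \<in> {1..<\<phi>}" using j by (auto simp: j'_def)
  interpret B: nonprincipal_character q "chi j'" using j' by (intro chi_nonprincipal) auto
  show False
  proof (cases "j' = j")
    case True
    hence "j + j = \<phi>" using j by (simp add: j'_def)
    hence "root_of_unity \<phi> j ^ 2 = 1"
      using root_of_unity_add[of \<phi> j j] root_of_unity_eq_1_iff[OF phi_pos, of \<phi>] by (simp add: power2_eq_square)
    hence r: "root_of_unity \<phi> j = 1 \<or> root_of_unity \<phi> j = -1" by (simp add: power2_eq_1_iff)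
    have "chi j n \<in> {-1, 0, 1}" for n
      using r by (cases "even (dlog n)") (auto simp: chi_def)
    from A.real_character_nonvanishing[OF this] L0 show False by simp
  next
    case False
    have B0: "B.L = 0" unfolding j'_def by (rule L_conj[OF j L0])
    have "\<forall>i\<in>{1..<\<phi>}. \<exists>C. \<forall>x\<ge>1. Re (SS i x) \<le> C" 
    proof
      fix i assume "i \<in> {1..<\<phi>}"
      then obtain C where "\<And>x. x \<ge> 1 \<Longrightarrow> Re (SS i x) \<le> C" by (rule Re_SS_bounded_above) blast
      thus "\<exists>C. \<forall>x\<ge>1. Re (SS i x) \<le> C" by auto
    qed
    from bchoice[OF this] obtain C where "\<forall>i\<in>{1..<\<phi>}. \<forall>x\<ge>1. Re (SS i x) \<le> C i" by blast
    hence C: "\<And>i x. i \<in> {1..<\<phi>} \<Longrightarrow> x \<ge> 1 \<Longrightarrow> Re (SS i x) \<le> C i" by blast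
    obtain C0 where C0: "\<And>x. x \<ge> 1 \<Longrightarrow> \<bar>S0 x - ln (real x)\<bar> \<le> C0" by (rule S0_bounded) blast
    define R where "R = {1..<\<phi>} - {j, j'}"
    \<comment> \<open>R collects the characters of which only an upper bound for the real part is needed.\<close>
    have split: "{1..<\<phi>} = insert j (insert j' R)" using j j' by (auto simp: R_def)
    have bound: "ln (real x) \<le> C0 + (\<Sum>i\<in>R. C i) + 4 * real q" if x: "x \<ge> 1" for x
    proof -
      have "0 \<le> real \<phi> * T x" by (intro mult_nonneg_nonneg T_nonneg) auto
      also have "real \<phi> * T x = Re (of_nat \<phi> * of_real (T x))" by simp
      also have "\<dots> = S0 x + (\<Sum>i\<in>{1..<\<phi>}. Re (SS i x))" unfolding T_eq by simp
      also have "(\<Sum>i\<in>{1..<\<phi>}. Re (SS i x)) = Re (SS j x) + (Re (SS j' x) + (\<Sum>i\<in>R. Re (SS i x)))"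
        unfolding split using False by (subst sum.insert, simp_all add: R_def)
      finally have "0 \<le> S0 x + (Re (SS j x) + (Re (SS j' x) + (\<Sum>i\<in>R. Re (SS i x))))" .
      moreover have "(\<Sum>i\<in>R. Re (SS i x)) \<le> (\<Sum>i\<in>R. C i)" using x by (intro sum_mono C) (auto simp: R_def)
      moreover have "ln (real x) + Re (A.S x) \<le> 2 * real q"
        using A.ln_plus_S_bounded[OF L0 x] complex_Re_le_cmod[of "of_real (ln (real x)) + A.S x"]
        by (simp only: plus_complex.sel Re_complex_of_real)
      moreover have "ln (real x) + Re (B.S x) \<le> 2 * real q"
        using B.ln_plus_S_bounded[OF B0 x] complex_Re_le_cmod[of "of_real (ln (real x)) + B.S x"]
        by (simp only: plus_complex.sel Re_complex_of_real)
      ultimately show ?thesis using C0[OF x] by linarith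
    qed
    define M where "M = C0 + (\<Sum>i\<in>R. C i) + 4 * real q"
    obtain x :: nat where x: "exp M < real x" using reals_Archimedean2 by blast
    hence "real x > 0" using exp_gt_zero[of M] by linarith
    hence "x \<ge> 1" by simp
    have "M < ln (real x)" using x \<open>real x > 0\<close> by (subst ln_exp[of M, symmetric], subst ln_less_cancel_iff) auto
    thus False using bound[OF \<open>x \<ge> 1\<close>] by (simp add: M_def)
  qed
qed

lemma T_asymptotic: obtains C where "\<And>x. x \<ge> 1 \<Longrightarrow> \<bar>real \<phi> * T x - ln (real x)\<bar> \<le> C"
proof -
  obtain C0 where C0: "\<And>x. x \<ge> 1 \<Longrightarrow> \<bar>S0 x - ln (real x)\<bar> \<le> C0" by (rule S0_bounded) blast
  define c where "c = (\<lambda>j. (1 + 12 * real q) / norm (LL j))"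
  have c: "norm (SS j x) \<le> c j" if j: "j \<in> {1..<\<phi>}" and x: "x \<ge> 1" for j x
  proof -
    interpret nonprincipal_character q "chi j" using j by (intro chi_nonprincipal) auto
    show ?thesis using L_times_S_bounded[OF x] L_nonzero[OF j] by (simp add: c_def norm_mult field_simps)
  qed
  have "\<bar>real \<phi> * T x - ln (real x)\<bar> \<le> C0 + (\<Sum>j\<in>{1..<\<phi>}. c j)" if x: "x \<ge> 1" for x
  proof -
    have "real \<phi> * T x = Re (of_nat \<phi> * of_real (T x))" by simp
    also have "\<dots> = S0 x + Re (\<Sum>j\<in>{1..<\<phi>}. SS j x)" unfolding T_eq by simp
    finally have e: "real \<phi> * T x = S0 x + Re (\<Sum>j\<in>{1..<\<phi>}. SS j x)" .
    have "\<bar>Re (\<Sum>j\<in>{1..<\<phi>}. SS j x)\<bar> \<le> norm (\<Sum>j\<in>{1..<\<phi>}. SS j x)" by (rule abs_Re_le_cmod)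
    also have "\<dots> \<le> (\<Sum>j\<in>{1..<\<phi>}. c j)" using c[OF _ x] by (rule sum_norm_le)
    finally show ?thesis using e C0[OF x] by linarith
  qed
  thus ?thesis by (rule that)
qed

end

text \<open>
  The difference of the sums T at K x and x is log K / (q - 1) up to a constant. Choosing K
  large makes it at least 1, even after discarding proper prime powers, and every term of it is at
  most log p / x.
\<close>

theorem primes_cong_1_dense:
  fixes q :: nat
  assumes q: "prime q"
  obtains K :: nat where "K > 1"
    "\<And>x. x \<ge> 1 \<Longrightarrow> real x \<le> (\<Sum>p\<in>{p\<in>{x<..K*x}. prime p \<and> p mod q = 1}. ln (real p))"
proof -
  obtain g where "residue_primroot q g" using prime_primitive_root_exists[OF prime_gt_1_nat[OF q] q] by blast
  then interpret primitive_root_modulo_prime q g using q by unfold_locales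
  obtain C where C: "\<And>x. x \<ge> 1 \<Longrightarrow> \<bar>real \<phi> * T x - ln (real x)\<bar> \<le> C" by (rule T_asymptotic) blast
  obtain D where D: "D \<ge> 0" "\<And>x. (\<Sum>d\<in>{d\<in>{1..x}. \<not> prime d}. mangoldt d / real d) \<le> D"
    by (rule sum_nonprime_mangoldt_bounded) blast
  obtain K0 :: nat where K0: "exp (real \<phi> * (1 + D) + 2 * C) < real K0" using reals_Archimedean2 by blast
  define K where "K = max 2 K0"
  have "exp (real \<phi> * (1 + D) + 2 * C) < real K" using K0 by (simp add: K_def)
  hence lnK: "real \<phi> * (1 + D) + 2 * C < ln (real K)" 
    by (subst ln_exp[symmetric], subst ln_less_cancel_iff) (use K_def in auto)
  have K1: "K > 1" by (simp add: K_def)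
  have "real x \<le> (\<Sum>p\<in>{p\<in>{x<..K*x}. prime p \<and> p mod q = 1}. ln (real p))" if x: "x \<ge> 1" for x
  proof -
    define P where "P = {p\<in>{x<..K*x}. prime p \<and> p mod q = 1}"
    have nn: "mangoldt d / real d \<ge> (0::real)" for d by (simp add: mangoldt_nonneg)
    have xK: "x \<le> K * x" using K1 by simp
    have "ln (real (K * x)) = ln (real K) + ln (real x)" using K1 x by (simp add: ln_mult_pos)
    hence "real \<phi> * (1 + D) \<le> real \<phi> * T (K * x) - real \<phi> * T x"
      using C[of "K * x"] C[OF x] lnK xK x by linarith
    hence "real \<phi> * (1 + D) \<le> real \<phi> * (T (K * x) - T x)" by (simp add: algebra_simps)
    hence "1 + D \<le> T (K * x) - T x" using phi_pos by simp
    also have "T (K * x) = T x + (\<Sum>d\<in>{d\<in>{x<..K*x}. d mod q = 1}. mangoldt d / real d)"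
      unfolding T_def by (subst sum.union_disjoint[symmetric]) (auto intro!: sum.cong intro: order.trans[OF _ xK])
    also have "(\<Sum>d\<in>{d\<in>{x<..K*x}. d mod q = 1}. mangoldt d / real d) \<le> (\<Sum>d\<in>P \<union> {d\<in>{1..K*x}. \<not> prime d}. mangoldt d / real d)"
      using nn by (intro sum_mono2) (auto simp: P_def)
    also have "\<dots> = (\<Sum>p\<in>P. mangoldt p / real p) + (\<Sum>d\<in>{d\<in>{1..K*x}. \<not> prime d}. mangoldt d / real d)"
      by (rule sum.union_disjoint) (auto simp: P_def)
    finally have "1 \<le> (\<Sum>p\<in>P. mangoldt p / real p)" using D(2)[of "K * x"] by simp
    also have "\<dots> \<le> (\<Sum>p\<in>P. ln (real p) / real x)"
      using x by (intro sum_mono) (auto simp: P_def intro!: divide_left_mono mult_pos_pos)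
    also have "\<dots> = (\<Sum>p\<in>P. ln (real p)) / real x" by (rule sum_divide_distrib[symmetric])
    finally show ?thesis using x by (simp add: P_def field_simps)
  qed
  thus ?thesis by (rule that[OF K1])
qed

section \<open>Residues of sets with pairwise power conditions, and the larger sieve\<close>

lemma sum_card_Collect_swap:
  assumes "finite X" "finite Y"
  shows "(\<Sum>a\<in>X. card {b\<in>Y. R a b}) = (\<Sum>b\<in>Y. card {a\<in>X. R a b})"
proof -
  have "(\<Sum>a\<in>X. card {b\<in>Y. R a b}) = (\<Sum>a\<in>X. \<Sum>b\<in>Y. if R a b then 1 else 0)"
    using assms by (intro sum.cong refl) (simp add: sum.If_cases Int_def)
  also have "\<dots> = (\<Sum>b\<in>Y. \<Sum>a\<in>X. if R a b then 1 else 0)" by (rule sum.swap)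
  also have "\<dots> = (\<Sum>b\<in>Y. card {a\<in>X. R a b})"
    using assms by (intro sum.cong refl) (simp add: sum.If_cases Int_def)
  finally show ?thesis .
qed

text \<open>
  The Cauchy-Schwarz inequality for the fibres of f.
\<close>

lemma card_equal_pairs:
  assumes "finite B" "finite V" "f ` B \<subseteq> V"
  shows "(card B)\<^sup>2 \<le> card V * card {(b, b'). b \<in> B \<and> b' \<in> B \<and> f b = f b'}"
proof -
  define m where "m = (\<lambda>v. card {b\<in>B. f b = v})"
  have cB: "card B = (\<Sum>v\<in>V. m v)"
  proof -
    have "card B = card (\<Union>v\<in>V. {b\<in>B. f b = v})" using assms by (intro arg_cong[of _ _ card]) auto
    also have "\<dots> = (\<Sum>v\<in>V. m v)" unfolding m_def using assms by (intro card_UN_disjoint) auto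
    finally show ?thesis .
  qed
  have "card {(b, b'). b \<in> B \<and> b' \<in> B \<and> f b = f b'} = card (\<Union>v\<in>V. {b\<in>B. f b = v} \<times> {b\<in>B. f b = v})"
    using assms by (intro arg_cong[of _ _ card]) auto
  also have "\<dots> = (\<Sum>v\<in>V. card ({b\<in>B. f b = v} \<times> {b\<in>B. f b = v}))" 
    using assms by (intro card_UN_disjoint) auto
  also have "\<dots> = (\<Sum>v\<in>V. (m v)\<^sup>2)" by (simp add: m_def card_cartesian_product power2_eq_square)
  finally have cE: "card {(b, b'). b \<in> B \<and> b' \<in> B \<and> f b = f b'} = (\<Sum>v\<in>V. (m v)\<^sup>2)" .
  have "(\<Sum>v\<in>V. real (m v))\<^sup>2 \<le> (\<Sum>v\<in>V. (real (m v))\<^sup>2) * card V"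
    by (rule sum_squared_le_sum_of_squares)
  hence "real ((card B)\<^sup>2) \<le> real (card V * card {(b, b'). b \<in> B \<and> b' \<in> B \<and> f b = f b'})"
    unfolding cB cE by (simp add: mult.commute)
  thus ?thesis by (simp only: of_nat_le_iff)
qed

text \<open>
  The a for which c a b + n and c a b' + n lie in the same coset of the kernel of x^e are
  parametrised by the quotient t of the two numbers. The quotient satisfies t^e = 1, and it
  determines a because a fractional linear map is injective.
\<close>

lemma card_same_power_residue_class:
  fixes p e c n b b' :: nat
  assumes p: "prime p" and e: "e > 0" and c: "\<not> p dvd c" and n: "\<not> p dvd n" 
    and b: "b < p" "b' < p" "b \<noteq> b'"
  shows "card {a \<in> {..<p}. \<not> p dvd c * a * b + n \<and> \<not> p dvd c * a * b' + n \<and> 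
     (c * a * b + n) ^ e mod p = (c * a * b' + n) ^ e mod p} \<le> e" (is "card ?X \<le> e")
proof -
  define T where "T = {x\<in>{..<p}. [x ^ e = 1] (mod p)}"
  have p1: "p > 1" using p by (rule prime_gt_1_nat)
  have "\<exists>t\<in>T. [t * (c * a * b' + n) = c * a * b + n] (mod p)" if a: "a \<in> ?X" for a
  proof -
    have "\<not> p dvd c * a * b' + n" and same: "[(c * a * b + n) ^ e = (c * a * b' + n) ^ e] (mod p)"
      using a unfolding cong_def by blast+
    hence "coprime p (c * a * b' + n)" using p by (intro prime_imp_coprime)
    hence "coprime (c * a * b' + n) p" by (simp add: coprime_commute)
    then obtain w where w: "[(c * a * b' + n) * w = 1] (mod p)" by (metis cong_solve_coprime_nat One_nat_def)
    define t where "t = ((c * a * b + n) * w) mod p"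
    have "[t ^ e = ((c * a * b + n) * w) ^ e] (mod p)" by (simp add: t_def cong_def power_mod)
    also have "((c * a * b + n) * w) ^ e = (c * a * b + n) ^ e * w ^ e" by (rule power_mult_distrib)
    also have "[\<dots> = (c * a * b' + n) ^ e * w ^ e] (mod p)" by (intro cong_mult cong_refl same)
    also have "(c * a * b' + n) ^ e * w ^ e = ((c * a * b' + n) * w) ^ e" by (rule power_mult_distrib[symmetric])
    also have "[\<dots> = 1 ^ e] (mod p)" by (rule cong_pow[OF w])
    finally have "[t ^ e = 1] (mod p)" unfolding power_one .
    moreover have "t < p" using p1 by (simp add: t_def)
    ultimately have "t \<in> T" unfolding T_def by blast
    moreover have "[t * (c * a * b' + n) = ((c * a * b + n) * w) * (c * a * b' + n)] (mod p)"
      by (intro cong_mult cong_refl) (simp add: t_def cong_def)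
    hence "[t * (c * a * b' + n) = (c * a * b + n) * ((c * a * b' + n) * w)] (mod p)" by (simp add: mult_ac)
    hence "[t * (c * a * b' + n) = (c * a * b + n) * 1] (mod p)"
      by (rule cong_trans) (intro cong_mult cong_refl w)
    ultimately show ?thesis by auto
  qed
  hence "\<forall>a\<in>?X. \<exists>t. t \<in> T \<and> [t * (c * a * b' + n) = c * a * b + n] (mod p)" by blast
  from bchoice[OF this] obtain \<tau> where \<tau>: "\<And>a. a \<in> ?X \<Longrightarrow> \<tau> a \<in> T \<and> [\<tau> a * (c * a * b' + n) = c * a * b + n] (mod p)" by blast
  have inj: "inj_on \<tau> ?X"
  proof (rule inj_onI)
    fix a1 a2 assume a: "a1 \<in> ?X" "a2 \<in> ?X" "\<tau> a1 = \<tau> a2"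
    define t where "t = int (\<tau> a1)"
    have pp: "prime (int p)" using p by simp
    have d: "int p dvd t * (int c * int a * int b' + int n) - (int c * int a * int b + int n)" if "a = a1 \<or> a = a2" for a
    proof -
      have "[\<tau> a * (c * a * b' + n) = c * a * b + n] (mod p)" using \<tau> a that by blast
      hence "[int (\<tau> a * (c * a * b' + n)) = int (c * a * b + n)] (mod int p)" by (simp only: cong_int_iff)
      thus ?thesis using that a(3) by (auto simp: cong_iff_dvd_diff t_def)
    qed
    have "int p dvd (t * (int c * int a1 * int b' + int n) - (int c * int a1 * int b + int n)) - 
       (t * (int c * int a2 * int b' + int n) - (int c * int a2 * int b + int n))"
      by (intro dvd_diff d) auto
    also have "\<dots> = int c * ((t * int b' - int b) * (int a1 - int a2))" by (simp add: algebra_simps)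
    finally have "int p dvd t * int b' - int b \<or> int p dvd int a1 - int a2"
      using pp c by (simp add: prime_dvd_mult_iff)
    moreover have "\<not> int p dvd t * int b' - int b"
    proof
      assume D: "int p dvd t * int b' - int b"
      have "int p dvd (t * (int c * int a1 * int b' + int n) - (int c * int a1 * int b + int n)) - int c * int a1 * (t * int b' - int b)"
        by (intro dvd_diff d dvd_mult D) auto
      also have "\<dots> = int n * (t - 1)" by (simp add: algebra_simps)
      finally have "int p dvd t - 1" using pp n by (simp add: prime_dvd_mult_iff)
      moreover have "0 \<le> t" "t < int p" using \<tau>[OF a(1)] by (auto simp: t_def T_def)
      moreover have "\<not> int p dvd - 1" using p1 by (simp add: zdvd1_eq)
      ultimately have "t \<noteq> 0" "\<not> 0 < t - 1" using zdvd_not_zless[of "t - 1" "int p"] by auto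
      hence "t = 1" using \<open>0 \<le> t\<close> by simp
      hence "int p dvd int b' - int b" using D by simp
      hence "[int b' = int b] (mod int p)" by (simp add: cong_iff_dvd_diff)
      hence "[b' = b] (mod p)" by (simp only: cong_int_iff)
      thus False using b cong_less_modulus_unique_nat[of b' b p] by auto
    qed
    ultimately have "[int a1 = int a2] (mod int p)" by (simp add: cong_iff_dvd_diff)
    hence "[a1 = a2] (mod p)" by (simp only: cong_int_iff)
    moreover have "a1 < p" "a2 < p" using a(1,2) by blast+
    ultimately show "a1 = a2" by (intro cong_less_modulus_unique_nat[of a1 a2 p])
  qed
  have "card ?X \<le> card T" by (rule card_inj_on_le[OF inj]) (use \<tau> in \<open>auto simp: T_def\<close>)
  also have "\<dots> \<le> e" unfolding T_def by (rule roots_mod_prime_bound[OF p e])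
  finally show ?thesis .
qed

lemma card_linear_root_le_1:
  fixes p m n :: nat
  assumes p: "prime p" and m: "\<not> p dvd m" and X: "X \<subseteq> {..<p}"
  shows "card {a \<in> X. p dvd m * a + n} \<le> 1"
proof -
  have "a = b" if "a \<in> X" "b \<in> X" "p dvd m * a + n" "p dvd m * b + n" for a b
  proof -
    have "int p dvd int (m * a + n) - int (m * b + n)" by (intro dvd_diff) (use that in \<open>simp_all only: of_nat_dvd_iff\<close>)
    also have "\<dots> = int m * (int a - int b)" by (simp add: algebra_simps)
    finally have "int p dvd int a - int b" using p m by (simp add: prime_dvd_mult_iff)
    hence "[int a = int b] (mod int p)" by (simp add: cong_iff_dvd_diff)
    hence "[a = b] (mod p)" by (simp only: cong_int_iff)
    thus "a = b" using that X by (intro cong_less_modulus_unique_nat[of a b p]) auto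
  qed
  moreover have "finite {a \<in> X. p dvd m * a + n}" using X by (auto intro: finite_subset)
  ultimately show ?thesis by (auto simp: card_le_Suc0_iff_eq)
qed

text \<open>
  A second moment argument. For a residue a, let the units c a b + n with b in S be distributed
  over the q cosets of the q-th powers, which are the fibres of x^e with e = (p - 1) / q. By
  Cauchy-Schwarz the number of pairs b, b' falling into the same coset is at least 1/q of the number of
  all such pairs. Summed over all a modulo p the total excess is only O(q p s), where s is
  the size of S, since for b different from b' the two cosets coincide for at most e values of a. But every a in S has
  almost all of its c a b + n in a single coset and hence an excess of order q s^2, so that s^3 is
  O(p s).
\<close>

lemma card_le_if_pairwise_power_residues:
  fixes p q c n :: nat
  assumes p: "prime p" and q: "q \<ge> 2" "q dvd p - 1" and c: "\<not> p dvd c" and n: "\<not> p dvd n" and S: "S \<subseteq> {1..<p}"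
    and pw: "\<And>a b. a \<in> S \<Longrightarrow> b \<in> S \<Longrightarrow> a \<noteq> b \<Longrightarrow> \<exists>y. [c * a * b + n = y ^ q] (mod p)"
  shows "real (card S) \<le> 9 + sqrt (2 * real p)"
proof -
  define e where "e = (p - 1) div q"
  have p1: "p > 1" using p by (rule prime_gt_1_nat)
  have qe: "q * e = p - 1" using q by (simp add: e_def)
  have e0: "e > 0" using qe p1 by (intro Nat.gr0I) auto
  have pow_qe: "x ^ (p - 1) = (x ^ e) ^ q" "(x ^ q) ^ e = x ^ (p - 1)" for x :: nat
    by (simp_all only: qe[symmetric] power_mult[symmetric] mult.commute)
  have fS: "finite S" using S finite_subset by blast
  have S_nd: "\<not> p dvd b" if "b \<in> S" for b using that S nat_dvd_not_less[of b p] by auto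
  define s where "s = card S"
  define f where "f = (\<lambda>a b. c * a * b + n)"
  define nz where "nz = (\<lambda>a. {b \<in> S. \<not> p dvd f a b})"
  define \<kappa> where "\<kappa> = (\<lambda>x. x ^ e mod p)"
  define Eq where "Eq = (\<lambda>a. {(b, b'). b \<in> nz a \<and> b' \<in> nz a \<and> \<kappa> (f a b) = \<kappa> (f a b')})"
  have fer: "[x ^ (p - 1) = 1] (mod p)" if "\<not> p dvd x" for x using p that by (rule fermat_theorem)
  have fnz: "finite (nz a)" for a using fS by (simp add: nz_def)
  have EqS: "Eq a \<subseteq> S \<times> S" for a by (auto simp: Eq_def nz_def)
  have fEq: "finite (Eq a)" for a using finite_subset[OF EqS] fS by blast
  have CS: "(card (nz a))\<^sup>2 \<le> q * card (Eq a)" for a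
  proof -
    define V where "V = {x\<in>{..<p}. [x ^ q = 1] (mod p)}"
    have V: "card V \<le> q" unfolding V_def by (rule roots_mod_prime_bound[OF p]) (use q in auto)
    have "(\<lambda>b. \<kappa> (f a b)) ` nz a \<subseteq> V"
    proof safe
      fix b assume "b \<in> nz a"
      hence "[f a b ^ (p - 1) = 1] (mod p)" by (intro fer) (auto simp: nz_def)
      hence "[(f a b ^ e) ^ q = 1] (mod p)" by (simp only: pow_qe)
      thus "\<kappa> (f a b) \<in> V" using p1 by (simp add: V_def \<kappa>_def cong_def power_mod)
    qed
    hence "(card (nz a))\<^sup>2 \<le> card V * card (Eq a)"
      unfolding Eq_def using fnz by (intro card_equal_pairs) (auto simp: V_def)
    also have "\<dots> \<le> q * card (Eq a)" using V by (intro mult_right_mono) auto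
    finally show ?thesis .
  qed
  have row: "(real s - 2)\<^sup>2 \<le> real (card (Eq a))" if a: "a \<in> S" "s \<ge> 2" for a
  proof -
    define B where "B = nz a - {a}"
    have "\<kappa> (f a b) = 1" if "b \<in> B" for b
    proof -
      have b: "b \<in> S" "b \<noteq> a" "\<not> p dvd f a b" using that by (auto simp: B_def nz_def)
      then obtain y where y: "[f a b = y ^ q] (mod p)" using pw[of a b] a by (auto simp: f_def)
      have "\<not> p dvd y"
      proof
        assume "p dvd y"
        hence "p dvd y ^ q" using q by (intro dvd_trans[OF _ dvd_power]) auto
        thus False using b y cong_dvd_iff by blast
      qed
      hence "[y ^ (p - 1) = 1] (mod p)" by (rule fer)
      moreover have "[f a b ^ e = (y ^ q) ^ e] (mod p)" by (rule cong_pow[OF y])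
      moreover have "(y ^ q) ^ e = y ^ (p - 1)" by (rule pow_qe)
      ultimately have "[f a b ^ e = 1] (mod p)" using cong_trans by metis
      thus ?thesis using p1 by (simp add: \<kappa>_def cong_def)
    qed
    hence "B \<times> B \<subseteq> Eq a" by (auto simp: Eq_def B_def)
    hence "card (B \<times> B) \<le> card (Eq a)" by (intro card_mono fEq)
    moreover have "s \<le> card B + 2"
    proof -
      have "S \<subseteq> B \<union> ({a} \<union> {b\<in>S. p dvd (c * a) * b + n})" by (auto simp: B_def nz_def f_def)
      hence "s \<le> card (B \<union> ({a} \<union> {b\<in>S. p dvd (c * a) * b + n}))"
        unfolding s_def using fS fnz by (intro card_mono) (auto simp: B_def)
      also have "\<dots> \<le> card B + card ({a} \<union> {b\<in>S. p dvd (c * a) * b + n})" by (rule card_Un_le)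
      also have "card ({a} \<union> {b\<in>S. p dvd (c * a) * b + n}) \<le> card {a} + card {b\<in>S. p dvd (c * a) * b + n}" by (rule card_Un_le)
      also have "card {b\<in>S. p dvd (c * a) * b + n} \<le> 1"
      proof (rule card_linear_root_le_1[OF p])
        have "\<not> p dvd a" using a by (intro S_nd)
        thus "\<not> p dvd c * a" using p c by (simp add: prime_dvd_mult_iff)
      qed (use S in auto)
      finally show ?thesis by simp
    qed
    hence "(real s - 2)\<^sup>2 \<le> (real (card B))\<^sup>2" using a(2) by (intro power_mono) auto
    ultimately show ?thesis by (simp add: card_cartesian_product power2_eq_square flip: of_nat_mult)
  qed
  have total_Eq: "(\<Sum>a<p. card (Eq a)) \<le> s * p + s * s * e"
  proof -
    have "(\<Sum>a<p. card (Eq a)) = (\<Sum>a<p. card {bb \<in> S \<times> S. bb \<in> Eq a})"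
      using EqS by (intro sum.cong refl arg_cong[of _ _ card]) auto
    also have "\<dots> = (\<Sum>bb\<in>S \<times> S. card {a \<in> {..<p}. bb \<in> Eq a})"
      using fS by (intro sum_card_Collect_swap) auto
    also have "\<dots> \<le> (\<Sum>bb\<in>S \<times> S. (if fst bb = snd bb then p else 0) + e)"
    proof (rule sum_mono)
      fix bb assume "bb \<in> S \<times> S"
      then obtain b b' where bb: "bb = (b, b')" "b \<in> S" "b' \<in> S" by auto
      show "card {a \<in> {..<p}. bb \<in> Eq a} \<le> (if fst bb = snd bb then p else 0) + e"
      proof (cases "b = b'")
        case True
        have "card {a \<in> {..<p}. bb \<in> Eq a} \<le> card {..<p}" by (intro card_mono) auto
        thus ?thesis using True bb by simp
      next
        case False
        have "card {a \<in> {..<p}. bb \<in> Eq a} \<le> card {a \<in> {..<p}. \<not> p dvd c * a * b + n \<and> \<not> p dvd c * a * b' + n \<and> 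
     (c * a * b + n) ^ e mod p = (c * a * b' + n) ^ e mod p}"
          by (intro card_mono) (auto simp: bb Eq_def nz_def f_def \<kappa>_def)
        also have "\<dots> \<le> e" using False bb S by (intro card_same_power_residue_class p e0 c n) auto
        finally show ?thesis by simp
      qed
    qed
    also have "\<dots> = (\<Sum>b\<in>S. \<Sum>b'\<in>S. (if b = b' then p else 0)) + s * s * e"
      by (simp add: sum.distrib s_def card_cartesian_product sum.cartesian_product case_prod_unfold)
    also have "(\<Sum>b\<in>S. \<Sum>b'\<in>S. (if b = b' then p else 0)) = s * p" using fS by (simp add: s_def)
    finally show ?thesis .
  qed
  have total_nz: "s * s * (p - 2) \<le> (\<Sum>a<p. (card (nz a))\<^sup>2)"
  proof -
    have "(\<Sum>a<p. (card (nz a))\<^sup>2) = (\<Sum>a<p. card {bb \<in> S \<times> S. fst bb \<in> nz a \<and> snd bb \<in> nz a})"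
    proof (intro sum.cong refl)
      fix a
      have "{bb \<in> S \<times> S. fst bb \<in> nz a \<and> snd bb \<in> nz a} = nz a \<times> nz a" by (auto simp: nz_def)
      thus "(card (nz a))\<^sup>2 = card {bb \<in> S \<times> S. fst bb \<in> nz a \<and> snd bb \<in> nz a}"
        by (simp add: card_cartesian_product power2_eq_square)
    qed
    also have "\<dots> = (\<Sum>bb\<in>S \<times> S. card {a \<in> {..<p}. fst bb \<in> nz a \<and> snd bb \<in> nz a})"
      using fS by (intro sum_card_Collect_swap) auto
    also have "\<dots> \<ge> (\<Sum>bb\<in>S \<times> S. p - 2)"
    proof (rule sum_mono)
      fix bb assume "bb \<in> S \<times> S"
      then obtain b b' where bb: "bb = (b, b')" "b \<in> S" "b' \<in> S" by auto
      define G where "G = {a \<in> {..<p}. fst bb \<in> nz a \<and> snd bb \<in> nz a}"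
      have one: "card {a\<in>{..<p}. p dvd (c * b) * a + n} \<le> 1" if "b \<in> S" for b
      proof (rule card_linear_root_le_1[OF p])
        have "\<not> p dvd b" using that by (intro S_nd)
        thus "\<not> p dvd c * b" using p c by (simp add: prime_dvd_mult_iff)
      qed auto
      have "{..<p} \<subseteq> G \<union> ({a\<in>{..<p}. p dvd (c * b) * a + n} \<union> {a\<in>{..<p}. p dvd (c * b') * a + n})"
        using bb by (auto simp: G_def nz_def f_def mult_ac)
      hence "card {..<p} \<le> card (G \<union> ({a\<in>{..<p}. p dvd (c * b) * a + n} \<union> {a\<in>{..<p}. p dvd (c * b') * a + n}))"
        by (intro card_mono) (auto simp: G_def)
      also have "\<dots> \<le> card G + card ({a\<in>{..<p}. p dvd (c * b) * a + n} \<union> {a\<in>{..<p}. p dvd (c * b') * a + n})" by (rule card_Un_le)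
      also have "card ({a\<in>{..<p}. p dvd (c * b) * a + n} \<union> {a\<in>{..<p}. p dvd (c * b') * a + n}) \<le> 
         card {a\<in>{..<p}. p dvd (c * b) * a + n} + card {a\<in>{..<p}. p dvd (c * b') * a + n}" by (rule card_Un_le)
      also have "\<dots> \<le> 1 + 1" by (intro add_mono one bb)
      finally show "p - 2 \<le> card {a \<in> {..<p}. fst bb \<in> nz a \<and> snd bb \<in> nz a}" by (simp add: G_def)
    qed
    also have "(\<Sum>bb\<in>S \<times> S. p - 2) = s * s * (p - 2)" by (simp add: s_def card_cartesian_product)
    finally show ?thesis .
  qed
  show ?thesis
  proof (cases "s \<ge> 2")
    case s2: True
    define u where "u = real s"
    have u2: "u \<ge> 2" using s2 by (simp add: u_def)
    have P2: "real (p - 2) = real p - 2" using p1 by (simp add: of_nat_diff)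
    have "(\<Sum>a\<in>S. real q * (u - 2)\<^sup>2 - u\<^sup>2) \<le> (\<Sum>a\<in>S. real q * real (card (Eq a)) - (real (card (nz a)))\<^sup>2)"
    proof (rule sum_mono)
      fix a assume a: "a \<in> S"
      have "card (nz a) \<le> s" unfolding s_def using fS by (intro card_mono) (auto simp: nz_def)
      hence "(real (card (nz a)))\<^sup>2 \<le> u\<^sup>2" unfolding u_def by (intro power_mono) auto
      moreover have "real q * (u - 2)\<^sup>2 \<le> real q * real (card (Eq a))"
        using row[OF a s2] unfolding u_def by (intro mult_left_mono) auto
      ultimately show "real q * (u - 2)\<^sup>2 - u\<^sup>2 \<le> real q * real (card (Eq a)) - (real (card (nz a)))\<^sup>2" by linarith
    qed
    also have "\<dots> \<le> (\<Sum>a<p. real q * real (card (Eq a)) - (real (card (nz a)))\<^sup>2)"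
    proof (rule sum_mono2)
      fix a
      show "0 \<le> real q * real (card (Eq a)) - (real (card (nz a)))\<^sup>2"
        using CS[of a] by (simp flip: of_nat_mult of_nat_power)
    qed (use S in auto)
    also have "\<dots> = real q * real (\<Sum>a<p. card (Eq a)) - real (\<Sum>a<p. (card (nz a))\<^sup>2)"
      by (simp add: sum_subtractf sum_distrib_left)
    also have "\<dots> \<le> real q * real (s * p + s * s * e) - real (s * s * (p - 2))"
      using total_Eq total_nz by (intro diff_mono mult_left_mono) (simp_all only: of_nat_le_iff of_nat_0_le_iff)
    also have "\<dots> = real q * u * real p + u * u * real (q * e) - u * u * (real p - 2)"
      unfolding of_nat_add of_nat_mult P2 u_def by (simp add: algebra_simps)
    also have "real (q * e) = real p - 1" unfolding qe using p1 by simp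
    also have "real q * u * real p + u * u * (real p - 1) - u * u * (real p - 2) = u * (real q * real p + u)"
      by (simp add: algebra_simps)
    also have "(\<Sum>a\<in>S. real q * (u - 2)\<^sup>2 - u\<^sup>2) = u * (real q * (u - 2)\<^sup>2 - u\<^sup>2)"
      by (simp add: u_def s_def)
    finally have "real q * (u - 2)\<^sup>2 - u\<^sup>2 \<le> real q * real p + u" using u2 by simp
    hence "real q * ((u - 2)\<^sup>2 - real p) \<le> u\<^sup>2 + u" by (simp add: algebra_simps)
    moreover have "2 * ((u - 2)\<^sup>2 - real p) \<le> real q * ((u - 2)\<^sup>2 - real p) \<or> (u - 2)\<^sup>2 - real p \<le> 0"
      using q by (cases "(u - 2)\<^sup>2 - real p \<le> 0") (force, intro disjI1 mult_right_mono, auto)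
    ultimately have "2 * ((u - 2)\<^sup>2 - real p) \<le> u\<^sup>2 + u" using u2 by (smt (verit) zero_le_power2)
    hence main: "u * (u - 9) \<le> 2 * real p" by (simp add: power2_eq_square algebra_simps)
    show ?thesis
    proof (cases "u \<le> 9")
      case True thus ?thesis by (simp add: u_def s_def add_increasing2)
    next
      case False
      hence "(u - 9)\<^sup>2 \<le> u * (u - 9)" by (simp add: power2_eq_square mult_right_mono)
      hence "u - 9 \<le> sqrt (2 * real p)" using main by (intro real_le_rsqrt) auto
      thus ?thesis by (simp add: u_def s_def)
    qed
  next
    case False
    have "sqrt (2 * real p) \<ge> 0" by simp
    thus ?thesis using False unfolding s_def by linarith
  qed
qed

lemma sum_ln_prime_divisors_le:
  fixes d :: int
  assumes "finite P" "\<And>p. p \<in> P \<Longrightarrow> prime p" "d \<noteq> 0"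
  shows "(\<Sum>p\<in>{p\<in>P. int p dvd d}. ln (real p)) \<le> ln (real_of_int \<bar>d\<bar>)"
proof -
  define D where "D = nat \<bar>d\<bar>"
  have D: "D \<noteq> 0" using assms by (simp add: D_def)
  have iD: "int D = \<bar>d\<bar>" by (simp add: D_def)
  have dvd_D: "p dvd D" if "int p dvd d" for p
  proof -
    have "int p dvd int D" unfolding iD using that by simp
    thus ?thesis by (simp only: of_nat_dvd_iff)
  qed
  have "(\<Sum>p\<in>{p\<in>P. int p dvd d}. ln (real p)) = (\<Sum>p\<in>{p\<in>P. int p dvd d}. mangoldt p)"
    using assms by (intro sum.cong) auto
  also have "\<dots> \<le> (\<Sum>m | m dvd D. mangoldt m)"
    using D by (intro sum_mono2) (auto simp: mangoldt_nonneg dvd_D)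
  also have "\<dots> = ln (real D)" using mangoldt_sum[OF D, where 'a = real] by simp
  finally show ?thesis by (simp add: D_def)
qed

text \<open>
  Gallagher's larger sieve. Count the pairs in A congruent modulo p, weighted by log p: there
  are at least |A|^2 / \<nu> for each p, whereas a pair of distinct elements is congruent only
  for the prime divisors of its difference, whose total weight is at most log M.
\<close>

lemma larger_sieve:
  fixes A :: "int set" and P :: "nat set" and M \<nu> :: real
  assumes A: "finite A" "\<And>a. a \<in> A \<Longrightarrow> 0 < a \<and> of_int a \<le> M" and P: "finite P" "\<And>p. p \<in> P \<Longrightarrow> prime p"
    and \<nu>: "\<nu> > 0" "\<And>p. p \<in> P \<Longrightarrow> real (card ((\<lambda>a. a mod int p) ` A)) \<le> \<nu>"
    and M: "M \<ge> 1"
  shows "real (card A) * ((\<Sum>p\<in>P. ln (real p)) / \<nu> - ln M) \<le> (\<Sum>p\<in>P. ln (real p))"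
proof (cases "A = {}")
  case True thus ?thesis using P by (auto intro!: sum_nonneg ln_ge_zero dest!: P(2) prime_ge_1_nat)
next
  case False
  define m where "m = real (card A)"
  have m0: "m > 0" using False A by (simp add: m_def card_gt_0_iff)
  define Eq where "Eq = (\<lambda>p::nat. {(a, b). a \<in> A \<and> b \<in> A \<and> a mod int p = b mod int p})"
  have EqA: "Eq p \<subseteq> A \<times> A" for p by (auto simp: Eq_def)
  have lnp: "ln (real p) \<ge> 0" if "p \<in> P" for p using P(2)[OF that] prime_gt_0_nat[of p] by (intro ln_ge_zero) (auto simp: Suc_leI)
  have "(\<Sum>p\<in>P. ln (real p)) * m\<^sup>2 \<le> (\<Sum>p\<in>P. ln (real p) * (\<nu> * real (card (Eq p))))"
    unfolding sum_distrib_right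
  proof (intro sum_mono mult_left_mono)
    fix p assume p: "p \<in> P"
    have "(card A)\<^sup>2 \<le> card ((\<lambda>a. a mod int p) ` A) * card (Eq p)"
      unfolding Eq_def by (rule card_equal_pairs) (use A in auto)
    hence "m\<^sup>2 \<le> real (card ((\<lambda>a. a mod int p) ` A)) * real (card (Eq p))"
      unfolding m_def by (simp flip: of_nat_mult of_nat_power)
    also have "\<dots> \<le> \<nu> * real (card (Eq p))" using \<nu>(2)[OF p] by (intro mult_right_mono) auto
    finally show "m\<^sup>2 \<le> \<nu> * real (card (Eq p))" .
  qed (use lnp in auto)
  also have "\<dots> = \<nu> * (\<Sum>p\<in>P. ln (real p) * real (card (Eq p)))"
    by (simp add: sum_distrib_left mult_ac)
  also have "(\<Sum>p\<in>P. ln (real p) * real (card (Eq p))) = (\<Sum>p\<in>P. \<Sum>ab\<in>A\<times>A. if ab \<in> Eq p then ln (real p) else 0)"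
  proof (intro sum.cong refl)
    fix p
    have "Eq p = {ab \<in> A \<times> A. ab \<in> Eq p}" using EqA by auto
    thus "ln (real p) * real (card (Eq p)) = (\<Sum>ab\<in>A\<times>A. if ab \<in> Eq p then ln (real p) else 0)"
      using A by (simp add: sum.If_cases Int_def mult.commute)
  qed
  also have "\<dots> = (\<Sum>ab\<in>A\<times>A. \<Sum>p\<in>P. if ab \<in> Eq p then ln (real p) else 0)" by (rule sum.swap)
  also have "\<dots> \<le> (\<Sum>ab\<in>A\<times>A. (if fst ab = snd ab then (\<Sum>p\<in>P. ln (real p)) else 0) + ln M)"
  proof (rule sum_mono)
    fix ab assume "ab \<in> A \<times> A"
    then obtain a b where ab: "ab = (a, b)" "a \<in> A" "b \<in> A" by auto
    have lM: "ln M \<ge> 0" using M by simp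
    have "(\<Sum>p\<in>P. if ab \<in> Eq p then ln (real p) else 0) = (\<Sum>p\<in>{p\<in>P. ab \<in> Eq p}. ln (real p))"
      using P by (simp add: sum.If_cases Int_def)
    also have "{p\<in>P. ab \<in> Eq p} = {p\<in>P. int p dvd a - b}" using ab by (auto simp: Eq_def mod_eq_dvd_iff)
    also have "(\<Sum>p\<in>{p\<in>P. int p dvd a - b}. ln (real p)) \<le> (if a = b then (\<Sum>p\<in>P. ln (real p)) else 0) + ln M"
    proof (cases "a = b")
      case True thus ?thesis using lM by simp
    next
      case False
      have "(\<Sum>p\<in>{p\<in>P. int p dvd a - b}. ln (real p)) \<le> ln (real_of_int \<bar>a - b\<bar>)"
        using False P by (intro sum_ln_prime_divisors_le) auto
      also have "\<dots> \<le> ln M" using False A(2)[OF ab(2)] A(2)[OF ab(3)] M by (subst ln_le_cancel_iff) auto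
      finally show ?thesis using False by simp
    qed
    finally show "(\<Sum>p\<in>P. if ab \<in> Eq p then ln (real p) else 0) \<le> (if fst ab = snd ab then (\<Sum>p\<in>P. ln (real p)) else 0) + ln M"
      by (simp add: ab)
  qed
  also have "\<dots> = (\<Sum>a\<in>A. \<Sum>b\<in>A. if a = b then (\<Sum>p\<in>P. ln (real p)) else 0) + m\<^sup>2 * ln M"
    by (simp add: sum.distrib m_def card_cartesian_product sum.cartesian_product case_prod_unfold power2_eq_square)
  also have "(\<Sum>a\<in>A. \<Sum>b\<in>A. if a = b then (\<Sum>p\<in>P. ln (real p)) else 0) = m * (\<Sum>p\<in>P. ln (real p))"
    using A by (simp add: m_def)
  finally have "(\<Sum>p\<in>P. ln (real p)) * m\<^sup>2 \<le> \<nu> * (m * (\<Sum>p\<in>P. ln (real p)) + m\<^sup>2 * ln M)" using \<nu> by simp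
  hence "m * (m * ((\<Sum>p\<in>P. ln (real p)) / \<nu> - ln M)) \<le> m * (\<Sum>p\<in>P. ln (real p))"
    using \<nu>(1) by (simp add: field_simps power2_eq_square)
  thus ?thesis using m0 by (simp add: m_def)
qed

section \<open>Small elements and the final bound\<close>

text \<open>
  Passes from integers to residues; the class 0 is put aside at the cost of 1.
\<close>

lemma card_residues_le_if_pairwise_powers:
  fixes c n :: int and G :: "int set" and k q p :: nat
  assumes p: "prime p" "p mod q = 1" and q: "q \<ge> 2" "q dvd k" 
    and c: "\<not> int p dvd c" "\<not> int p dvd n" and G: "finite G"
    and pw: "\<And>a b. a \<in> G \<Longrightarrow> b \<in> G \<Longrightarrow> a \<noteq> b \<Longrightarrow> is_nth_power k (c * a * b + n)"
  shows "real (card ((\<lambda>a. a mod int p) ` G)) \<le> 10 + sqrt (2 * real p)"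
proof -
  have p0: "int p > 0" using prime_gt_0_nat[OF p(1)] by simp
  define R where "R = (\<lambda>a. a mod int p) ` G"
  define S where "S = nat ` (R - {0})"
  define c' n' where "c' = nat (c mod int p)" and "n' = nat (n mod int p)"
  have ic: "int c' = c mod int p" "int n' = n mod int p" using p0 by (simp_all add: c'_def n'_def)
  have R: "0 \<le> r" "r < int p" if "r \<in> R" for r using that p0 by (auto simp: R_def)
  have "real (card S) \<le> 9 + sqrt (2 * real p)"
  proof (rule card_le_if_pairwise_power_residues[OF p(1) q(1)])
    have "int p dvd int c' \<longleftrightarrow> int p dvd c" "int p dvd int n' \<longleftrightarrow> int p dvd n" by (simp_all only: ic dvd_mod_iff[OF dvd_refl])
    thus "\<not> p dvd c'" "\<not> p dvd n'" using c by simp_all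
    have "[p = 1] (mod q)" using p(2) q(1) by (simp add: cong_def)
    thus "q dvd p - 1" using prime_gt_1_nat[OF p(1)] by (metis cong_to_1_nat)
    show "S \<subseteq> {1..<p}"
    proof
      fix t assume "t \<in> S"
      then obtain r where r: "r \<in> R" "r \<noteq> 0" "t = nat r" by (auto simp: S_def)
      thus "t \<in> {1..<p}" using R[OF r(1)] by auto
    qed
    fix t u assume "t \<in> S" "u \<in> S" "t \<noteq> u"
    obtain a where a: "a \<in> G" "t = nat (a mod int p)" using \<open>t \<in> S\<close> by (auto simp: S_def R_def)
    obtain b where b: "b \<in> G" "u = nat (b mod int p)" using \<open>u \<in> S\<close> by (auto simp: S_def R_def)
    have it: "int t = a mod int p" "int u = b mod int p" using a b p0 by auto
    have "a \<noteq> b" using a b \<open>t \<noteq> u\<close> by auto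
    then obtain y where y: "c * a * b + n = y ^ k" using pw[OF a(1) b(1)] by (auto simp: is_nth_power_def)
    obtain m where m: "k = q * m" using q(2) by (rule dvdE)
    define z where "z = nat (y ^ m mod int p)"
    have iz: "int z = y ^ m mod int p" using p0 by (simp add: z_def)
    have "[int (c' * t * u + n') = c * a * b + n] (mod int p)"
      unfolding of_nat_add of_nat_mult ic it by (intro cong_add cong_mult) (simp_all add: cong_def)
    also have "c * a * b + n = (y ^ m) ^ q" using y m by (simp add: power_mult[symmetric] mult.commute)
    also have "[(y ^ m) ^ q = int (z ^ q)] (mod int p)"
      unfolding of_nat_power iz by (intro cong_pow) (simp add: cong_def)
    finally have "[c' * t * u + n' = z ^ q] (mod p)" by (simp only: cong_int_iff)
    thus "\<exists>y. [c' * t * u + n' = y ^ q] (mod p)" by blast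
  qed
  moreover have "card R \<le> card S + 1"
  proof -
    have "card S = card (R - {0})" unfolding S_def
      by (intro card_image inj_onI) (use R in \<open>auto simp: eq_nat_nat_iff\<close>)
    moreover have "card R \<le> card (R - {0}) + card {0 :: int}" using diff_card_le_card_Diff[of "{0}" R] by simp
    ultimately show ?thesis by simp
  qed
  ultimately show ?thesis unfolding R_def by linarith
qed

text \<open>
  The sieve is applied at the scale x = s^2, where s is about C1 (l + log N / l). The constant
  C1 is large enough for two purposes: the primes dividing c n must have at most half
  of the total weight, and log M must be at most half of the main term of the sieve.
\<close>

lemma small_elements_bounded:
  fixes k :: nat
  assumes k: "k \<ge> 3"
  obtains K :: real where "K > 0" "\<And>(c::int) (n::int) (l::nat) (M::real) G. c > 0 \<Longrightarrow> n \<noteq> 0 \<Longrightarrow> l \<ge> 2 \<Longrightarrow> finite G \<Longrightarrow>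
     M \<ge> 1 \<Longrightarrow> (\<And>a. a \<in> G \<Longrightarrow> 0 < a \<and> of_int a \<le> M) \<Longrightarrow>
     ln (of_int c) \<le> 6 * real k * ln (of_int \<bar>n\<bar> + 1) \<Longrightarrow> real l * ln M \<le> 6 * real k * ln (of_int \<bar>n\<bar> + 1) \<Longrightarrow>
     (\<And>a b. a \<in> G \<Longrightarrow> b \<in> G \<Longrightarrow> a \<noteq> b \<Longrightarrow> is_nth_power k (c * a * b + n)) \<Longrightarrow> 
     real (card G) \<le> K * (real l + ln (of_int \<bar>n\<bar> + 1) / real l)"
proof -
  obtain q where q: "prime q" "q dvd k" using prime_factor_nat[of k] k by auto
  obtain K where K: "K > 1" 
    "\<And>x. x \<ge> 1 \<Longrightarrow> real x \<le> (\<Sum>p\<in>{p\<in>{x<..K*x}. prime p \<and> p mod q = 1}. ln (real p))"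
    using primes_cong_1_dense[OF q(1)] by metis
  define H where "H = 10 + 2 * real K"
  define C1 where "C1 = 24 * real k * H"
  have H: "H \<ge> 14" using K(1) by (simp add: H_def)
  have "24 * real k * 14 \<le> C1" unfolding C1_def using H by (intro mult_left_mono) auto
  hence C1: "C1 \<ge> 6 * real k + 1" "C1 \<ge> 1" using k by auto
  have "real (card G) \<le> (2 * H * (C1 + 1)) * (real l + ln (of_int \<bar>n\<bar> + 1) / real l)"
    if c: "c > 0" and n: "n \<noteq> 0" and l: "l \<ge> 2" and G: "finite G" and M: "M \<ge> 1" and GM: "\<And>a. a \<in> G \<Longrightarrow> 0 < a \<and> of_int a \<le> M"
     and lc: "ln (of_int c) \<le> 6 * real k * ln (of_int \<bar>n\<bar> + 1)" and lM: "real l * ln M \<le> 6 * real k * ln (of_int \<bar>n\<bar> + 1)"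
     and pw: "\<And>a b. a \<in> G \<Longrightarrow> b \<in> G \<Longrightarrow> a \<noteq> b \<Longrightarrow> is_nth_power k (c * a * b + n)" for c n :: int and l :: nat and M :: real and G
  proof -
    define \<eta> where "\<eta> = ln (real_of_int \<bar>n\<bar> + 1)"
    have \<eta>0: "\<eta> \<ge> 0" by (simp add: \<eta>_def)
    define Y where "Y = real l + \<eta> / real l"
    have Y2: "Y \<ge> 2" using l \<eta>0 by (simp add: Y_def add_increasing2)
    have Y\<eta>: "2 * \<eta> \<le> Y ^ 2"
    proof -
      have "Y ^ 2 = real l ^ 2 + 2 * \<eta> + (\<eta> / real l) ^ 2" using l by (simp add: Y_def power2_eq_square field_simps)
      thus ?thesis by simp
    qed
    define s where "s = nat \<lceil>C1 * Y\<rceil>"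
    have "C1 * Y > 0" using C1 Y2 by simp
    hence "real s = of_int \<lceil>C1 * Y\<rceil>" unfolding s_def by simp
    hence s: "C1 * Y \<le> real s" "real s \<le> C1 * Y + 1" by linarith+
    have s1: "s \<ge> 1" using \<open>C1 * Y > 0\<close> s by linarith
    define x where "x = s ^ 2"
    have x1: "x \<ge> 1" using s1 by (simp add: x_def)
    define P0 where "P0 = {p\<in>{x<..K*x}. prime p \<and> p mod q = 1}"
    define P where "P = {p\<in>P0. \<not> int p dvd c * n}"
    define \<Sigma> where "\<Sigma> = (\<Sum>p\<in>P. ln (real p))"
    have bad: "(\<Sum>p\<in>{p\<in>P0. int p dvd c * n}. ln (real p)) \<le> (6 * real k + 1) * \<eta>"
    proof -
      have "(\<Sum>p\<in>{p\<in>P0. int p dvd c * n}. ln (real p)) \<le> ln (real_of_int \<bar>c * n\<bar>)"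
        using c n by (intro sum_ln_prime_divisors_le) (auto simp: P0_def)
      also have "\<dots> = ln (of_int c) + ln (of_int \<bar>n\<bar>)" using c n by (simp add: abs_mult ln_mult_pos)
      also have "ln (real_of_int \<bar>n\<bar>) \<le> \<eta>" unfolding \<eta>_def using n by (subst ln_le_cancel_iff) auto
      finally show ?thesis using lc unfolding \<eta>_def[symmetric] by (simp add: algebra_simps)
    qed
    \<comment> \<open>The square of l + \<eta> / l is at least 2 \<eta>, so x dominates the weight of the bad primes whatever the size of l.\<close>
    have xb: "2 * ((6 * real k + 1) * \<eta>) \<le> real x"
    proof -
      have "2 * ((6 * real k + 1) * \<eta>) = (6 * real k + 1) * (2 * \<eta>)" by simp
      also have "\<dots> \<le> C1 * Y ^ 2" using C1 Y\<eta> \<eta>0 by (intro mult_mono) auto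
      also have "\<dots> \<le> C1 ^ 2 * Y ^ 2" using C1 by (intro mult_right_mono) (auto simp: power2_eq_square)
      also have "\<dots> = (C1 * Y) ^ 2" by (simp add: power_mult_distrib)
      also have "\<dots> \<le> real s ^ 2" using s \<open>C1 * Y > 0\<close> by (intro power_mono) auto
      finally show ?thesis by (simp add: x_def)
    qed
    have "real x \<le> (\<Sum>p\<in>P0. ln (real p))" unfolding P0_def by (rule K(2)[OF x1])
    also have "\<dots> = \<Sigma> + (\<Sum>p\<in>{p\<in>P0. int p dvd c * n}. ln (real p))"
      unfolding \<Sigma>_def P_def by (subst sum.union_disjoint[symmetric]) (auto simp: P0_def intro!: sum.cong)
    finally have \<Sigma>: "real x \<le> 2 * \<Sigma>" using bad xb by linarith
    define \<nu> where "\<nu> = H * real s"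
    have \<nu>0: "\<nu> > 0" using H s1 by (simp add: \<nu>_def)
    have main: "real (card G) * (\<Sigma> / \<nu> - ln M) \<le> \<Sigma>"
      unfolding \<Sigma>_def
    proof (rule larger_sieve[OF G GM _ _ \<nu>0 _ M])
      show "finite P" by (simp add: P_def P0_def)
      show "prime p" if "p \<in> P" for p using that by (simp add: P_def P0_def)
      fix p assume "p \<in> P"
      hence p: "prime p" "p mod q = 1" "p \<le> K * x" "\<not> int p dvd c * n" by (auto simp: P_def P0_def)
      have "real (card ((\<lambda>a. a mod int p) ` G)) \<le> 10 + sqrt (2 * real p)"
        using p(4) prime_ge_2_nat[OF q(1)] by (intro card_residues_le_if_pairwise_powers[OF p(1,2) _ q(2) _ _ G pw]) auto
      also have "sqrt (2 * real p) \<le> 2 * real K * real s"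
      proof (rule real_le_lsqrt)
        have "real p \<le> real (K * x)" using p(3) by (simp only: of_nat_le_iff)
        hence "2 * real p \<le> 2 * real K * real s ^ 2" by (simp add: x_def)
        also have "\<dots> \<le> (2 * real K) ^ 2 * real s ^ 2" using K(1) by (intro mult_right_mono) (auto simp: power2_eq_square)
        finally show "2 * real p \<le> (2 * real K * real s) ^ 2" by (simp add: power_mult_distrib)
      qed auto
      also have "10 + 2 * real K * real s \<le> \<nu>" unfolding \<nu>_def H_def using s1 by (simp add: algebra_simps)
      finally show "real (card ((\<lambda>a. a mod int p) ` G)) \<le> \<nu>" by simp
    qed
    have \<Sigma>0: "\<Sigma> > 0" using \<Sigma> x1 by linarith
    have "2 * ln M \<le> \<Sigma> / \<nu>"
    proof -
      have "real l * ln M \<le> 6 * real k * \<eta>" using lM unfolding \<eta>_def .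
      hence "ln M \<le> 6 * real k * (\<eta> / real l)" using l by (simp add: field_simps)
      also have "\<dots> \<le> 6 * real k * Y" unfolding Y_def by (intro mult_left_mono) auto
      finally have "4 * H * ln M \<le> 4 * H * (6 * real k * Y)" using H by (intro mult_left_mono) auto
      also have "\<dots> = C1 * Y" by (simp add: C1_def)
      also have "\<dots> \<le> real s" by (rule s)
      finally have "real s * (4 * H * ln M) \<le> real s * real s" by (intro mult_left_mono) auto
      also have "\<dots> \<le> 2 * \<Sigma>" using \<Sigma> by (simp add: x_def power2_eq_square)
      finally show ?thesis unfolding \<nu>_def using H s1 by (simp add: field_simps)
    qed
    moreover have "t / 2 \<le> t - u" if "2 * u \<le> t" for t u :: real using that by linarith
    ultimately have "\<Sigma> / \<nu> / 2 \<le> \<Sigma> / \<nu> - ln M" by blast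
    hence "real (card G) * (\<Sigma> / \<nu> / 2) \<le> real (card G) * (\<Sigma> / \<nu> - ln M)" by (intro mult_left_mono) auto
    also note main
    finally have "\<Sigma> * real (card G) \<le> \<Sigma> * (2 * \<nu>)" using \<nu>0 by (simp add: field_simps)
    hence "real (card G) \<le> 2 * \<nu>" using \<Sigma>0 by simp
    also have "\<dots> = 2 * H * real s" by (simp add: \<nu>_def)
    also have "\<dots> \<le> 2 * H * ((C1 + 1) * Y)" using s Y2 H by (intro mult_left_mono) (auto simp: algebra_simps)
    finally show ?thesis unfolding Y_def \<eta>_def by (simp only: mult.assoc)
  qed
  note bound = this
  have "2 * H * (C1 + 1) > 0" using H C1 by simp
  thus ?thesis by (rule that[OF _ bound])
qed

lemma finite_set_largest_elements:
  fixes F :: "'a :: linorder set"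
  assumes "finite F" "m \<le> card F"
  obtains B where "B \<subseteq> F" "card B = m" "\<And>a b. a \<in> F - B \<Longrightarrow> b \<in> B \<Longrightarrow> a \<le> b"
proof -
  have "\<exists>B. B \<subseteq> F \<and> card B = m \<and> (\<forall>a\<in>F - B. \<forall>b\<in>B. a \<le> b)"
    using assms(2)
  proof (induction m)
    case 0 thus ?case by (intro exI[of _ "{}"]) auto
  next
    case (Suc m)
    then obtain B where B: "B \<subseteq> F" "card B = m" "\<And>a b. a \<in> F - B \<Longrightarrow> b \<in> B \<Longrightarrow> a \<le> b" by auto
    have fB: "finite B" using B(1) assms(1) finite_subset by blast
    have "F - B \<noteq> {}"
    proof
      assume "F - B = {}"
      hence "F = B" using B(1) by blast
      thus False using B(2) Suc.prems by simp
    qed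
    hence mx: "Max (F - B) \<in> F - B" using assms(1) by (intro Max_in) auto
    have "card (insert (Max (F - B)) B) = Suc m" using mx fB B(2) by simp
    moreover have "a \<le> b" if "a \<in> F - insert (Max (F - B)) B" "b \<in> insert (Max (F - B)) B" for a b
      using that B(3) assms(1) by auto
    ultimately show ?case using mx B(1) by (intro exI[of _ "insert (Max (F - B)) B"]) auto
  qed
  thus ?thesis using that by blast
qed

lemma finite_card_le_if_finite_subsets:
  assumes "\<And>F. F \<subseteq> A \<Longrightarrow> finite F \<Longrightarrow> real (card F) \<le> b"
  shows "finite A \<and> real (card A) \<le> b"
proof -
  have "finite A"
  proof (rule ccontr)
    assume "infinite A"
    then obtain F where "F \<subseteq> A" "finite F" "card F = nat \<lceil>b\<rceil> + 1" using infinite_arbitrarily_large by blast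
    thus False using assms[of F] by linarith
  qed
  thus ?thesis using assms by blast
qed

theorem theorem1p5:
  fixes k :: nat
  assumes "k \<ge> 3"
  shows "\<exists>C::real. C > 0 \<and>
    (\<forall>(l::nat) (n::int) (A::int set).
      l \<ge> 2 \<longrightarrow> n \<noteq> 0 \<longrightarrow> (\<forall>a\<in>A. a > 0) \<longrightarrow>
      (\<exists>a0::int. a0 > 0 \<and>
        (\<forall>B. B \<subseteq> A \<and> card B = l \<longrightarrow> is_nth_power k (a0 * (\<Prod>a\<in>B. a) + n))) \<longrightarrow>
      finite A \<and>
      real (card A) \<le> C * (real l + ln (real_of_int \<bar>n\<bar> + 1) / real l))"
proof -
  obtain K1 :: nat where K1: "\<And>(c::int) (n::int) E. c > 0 \<Longrightarrow> n \<noteq> 0 \<Longrightarrow> finite E \<Longrightarrow> (\<And>a. a \<in> E \<Longrightarrow> a > 0) \<Longrightarrow>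
     (\<And>a. a \<in> E \<Longrightarrow> lsize c a \<ge> 3 * real k * ln (of_int \<bar>n\<bar> + 1)) \<Longrightarrow>
     (\<And>a b. a \<in> E \<Longrightarrow> b \<in> E \<Longrightarrow> a \<noteq> b \<Longrightarrow> is_nth_power k (c * a * b + n)) \<Longrightarrow> card E \<le> K1"
    by (rule large_elements_bounded[OF assms]) blast
  obtain K2 :: real where K2: "K2 > 0" "\<And>(c::int) (n::int) (l::nat) (M::real) G. c > 0 \<Longrightarrow> n \<noteq> 0 \<Longrightarrow> l \<ge> 2 \<Longrightarrow> finite G \<Longrightarrow>
     M \<ge> 1 \<Longrightarrow> (\<And>a. a \<in> G \<Longrightarrow> 0 < a \<and> of_int a \<le> M) \<Longrightarrow>
     ln (of_int c) \<le> 6 * real k * ln (of_int \<bar>n\<bar> + 1) \<Longrightarrow> real l * ln M \<le> 6 * real k * ln (of_int \<bar>n\<bar> + 1) \<Longrightarrow>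
     (\<And>a b. a \<in> G \<Longrightarrow> b \<in> G \<Longrightarrow> a \<noteq> b \<Longrightarrow> is_nth_power k (c * a * b + n)) \<Longrightarrow> 
     real (card G) \<le> K2 * (real l + ln (of_int \<bar>n\<bar> + 1) / real l)"
    by (rule small_elements_bounded[OF assms]) blast
  define C where "C = 1 + real K1 + K2"
  have "finite A \<and> real (card A) \<le> C * (real l + ln (real_of_int \<bar>n\<bar> + 1) / real l)"
    if l: "l \<ge> 2" and n: "n \<noteq> 0" and A: "\<And>a. a \<in> A \<Longrightarrow> a > 0" and a0: "a0 > 0"
      and pw: "\<And>B. B \<subseteq> A \<Longrightarrow> card B = l \<Longrightarrow> is_nth_power k (a0 * (\<Prod>a\<in>B. a) + n)" for l n A a0
  proof (rule finite_card_le_if_finite_subsets)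
    fix F assume F: "F \<subseteq> A" "finite F"
    define \<eta> where "\<eta> = ln (real_of_int \<bar>n\<bar> + 1)"
    have \<eta>0: "\<eta> \<ge> 0" by (simp add: \<eta>_def)
    define Y where "Y = real l + \<eta> / real l"
    have Yl: "Y \<ge> real l" "Y \<ge> 1" using l \<eta>0 by (simp_all add: Y_def add_increasing2)
    have "real (card F) \<le> C * Y"
    proof (cases "card F < l")
      case True
      hence "real (card F) \<le> 1 * Y" using Yl by simp
      also have "\<dots> \<le> C * Y" using Yl K2(1) by (intro mult_right_mono) (auto simp: C_def)
      finally show ?thesis .
    next
      case False
      obtain B where B: "B \<subseteq> F" "card B = l - 2" "\<And>a b. a \<in> F - B \<Longrightarrow> b \<in> B \<Longrightarrow> a \<le> b"
        by (rule finite_set_largest_elements[of F "l - 2"]) (use F False in auto)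
      have fB: "finite B" using B(1) F(2) finite_subset by blast
      \<comment> \<open>From here on only the condition on pairs, with c in place of a0, is used.\<close>
      define c where "c = a0 * \<Prod>B"
      have Bpos: "b > 0" if "b \<in> B" for b using A F B that by blast
      have c: "c > 0" unfolding c_def using a0 Bpos by (intro mult_pos_pos prod_pos) auto
      define F' where "F' = F - B"
      have F'pos: "a > 0" if "a \<in> F'" for a using A F that by (auto simp: F'_def)
      have pairs: "is_nth_power k (c * a * b + n)" if "a \<in> F'" "b \<in> F'" "a \<noteq> b" for a b
      proof -
        have "is_nth_power k (a0 * \<Prod>(insert a (insert b B)) + n)"
          using that F B(1,2) fB l by (intro pw) (auto simp: F'_def)
        also have "a0 * \<Prod>(insert a (insert b B)) = c * a * b"
          using that fB by (simp add: F'_def c_def mult_ac)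
        finally show ?thesis .
      qed
      define E G where "E = {a\<in>F'. lsize c a \<ge> 3 * real k * \<eta>}" and "G = {a\<in>F'. lsize c a < 3 * real k * \<eta>}"
      have fin: "finite E" "finite G" using F(2) by (auto simp: E_def G_def F'_def)
      have E: "card E \<le> K1"
        by (rule K1[OF c n fin(1)]) (use F'pos pairs in \<open>auto simp: E_def \<eta>_def\<close>)
      have G: "real (card G) \<le> K2 * Y"
      proof (cases "G = {}")
        case True thus ?thesis using K2(1) Yl by simp
      next
        case False
        define M where "M = Max G"
        have MG: "M \<in> G" unfolding M_def using False fin(2) by (intro Max_in)
        have M1: "M \<ge> 1" using F'pos[of M] MG by (auto simp: G_def)
        define u where "u = ln (real_of_int M)"
        have u0: "u \<ge> 0" using M1 by (simp add: u_def)
        have sz: "ln (of_int c) / 2 + u < 3 * real k * \<eta>" using MG by (simp add: G_def lsize_def u_def)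
        \<comment> \<open>The elements absorbed into c are the largest ones, hence bound M.\<close>
        have "M ^ (l - 2) \<le> \<Prod>B"
        proof -
          have "(\<Prod>b\<in>B. M) \<le> (\<Prod>b\<in>B. b)" using B(3) MG M1 by (intro prod_mono) (auto simp: G_def F'_def)
          thus ?thesis using B(2) by simp
        qed
        also have "1 * \<Prod>B \<le> c" unfolding c_def using a0 Bpos by (intro mult_right_mono prod_nonneg) (auto intro: less_imp_le)
        hence "\<Prod>B \<le> c" by simp
        finally have "real_of_int (M ^ (l - 2)) \<le> real_of_int c" by (simp only: of_int_le_iff)
        hence "ln (real_of_int (M ^ (l - 2))) \<le> ln (real_of_int c)" using M1 c by (subst ln_le_cancel_iff) auto
        hence "real (l - 2) * u \<le> ln (real_of_int c)" using M1 by (simp add: ln_realpow u_def)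
        hence lu: "real l * u - 2 * u \<le> ln (real_of_int c)" using l by (simp add: of_nat_diff algebra_simps)
        have "real (card G) \<le> K2 * (real l + ln (of_int \<bar>n\<bar> + 1) / real l)"
        proof (rule K2(2)[OF c n l fin(2)])
          show "1 \<le> real_of_int M" using M1 by simp
          show "0 < a \<and> real_of_int a \<le> real_of_int M" if "a \<in> G" for a
            using that F'pos[of a] fin(2) by (auto simp: G_def M_def)
          show "ln (of_int c) \<le> 6 * real k * ln (of_int \<bar>n\<bar> + 1)"
            using sz u0 unfolding \<eta>_def[symmetric] by linarith
          show "real l * ln (real_of_int M) \<le> 6 * real k * ln (of_int \<bar>n\<bar> + 1)"
            using sz lu unfolding \<eta>_def[symmetric] u_def[symmetric] by linarith
        qed (use pairs in \<open>auto simp: G_def\<close>)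
        thus ?thesis by (simp add: Y_def \<eta>_def)
      qed
      have "F = B \<union> (E \<union> G)" using B(1) by (auto simp: E_def G_def F'_def)
      hence "card F \<le> card B + card (E \<union> G)" by (metis card_Un_le)
      also have "card (E \<union> G) \<le> card E + card G" by (rule card_Un_le)
      finally have "real (card F) \<le> real (card B) + real (card E) + real (card G)" by linarith
      also have "\<dots> \<le> Y + real K1 * Y + K2 * Y"
      proof (intro add_mono G)
        show "real (card B) \<le> Y" using B(2) Yl by linarith
        have "real (card E) \<le> real K1 * 1" using E by simp
        also have "\<dots> \<le> real K1 * Y" using Yl by (intro mult_left_mono) auto
        finally show "real (card E) \<le> real K1 * Y" .
      qed
      also have "\<dots> = C * Y" by (simp add: C_def algebra_simps)
      finally show ?thesis .
    qed
    thus "real (card F) \<le> C * (real l + ln (real_of_int \<bar>n\<bar> + 1) / real l)" by (simp add: Y_def \<eta>_def)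
  qed
  note bound = this
  have C0: "C > 0" using K2(1) by (simp add: C_def)
  show ?thesis
  proof (rule exI[of _ C], rule conjI[OF C0], intro allI impI)
    fix l :: nat and n :: int and A :: "int set"
    assume h: "2 \<le> l" "n \<noteq> 0" "\<forall>a\<in>A. 0 < a"
      "\<exists>a0>0. \<forall>B. B \<subseteq> A \<and> card B = l \<longrightarrow> is_nth_power k (a0 * \<Prod>B + n)"
    from h(4) obtain a0 where a0: "a0 > 0" "\<forall>B. B \<subseteq> A \<and> card B = l \<longrightarrow> is_nth_power k (a0 * \<Prod>B + n)"
      by (elim exE conjE)
    show "finite A \<and> real (card A) \<le> C * (real l + ln (real_of_int \<bar>n\<bar> + 1) / real l)"
      by (rule bound[OF h(1,2) bspec[OF h(3)] a0(1) mp[OF spec[OF a0(2)] conjI]])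
  qed
qed

end
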